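(* Let $(M,\mathcal H,\mathbf h)$ be a sub-Riemannian manifold with an integrable metric-preserving complement $\mathcal V$, let $\mathbf v$ be a metric on $\mathcal V$ with co-metric $\mathbf v^*$, and let $\mathbf g=\mathrm{pr}_{\mathcal H}^*\mathbf h+\mathrm{pr}_{\mathcal V}^*\mathbf v$. Assume that the conditions (i)--(iv) listed in the context hold, with constants $M_{\mathcal R}=1$, $\rho_{\mathcal H}$, $M_{\mathring\nabla\mathbf v^*}$, $\rho_{\Delta'\mathbf v^*}$, $M_{\mathcal{HV}}$, and let $m_{\mathcal R}$ be the constant defined there. Let $L=\Delta_{\mathbf h}'$ be the sub-Laplacian with respect to $\mathcal V$ and define $\mathsf\Gamma_2^{\mathbf h^*}$, $\mathsf\Gamma_2^{\mathbf v^*}$ with respect to $L$. Then for every $c>0$ (the value $c=\infty$, read as $c^{-1}=0$ and $c\cdot 0=0$, being also allowed when $M_{\mathcal{HV}}=M_{\mathring\nabla\mathbf v^*}=0$), for every $\ell>0$ and every $f\in C^\infty(M)$, $$\mathsf\Gamma_2^{\mathbf h^*}(f)+\ell\,\mathsf\Gamma_2^{\mathbf v^*}(f)\ \ge\ \frac1n(Lf)^2+\Big(\rho_1-\frac1\ell\Big)\mathsf\Gamma^{\mathbf h^*}(f)+(\rho_{2,0}+\rho_{2,1}\,\ell)\,\mathsf\Gamma^{\mathbf v^*}(f),$$ where $$n=\operatorname{rank}\mathcal H,\quad \rho_1=\rho_{\mathcal H}-c^{-1},\quad \rho_{2,0}=\tfrac12 m_{\mathcal R}^2-c\,(M_{\mathcal{HV}}+M_{\mathring\nabla\mathbf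 v^*})^2,\quad \rho_{2,1}=\tfrac12\rho_{\Delta'\mathbf v^*}-M_{\mathring\nabla\mathbf v^*}^2 .$$
   Context: A sub-Riemannian manifold $(M,\mathcal H,\mathbf h)$ is a connected manifold $M$ with a subbundle $\mathcal H\subseteq TM$ of rank $n\ge 2$ ($\dim M=n+\nu$) and a positive definite metric tensor $\mathbf h$ on $\mathcal H$. The morphism $\sharp^{\mathbf h^*}:T^*M\to TM$ is determined by $\sharp^{\mathbf h^*}(T^*M)=\mathcal H$ and $p(w)=\mathbf h(w,\sharp^{\mathbf h^*}p)$ for $w\in\mathcal H$; the co-metric is $\mathbf h^*(p_1,p_2)=p_1(\sharp^{\mathbf h^*}p_2)$. A complement $\mathcal V$ of $\mathcal H$ is a subbundle with $TM=\mathcal H\oplus\mathcal V$; $\mathrm{pr}_{\mathcal H},\mathrm{pr}_{\mathcal V}$ are the projections. An integrable complement $\mathcal V$ is metric-preserving if $\mathcal L_V(\mathrm{pr}_{\mathcal H}^*\mathbf h)=0$ for all $V\in\Gamma(\mathcal V)$. Given a (positive definite) metric $\mathbf v$ on $\mathcal V$, the co-metric $\mathbf v^*$ on $T^*M$ is defined analogously to $\mathbf h^*$ (it vanishes on $\operatorname{Ann}(\mathcal V)$). We write $\|e\|_{\mathbf s}=\sqrt{\mathbf s(e,e)}$ even if $\mathbf s$ is only positive semi-definite. $\mathbf g=\mathrm{pr}_{\mathcal H}^*\mathbf h+\mathrm{pr}_{\mathcal V}^*\mathbf v$ is a Riemannian metric with Levi-Civita connection $\nabla$. $\mathbf g^*$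 is the induced metric on $T^*M$, and induced norms on tensor bundles are denoted correspondingly. Connection: for vector fields $A,Z$, $$\mathring\nabla_AZ=\mathrm{pr}_{\mathcal H}\nabla_{\mathrm{pr}_{\mathcal H}A}\mathrm{pr}_{\mathcal H}Z+\mathrm{pr}_{\mathcal V}\nabla_{\mathrm{pr}_{\mathcal V}A}\mathrm{pr}_{\mathcal V}Z+\mathrm{pr}_{\mathcal H}[\mathrm{pr}_{\mathcal V}A,\mathrm{pr}_{\mathcal H}Z]+\mathrm{pr}_{\mathcal V}[\mathrm{pr}_{\mathcal H}A,\mathrm{pr}_{\mathcal V}Z],$$ extended to tensors, with Hessian $\mathring\nabla^2_{A,Z}=\mathring\nabla_A\mathring\nabla_Z-\mathring\nabla_{\mathring\nabla_AZ}$ and curvature $R^{\mathring\nabla}(X,Y)Z=\mathring\nabla_X\mathring\nabla_YZ-\mathring\nabla_Y\mathring\nabla_XZ-\mathring\nabla_{[X,Y]}Z$. For a local $\mathbf h$-orthonormal basis $A_1,\dots,A_n$ of $\mathcal H$, $\operatorname{tr}_{\mathcal H}\mathbf s(\times,\times)=\sum_i\mathbf s(A_i,A_i)$; $\operatorname{tr}$ without subscript is the full $\mathbf g$-trace. The sub-Laplacian with respect to $\mathcal V$ is $\Delta_{\mathbf h}'f=\operatorname{tr}_{\mathcal H}\mathring\nabla^2_{\times,\times}f$. For a symmetric $\mathbf s^*\in\Gamma(\operatorname{Sym}^2TM)$ set $\mathsf\Gamma^{\mathbf s^*}(f,g)=\mathbf s^*(df,dg)$, $\mathsf\Gamma^{\mathbf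 s^*}_2(f,g)=\frac12\big(L\mathsf\Gamma^{\mathbf s^*}(f,g)-\mathsf\Gamma^{\mathbf s^*}(Lf,g)-\mathsf\Gamma^{\mathbf s^*}(f,Lg)\big)$, and $\mathsf\Gamma^{\mathbf s^*}(f)=\mathsf\Gamma^{\mathbf s^*}(f,f)$, $\mathsf\Gamma_2^{\mathbf s^*}(f)=\mathsf\Gamma_2^{\mathbf s^*}(f,f)$. Curvature of $\mathcal H$: $\mathcal R(A,Z)=\mathrm{pr}_{\mathcal V}[\mathrm{pr}_{\mathcal H}A,\mathrm{pr}_{\mathcal H}Z]$, a $TM$-valued two-form. Horizontal Ricci tensor: $\operatorname{Ric}_{\mathcal H}(Z_1,Z_2)=\operatorname{tr}R^{\mathring\nabla}(\mathrm{pr}_{\mathcal H}\,\cdot\,,Z_2)Z_1$. Assumptions: (i) The length of $\mathcal R$ is bounded; $M_{\mathcal R}<\infty$ is the minimal number such that $\|\mathcal R(w,\cdot)\|_{\mathbf g^*\otimes\mathbf g}\le M_{\mathcal R}\|\mathrm{pr}_{\mathcal H}w\|_{\mathbf g}$ for all $w\in TM$, and $\mathbf v$ is normalized so that $M_{\mathcal R}=1$. (ii) $\operatorname{Ric}_{\mathcal H}(w,w)\ge\rho_{\mathcal H}\|\mathrm{pr}_{\mathcal H}w\|_{\mathbf h}^2$ for all $w\in TM$, for a constant $\rho_{\mathcal H}\in\mathbb R$. (iii) $M_{\mathring\nabla\mathbf v^*}:=\sup_M\|\mathring\nabla\mathbf v^*\|<\infty$, where the norm is the tensor norm induced by $\mathbf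 g$ on $T^*M\otimes\operatorname{Sym}^2TM$; and, with $(\Delta_{\mathbf h}'\mathbf v^* )(p,p)=\operatorname{tr}_{\mathcal H}(\mathring\nabla^2_{\times,\times}\mathbf v^* )(p,p)$, there is a constant $\rho_{\Delta'\mathbf v^*}\in\mathbb R$ with $(\Delta_{\mathbf h}'\mathbf v^* )(p,p)\ge\rho_{\Delta'\mathbf v^*}\|p\|_{\mathbf v^*}^2$ for all $p\in T^*M$. (iv) With $\operatorname{Ric}_{\mathcal{HV}}(Z_1,Z_2)=\frac12\operatorname{tr}\big(\mathbf g(Z_1,(\mathring\nabla_\times\mathcal R)(\times,Z_2))+\mathbf g(Z_2,(\mathring\nabla_\times\mathcal R)(\times,Z_1))\big)$, there is a number $M_{\mathcal{HV}}\ge0$ such that pointwise $\operatorname{Ric}_{\mathcal{HV}}(Z,Z)\ge-2M_{\mathcal{HV}}\|\mathrm{pr}_{\mathcal V}Z\|_{\mathbf v}\|\mathrm{pr}_{\mathcal H}Z\|_{\mathbf h}$ for all $Z$. Finally $m_{\mathcal R}\ge 0$ is the maximal number such that $\|\alpha(\mathcal R(\cdot,\cdot))\|_{\wedge^2\mathbf h^*}\ge m_{\mathcal R}\|\alpha\|_{\mathbf v^*}$ pointwise for all one-forms $\alpha$, where for a two-form $\eta$, $\|\eta\|^2_{\wedge^2\mathbf h^*}=\sum_{i<j}\eta(A_i,A_j)^2$. *)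

theory Defs
  imports "HOL-Analysis.Analysis"
begin

section \<open>Smooth manifolds\<close>

text \<open>For open \<open>S\<close>: all iterated directional derivatives of \<open>f\<close> up to order \<open>k\<close> exist and
  are continuous on \<open>S\<close>.\<close>

primrec ck_on :: "nat \<Rightarrow> 'x::real_normed_vector set \<Rightarrow> ('x \<Rightarrow> 'y::real_normed_vector) \<Rightarrow> bool" where
  "ck_on 0 S f \<longleftrightarrow> continuous_on S f"
| "ck_on (Suc k) S f \<longleftrightarrow>
     f differentiable_on S \<and> (\<forall>v. ck_on k S (\<lambda>x. frechet_derivative f (at x) v))"

definition smooth_on :: "'x::real_normed_vector set \<Rightarrow> ('x \<Rightarrow> 'y::real_normed_vector) \<Rightarrow> bool" where
  "smooth_on S f \<longleftrightarrow> (\<forall>k. ck_on k S f)"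

type_synonym ('a, 'e) chart = "'a set \<times> ('a \<Rightarrow> 'e)"

definition chart_inv :: "('a, 'e) chart \<Rightarrow> 'e \<Rightarrow> 'a" where
  "chart_inv c = inv_into (fst c) (snd c)"

text \<open>The manifold is the whole type \<open>'a\<close>, modelled on \<open>'e\<close>; the Hausdorff and second countability
  axioms come from the type class of \<open>'a\<close>. The atlas need not be maximal.\<close>

definition smooth_atlas ::
    "('a::{t2_space, second_countable_topology}, 'e::euclidean_space) chart set \<Rightarrow> bool" where
  "smooth_atlas A \<longleftrightarrow>
     (\<forall>p. \<exists>c\<in>A. p \<in> fst c) \<and>
     (\<forall>c\<in>A. open (fst c) \<and> open (snd c ` fst c) \<and>
        homeomorphism (fst c) (snd c ` fst c) (snd c) (chart_inv c)) \<and>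
     (\<forall>c\<in>A. \<forall>d\<in>A. smooth_on (snd c ` (fst c \<inter> fst d)) (\<lambda>x. snd d (chart_inv c x)))"

text \<open>Each tangent space \<open>T\<^sub>pM\<close> is identified with \<open>'e\<close> through one preferred chart
  \<open>chart_at A p\<close> around \<open>p\<close>: the vector \<open>w :: 'e\<close> at \<open>p\<close> is the one whose components in that chart
  are \<open>w\<close>. Thus a vector field is a function \<open>'a \<Rightarrow> 'e\<close>, a covector at \<open>p\<close> is a linear
  functional \<open>'e \<Rightarrow> real\<close>, and a subset of \<open>TM\<close> is a function \<open>'a \<Rightarrow> 'e set\<close>. Since the preferred
  chart changes with the point in no continuous way, smoothness always refers to the components in
  a fixed chart \<open>c\<close>, which are given by \<open>vec_in\<close> and \<open>vf_in\<close>.\<close>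

definition chart_at :: "('a, 'e) chart set \<Rightarrow> 'a \<Rightarrow> ('a, 'e) chart" where
  "chart_at A p = (SOME c. c \<in> A \<and> p \<in> fst c)"

definition vec_in :: "('a, 'e::euclidean_space) chart set \<Rightarrow> ('a, 'e) chart \<Rightarrow> 'a \<Rightarrow> 'e \<Rightarrow> 'e" where
  "vec_in A c q w = frechet_derivative (\<lambda>x. snd c (chart_inv (chart_at A q) x))
                      (at (snd (chart_at A q) q)) w"

definition vf_in :: "('a, 'e::euclidean_space) chart set \<Rightarrow> ('a, 'e) chart \<Rightarrow> ('a \<Rightarrow> 'e) \<Rightarrow> 'e \<Rightarrow> 'e" where
  "vf_in A c X x = vec_in A c (chart_inv c x) (X (chart_inv c x))"

definition smooth_fun_on ::
    "('a, 'e::euclidean_space) chart set \<Rightarrow> 'a set \<Rightarrow> ('a \<Rightarrow> real) \<Rightarrow> bool" where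
  "smooth_fun_on A U f \<longleftrightarrow> (\<forall>c\<in>A. smooth_on (snd c ` (fst c \<inter> U)) (\<lambda>x. f (chart_inv c x)))"

definition smooth_vf_on ::
    "('a, 'e::euclidean_space) chart set \<Rightarrow> 'a set \<Rightarrow> ('a \<Rightarrow> 'e) \<Rightarrow> bool" where
  "smooth_vf_on A U X \<longleftrightarrow> (\<forall>c\<in>A. smooth_on (snd c ` (fst c \<inter> U)) (vf_in A c X))"

abbreviation smooth_fun :: "('a, 'e::euclidean_space) chart set \<Rightarrow> ('a \<Rightarrow> real) \<Rightarrow> bool" where
  "smooth_fun A \<equiv> smooth_fun_on A UNIV"

abbreviation vfield :: "('a, 'e::euclidean_space) chart set \<Rightarrow> ('a \<Rightarrow> 'e) \<Rightarrow> bool" where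
  "vfield A \<equiv> smooth_vf_on A UNIV"

definition one_form :: "('a, 'e::euclidean_space) chart set \<Rightarrow> ('a \<Rightarrow> 'e \<Rightarrow> real) \<Rightarrow> bool" where
  "one_form A \<omega> \<longleftrightarrow> (\<forall>p. linear (\<omega> p)) \<and> (\<forall>X. vfield A X \<longrightarrow> smooth_fun A (\<lambda>p. \<omega> p (X p)))"

definition differential ::
    "('a, 'e::euclidean_space) chart set \<Rightarrow> ('a \<Rightarrow> real) \<Rightarrow> 'a \<Rightarrow> 'e \<Rightarrow> real" where
  "differential A f p = frechet_derivative (\<lambda>x. f (chart_inv (chart_at A p) x))
                          (at (snd (chart_at A p) p))"

definition along ::
    "('a, 'e::euclidean_space) chart set \<Rightarrow> ('a \<Rightarrow> 'e) \<Rightarrow> ('a \<Rightarrow> real) \<Rightarrow> 'a \<Rightarrow> real" where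
  "along A X f p = differential A f p (X p)"

text \<open>The coordinate formula \<open>[X, Y] = DY(X) - DX(Y)\<close>, in the preferred chart at \<open>p\<close>.\<close>

definition bracket ::
    "('a, 'e::euclidean_space) chart set \<Rightarrow> ('a \<Rightarrow> 'e) \<Rightarrow> ('a \<Rightarrow> 'e) \<Rightarrow> 'a \<Rightarrow> 'e" where
  "bracket A X Y p =
     (let c = chart_at A p; x = snd c p in
        frechet_derivative (vf_in A c Y) (at x) (X p) - frechet_derivative (vf_in A c X) (at x) (Y p))"

text \<open>A \<open>C\<^sup>\<infinity>\<close>-multilinear operation on fields is evaluated on vectors or covectors at \<open>p\<close>
  by extending these to global smooth fields; tensoriality makes the value at \<open>p\<close> independent of the
  extension.\<close>

definition ext_vec :: "('a, 'e::euclidean_space) chart set \<Rightarrow> 'a \<Rightarrow> 'e \<Rightarrow> 'a \<Rightarrow> 'e" where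
  "ext_vec A p w = (SOME X. vfield A X \<and> X p = w)"

definition ext_cov ::
    "('a, 'e::euclidean_space) chart set \<Rightarrow> 'a \<Rightarrow> ('e \<Rightarrow> real) \<Rightarrow> 'a \<Rightarrow> 'e \<Rightarrow> real" where
  "ext_cov A p \<alpha> = (SOME \<omega>. one_form A \<omega> \<and> \<omega> p = \<alpha>)"

definition subbundle ::
    "('a::topological_space, 'e::euclidean_space) chart set \<Rightarrow> nat \<Rightarrow> ('a \<Rightarrow> 'e set) \<Rightarrow> bool" where
  "subbundle A r B \<longleftrightarrow>
     (\<forall>p. subspace (B p) \<and> dim (B p) = r) \<and>
     (\<forall>p. \<exists>U. open U \<and> p \<in> U \<and>
        (\<exists>X :: nat \<Rightarrow> 'a \<Rightarrow> 'e. (\<forall>i<r. smooth_vf_on A U (X i)) \<and>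
           (\<forall>q\<in>U. B q = span ((\<lambda>i. X i q) ` {..<r}))))"

definition section_of ::
    "('a, 'e::euclidean_space) chart set \<Rightarrow> ('a \<Rightarrow> 'e set) \<Rightarrow> ('a \<Rightarrow> 'e) \<Rightarrow> bool" where
  "section_of A B X \<longleftrightarrow> vfield A X \<and> (\<forall>p. X p \<in> B p)"

text \<open>A positive definite smooth metric tensor on a subbundle \<open>B\<close>; its values outside \<open>B\<close> are
  irrelevant.\<close>

definition metric_on ::
    "('a::topological_space, 'e::euclidean_space) chart set \<Rightarrow> ('a \<Rightarrow> 'e set) \<Rightarrow>
     ('a \<Rightarrow> 'e \<Rightarrow> 'e \<Rightarrow> real) \<Rightarrow> bool" where
  "metric_on A B s \<longleftrightarrow>
     (\<forall>p. \<forall>u\<in>B p. \<forall>w\<in>B p. s p u w = s p w u) \<and>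
     (\<forall>p. \<forall>u\<in>B p. \<forall>u'\<in>B p. \<forall>w\<in>B p. s p (u + u') w = s p u w + s p u' w) \<and>
     (\<forall>p. \<forall>u\<in>B p. \<forall>w\<in>B p. \<forall>a. s p (a *\<^sub>R u) w = a * s p u w) \<and>
     (\<forall>p. \<forall>u\<in>B p. u \<noteq> 0 \<longrightarrow> s p u u > 0) \<and>
     (\<forall>U X Y. open U \<and> smooth_vf_on A U X \<and> smooth_vf_on A U Y \<and>
        (\<forall>q\<in>U. X q \<in> B q \<and> Y q \<in> B q) \<longrightarrow> smooth_fun_on A U (\<lambda>q. s q (X q) (Y q)))"

section \<open>Linear algebra in a single fibre\<close>

definition onb :: "'e::euclidean_space set \<Rightarrow> ('e \<Rightarrow> 'e \<Rightarrow> real) \<Rightarrow> nat \<Rightarrow> 'e" where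
  "onb S s = (SOME b. (\<forall>i<dim S. b i \<in> S) \<and>
                      (\<forall>i<dim S. \<forall>j<dim S. s (b i) (b j) = (if i = j then 1 else 0)))"

definition trace_on ::
    "'e::euclidean_space set \<Rightarrow> ('e \<Rightarrow> 'e \<Rightarrow> real) \<Rightarrow> ('e \<Rightarrow> 'e \<Rightarrow> real) \<Rightarrow> real" where
  "trace_on S s T = (\<Sum>i<dim S. T (onb S s i) (onb S s i))"

text \<open>The projection onto \<open>S\<close> along \<open>S'\<close>.\<close>

definition proj :: "'e::euclidean_space set \<Rightarrow> 'e set \<Rightarrow> 'e \<Rightarrow> 'e" where
  "proj S S' w = (THE a. a \<in> S \<and> w - a \<in> S')"

definition cosharp :: "('a \<Rightarrow> 'e set) \<Rightarrow> ('a \<Rightarrow> 'e \<Rightarrow> 'e \<Rightarrow> real) \<Rightarrow> 'a \<Rightarrow> ('e \<Rightarrow> real) \<Rightarrow> 'e" where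
  "cosharp B s p \<alpha> = (THE w. w \<in> B p \<and> (\<forall>u\<in>B p. \<alpha> u = s p u w))"

definition cometric ::
    "('a \<Rightarrow> 'e set) \<Rightarrow> ('a \<Rightarrow> 'e \<Rightarrow> 'e \<Rightarrow> real) \<Rightarrow> 'a \<Rightarrow> ('e \<Rightarrow> real) \<Rightarrow> ('e \<Rightarrow> real) \<Rightarrow> real" where
  "cometric B s p \<alpha> \<beta> = \<alpha> (cosharp B s p \<beta>)"

section \<open>Sub-Riemannian manifolds with a complement\<close>

record ('a, 'e) sr_foliation =
  atlas :: "('a, 'e) chart set"
  hor :: "'a \<Rightarrow> 'e set"
  hmet :: "'a \<Rightarrow> 'e \<Rightarrow> 'e \<Rightarrow> real"
  ver :: "'a \<Rightarrow> 'e set"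
  vmet :: "'a \<Rightarrow> 'e \<Rightarrow> 'e \<Rightarrow> real"

definition sub_riemannian ::
    "('a::{t2_space, second_countable_topology}, 'e::euclidean_space) sr_foliation \<Rightarrow> nat \<Rightarrow> bool" where
  "sub_riemannian M n \<longleftrightarrow>
     smooth_atlas (atlas M) \<and> connected (UNIV :: 'a set) \<and>
     2 \<le> n \<and> subbundle (atlas M) n (hor M) \<and> metric_on (atlas M) (hor M) (hmet M)"

definition complement ::
    "('a::topological_space, 'e::euclidean_space) sr_foliation \<Rightarrow> nat \<Rightarrow> bool" where
  "complement M \<nu> \<longleftrightarrow>
     subbundle (atlas M) \<nu> (ver M) \<and>
     (\<forall>p. hor M p \<inter> ver M p = {0}) \<and>
     (\<forall>p w. \<exists>a\<in>hor M p. \<exists>b\<in>ver M p. w = a + b)"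

definition integrable_complement ::
    "('a::topological_space, 'e::euclidean_space) sr_foliation \<Rightarrow> bool" where
  "integrable_complement M \<longleftrightarrow>
     (\<forall>X Y. section_of (atlas M) (ver M) X \<and> section_of (atlas M) (ver M) Y \<longrightarrow>
            section_of (atlas M) (ver M) (bracket (atlas M) X Y))"

definition prH :: "('a, 'e::euclidean_space) sr_foliation \<Rightarrow> 'a \<Rightarrow> 'e \<Rightarrow> 'e" where
  "prH M p = proj (hor M p) (ver M p)"

definition prV :: "('a, 'e::euclidean_space) sr_foliation \<Rightarrow> 'a \<Rightarrow> 'e \<Rightarrow> 'e" where
  "prV M p = proj (ver M p) (hor M p)"

definition PH :: "('a, 'e::euclidean_space) sr_foliation \<Rightarrow> ('a \<Rightarrow> 'e) \<Rightarrow> 'a \<Rightarrow> 'e" where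
  "PH M X p = prH M p (X p)"

definition PV :: "('a, 'e::euclidean_space) sr_foliation \<Rightarrow> ('a \<Rightarrow> 'e) \<Rightarrow> 'a \<Rightarrow> 'e" where
  "PV M X p = prV M p (X p)"

definition prH_hmet :: "('a, 'e::euclidean_space) sr_foliation \<Rightarrow> 'a \<Rightarrow> 'e \<Rightarrow> 'e \<Rightarrow> real" where
  "prH_hmet M p u w = hmet M p (prH M p u) (prH M p w)"

definition prV_vmet :: "('a, 'e::euclidean_space) sr_foliation \<Rightarrow> 'a \<Rightarrow> 'e \<Rightarrow> 'e \<Rightarrow> real" where
  "prV_vmet M p u w = vmet M p (prV M p u) (prV M p w)"

definition gmet :: "('a, 'e::euclidean_space) sr_foliation \<Rightarrow> 'a \<Rightarrow> 'e \<Rightarrow> 'e \<Rightarrow> real" where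
  "gmet M p u w = prH_hmet M p u w + prV_vmet M p u w"

definition lie_derivative ::
    "('a, 'e::euclidean_space) chart set \<Rightarrow> ('a \<Rightarrow> 'e) \<Rightarrow> ('a \<Rightarrow> 'e \<Rightarrow> 'e \<Rightarrow> real) \<Rightarrow>
     ('a \<Rightarrow> 'e) \<Rightarrow> ('a \<Rightarrow> 'e) \<Rightarrow> 'a \<Rightarrow> real" where
  "lie_derivative A V s X Y p =
     along A V (\<lambda>q. s q (X q) (Y q)) p - s p (bracket A V X p) (Y p) - s p (X p) (bracket A V Y p)"

definition metric_preserving ::
    "('a::topological_space, 'e::euclidean_space) sr_foliation \<Rightarrow> bool" where
  "metric_preserving M \<longleftrightarrow>
     (\<forall>V X Y p. section_of (atlas M) (ver M) V \<and> vfield (atlas M) X \<and> vfield (atlas M) Y \<longrightarrow>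
        lie_derivative (atlas M) V (prH_hmet M) X Y p = 0)"

definition hstar ::
    "('a, 'e::euclidean_space) sr_foliation \<Rightarrow> 'a \<Rightarrow> ('e \<Rightarrow> real) \<Rightarrow> ('e \<Rightarrow> real) \<Rightarrow> real" where
  "hstar M = cometric (hor M) (hmet M)"

definition vstar ::
    "('a, 'e::euclidean_space) sr_foliation \<Rightarrow> 'a \<Rightarrow> ('e \<Rightarrow> real) \<Rightarrow> ('e \<Rightarrow> real) \<Rightarrow> real" where
  "vstar M = cometric (ver M) (vmet M)"

section \<open>Connections and curvature\<close>

definition levi_civita ::
    "('a::topological_space, 'e::euclidean_space) sr_foliation \<Rightarrow>
     (('a \<Rightarrow> 'e) \<Rightarrow> ('a \<Rightarrow> 'e) \<Rightarrow> ('a \<Rightarrow> 'e)) \<Rightarrow> bool" where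
  "levi_civita M D \<longleftrightarrow>
     (let A = atlas M; g = gmet M in
       (\<forall>X Y. vfield A X \<and> vfield A Y \<longrightarrow> vfield A (D X Y)) \<and>
       (\<forall>X X' Y. vfield A X \<and> vfield A X' \<and> vfield A Y \<longrightarrow>
          D (\<lambda>p. X p + X' p) Y = (\<lambda>p. D X Y p + D X' Y p)) \<and>
       (\<forall>f X Y. smooth_fun A f \<and> vfield A X \<and> vfield A Y \<longrightarrow>
          D (\<lambda>p. f p *\<^sub>R X p) Y = (\<lambda>p. f p *\<^sub>R D X Y p)) \<and>
       (\<forall>X Y Y'. vfield A X \<and> vfield A Y \<and> vfield A Y' \<longrightarrow>
          D X (\<lambda>p. Y p + Y' p) = (\<lambda>p. D X Y p + D X Y' p)) \<and>
       (\<forall>f X Y. smooth_fun A f \<and> vfield A X \<and> vfield A Y \<longrightarrow>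
          D X (\<lambda>p. f p *\<^sub>R Y p) = (\<lambda>p. along A X f p *\<^sub>R Y p + f p *\<^sub>R D X Y p)) \<and>
       (\<forall>X Y. vfield A X \<and> vfield A Y \<longrightarrow> (\<forall>p. D X Y p - D Y X p = bracket A X Y p)) \<and>
       (\<forall>X Y Z. vfield A X \<and> vfield A Y \<and> vfield A Z \<longrightarrow>
          (\<forall>p. along A X (\<lambda>q. g q (Y q) (Z q)) p = g p (D X Y p) (Z p) + g p (Y p) (D X Z p))))"

text \<open>In what follows, \<open>D\<close> is the Levi-Civita connection of \<open>gmet M\<close>, and \<open>ring_conn M D\<close> is the
  connection \<open>\<nabla>\<close> with a ring; the \<open>cov_\<close> operators are its extensions to tensors by the
  Leibniz rule.\<close>

definition ring_conn ::
    "('a, 'e::euclidean_space) sr_foliation \<Rightarrow> (('a \<Rightarrow> 'e) \<Rightarrow> ('a \<Rightarrow> 'e) \<Rightarrow> ('a \<Rightarrow> 'e)) \<Rightarrow>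
     ('a \<Rightarrow> 'e) \<Rightarrow> ('a \<Rightarrow> 'e) \<Rightarrow> 'a \<Rightarrow> 'e" where
  "ring_conn M D X Z p =
     prH M p (D (PH M X) (PH M Z) p) + prV M p (D (PV M X) (PV M Z) p)
     + prH M p (bracket (atlas M) (PV M X) (PH M Z) p)
     + prV M p (bracket (atlas M) (PH M X) (PV M Z) p)"

definition cov_form ::
    "('a, 'e::euclidean_space) sr_foliation \<Rightarrow> (('a \<Rightarrow> 'e) \<Rightarrow> ('a \<Rightarrow> 'e) \<Rightarrow> ('a \<Rightarrow> 'e)) \<Rightarrow>
     ('a \<Rightarrow> 'e) \<Rightarrow> ('a \<Rightarrow> 'e \<Rightarrow> real) \<Rightarrow> 'a \<Rightarrow> 'e \<Rightarrow> real" where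
  "cov_form M D X \<omega> p w =
     (let W = ext_vec (atlas M) p w in
        along (atlas M) X (\<lambda>q. \<omega> q (W q)) p - \<omega> p (ring_conn M D X W p))"

text \<open>The derivative of a field \<open>s\<close> of bilinear forms on the cotangent spaces.\<close>

definition cov_bitensor ::
    "('a, 'e::euclidean_space) sr_foliation \<Rightarrow> (('a \<Rightarrow> 'e) \<Rightarrow> ('a \<Rightarrow> 'e) \<Rightarrow> ('a \<Rightarrow> 'e)) \<Rightarrow>
     ('a \<Rightarrow> 'e) \<Rightarrow> ('a \<Rightarrow> ('e \<Rightarrow> real) \<Rightarrow> ('e \<Rightarrow> real) \<Rightarrow> real) \<Rightarrow>
     'a \<Rightarrow> ('e \<Rightarrow> real) \<Rightarrow> ('e \<Rightarrow> real) \<Rightarrow> real" where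
  "cov_bitensor M D X s p \<alpha> \<beta> =
     (let a = ext_cov (atlas M) p \<alpha>; b = ext_cov (atlas M) p \<beta> in
        along (atlas M) X (\<lambda>q. s q (a q) (b q)) p
        - s p (cov_form M D X a p) \<beta> - s p \<alpha> (cov_form M D X b p))"

definition hess_fun ::
    "('a, 'e::euclidean_space) sr_foliation \<Rightarrow> (('a \<Rightarrow> 'e) \<Rightarrow> ('a \<Rightarrow> 'e) \<Rightarrow> ('a \<Rightarrow> 'e)) \<Rightarrow>
     ('a \<Rightarrow> 'e) \<Rightarrow> ('a \<Rightarrow> 'e) \<Rightarrow> ('a \<Rightarrow> real) \<Rightarrow> 'a \<Rightarrow> real" where
  "hess_fun M D X Z f p =
     along (atlas M) X (along (atlas M) Z f) p - along (atlas M) (ring_conn M D X Z) f p"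

definition hess_bitensor ::
    "('a, 'e::euclidean_space) sr_foliation \<Rightarrow> (('a \<Rightarrow> 'e) \<Rightarrow> ('a \<Rightarrow> 'e) \<Rightarrow> ('a \<Rightarrow> 'e)) \<Rightarrow>
     ('a \<Rightarrow> 'e) \<Rightarrow> ('a \<Rightarrow> 'e) \<Rightarrow> ('a \<Rightarrow> ('e \<Rightarrow> real) \<Rightarrow> ('e \<Rightarrow> real) \<Rightarrow> real) \<Rightarrow>
     'a \<Rightarrow> ('e \<Rightarrow> real) \<Rightarrow> ('e \<Rightarrow> real) \<Rightarrow> real" where
  "hess_bitensor M D X Z s p \<alpha> \<beta> =
     cov_bitensor M D X (cov_bitensor M D Z s) p \<alpha> \<beta> - cov_bitensor M D (ring_conn M D X Z) s p \<alpha> \<beta>"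

definition trH ::
    "('a, 'e::euclidean_space) sr_foliation \<Rightarrow> 'a \<Rightarrow> ('e \<Rightarrow> 'e \<Rightarrow> real) \<Rightarrow> real" where
  "trH M p = trace_on (hor M p) (hmet M p)"

definition trG ::
    "('a, 'e::euclidean_space) sr_foliation \<Rightarrow> 'a \<Rightarrow> ('e \<Rightarrow> 'e \<Rightarrow> real) \<Rightarrow> real" where
  "trG M p = trace_on UNIV (gmet M p)"

definition sub_laplacian ::
    "('a, 'e::euclidean_space) sr_foliation \<Rightarrow> (('a \<Rightarrow> 'e) \<Rightarrow> ('a \<Rightarrow> 'e) \<Rightarrow> ('a \<Rightarrow> 'e)) \<Rightarrow>
     ('a \<Rightarrow> real) \<Rightarrow> 'a \<Rightarrow> real" where
  "sub_laplacian M D f p =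
     trH M p (\<lambda>u w. hess_fun M D (ext_vec (atlas M) p u) (ext_vec (atlas M) p w) f p)"

definition sub_laplacian_bitensor ::
    "('a, 'e::euclidean_space) sr_foliation \<Rightarrow> (('a \<Rightarrow> 'e) \<Rightarrow> ('a \<Rightarrow> 'e) \<Rightarrow> ('a \<Rightarrow> 'e)) \<Rightarrow>
     ('a \<Rightarrow> ('e \<Rightarrow> real) \<Rightarrow> ('e \<Rightarrow> real) \<Rightarrow> real) \<Rightarrow> 'a \<Rightarrow> ('e \<Rightarrow> real) \<Rightarrow> ('e \<Rightarrow> real) \<Rightarrow> real" where
  "sub_laplacian_bitensor M D s p \<alpha> \<beta> =
     trH M p (\<lambda>u w. hess_bitensor M D (ext_vec (atlas M) p u) (ext_vec (atlas M) p w) s p \<alpha> \<beta>)"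

definition Gam ::
    "('a, 'e::euclidean_space) sr_foliation \<Rightarrow> ('a \<Rightarrow> ('e \<Rightarrow> real) \<Rightarrow> ('e \<Rightarrow> real) \<Rightarrow> real) \<Rightarrow>
     ('a \<Rightarrow> real) \<Rightarrow> ('a \<Rightarrow> real) \<Rightarrow> 'a \<Rightarrow> real" where
  "Gam M s f g p = s p (differential (atlas M) f p) (differential (atlas M) g p)"

definition Gam2 ::
    "(('a \<Rightarrow> real) \<Rightarrow> 'a \<Rightarrow> real) \<Rightarrow> ('a, 'e::euclidean_space) sr_foliation \<Rightarrow>
     ('a \<Rightarrow> ('e \<Rightarrow> real) \<Rightarrow> ('e \<Rightarrow> real) \<Rightarrow> real) \<Rightarrow> ('a \<Rightarrow> real) \<Rightarrow> ('a \<Rightarrow> real) \<Rightarrow> 'a \<Rightarrow> real" where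
  "Gam2 L M s f g p = 1/2 * (L (Gam M s f g) p - Gam M s (L f) g p - Gam M s f (L g) p)"

definition ring_curv ::
    "('a, 'e::euclidean_space) sr_foliation \<Rightarrow> (('a \<Rightarrow> 'e) \<Rightarrow> ('a \<Rightarrow> 'e) \<Rightarrow> ('a \<Rightarrow> 'e)) \<Rightarrow>
     ('a \<Rightarrow> 'e) \<Rightarrow> ('a \<Rightarrow> 'e) \<Rightarrow> ('a \<Rightarrow> 'e) \<Rightarrow> 'a \<Rightarrow> 'e" where
  "ring_curv M D X Y Z p =
     ring_conn M D X (ring_conn M D Y Z) p - ring_conn M D Y (ring_conn M D X Z) p
     - ring_conn M D (bracket (atlas M) X Y) Z p"

text \<open>The curvature \<open>\<R>\<close> of the horizontal bundle and its covariant derivative, as tensors.\<close>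

definition hcurv :: "('a, 'e::euclidean_space) sr_foliation \<Rightarrow> 'a \<Rightarrow> 'e \<Rightarrow> 'e \<Rightarrow> 'e" where
  "hcurv M p u w =
     prV M p (bracket (atlas M) (PH M (ext_vec (atlas M) p u)) (PH M (ext_vec (atlas M) p w)) p)"

definition cov_hcurv ::
    "('a, 'e::euclidean_space) sr_foliation \<Rightarrow> (('a \<Rightarrow> 'e) \<Rightarrow> ('a \<Rightarrow> 'e) \<Rightarrow> ('a \<Rightarrow> 'e)) \<Rightarrow>
     'a \<Rightarrow> 'e \<Rightarrow> 'e \<Rightarrow> 'e \<Rightarrow> 'e" where
  "cov_hcurv M D p z u w =
     (let Z = ext_vec (atlas M) p z; U = ext_vec (atlas M) p u; W = ext_vec (atlas M) p w in
        ring_conn M D Z (\<lambda>q. hcurv M q (U q) (W q)) p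
        - hcurv M p (ring_conn M D Z U p) w - hcurv M p u (ring_conn M D Z W p))"

text \<open>The trace over \<open>e\<close> of the endomorphism \<open>e \<mapsto> R(pr\<^sub>H e, z\<^sub>2) z\<^sub>1\<close>.\<close>

definition Ric_H ::
    "('a, 'e::euclidean_space) sr_foliation \<Rightarrow> (('a \<Rightarrow> 'e) \<Rightarrow> ('a \<Rightarrow> 'e) \<Rightarrow> ('a \<Rightarrow> 'e)) \<Rightarrow>
     'a \<Rightarrow> 'e \<Rightarrow> 'e \<Rightarrow> real" where
  "Ric_H M D p z1 z2 =
     trG M p (\<lambda>e e'. gmet M p (ring_curv M D (ext_vec (atlas M) p (prH M p e))
                                  (ext_vec (atlas M) p z2) (ext_vec (atlas M) p z1) p) e')"

definition Ric_HV ::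
    "('a, 'e::euclidean_space) sr_foliation \<Rightarrow> (('a \<Rightarrow> 'e) \<Rightarrow> ('a \<Rightarrow> 'e) \<Rightarrow> ('a \<Rightarrow> 'e)) \<Rightarrow>
     'a \<Rightarrow> 'e \<Rightarrow> 'e \<Rightarrow> real" where
  "Ric_HV M D p z1 z2 =
     1/2 * trG M p (\<lambda>e e'. gmet M p z1 (cov_hcurv M D p e e' z2) + gmet M p z2 (cov_hcurv M D p e e' z1))"

section \<open>Norms and optimal constants\<close>

definition hnorm :: "('a, 'e::euclidean_space) sr_foliation \<Rightarrow> 'a \<Rightarrow> 'e \<Rightarrow> real" where
  "hnorm M p w = sqrt (hmet M p w w)"

definition vnorm :: "('a, 'e::euclidean_space) sr_foliation \<Rightarrow> 'a \<Rightarrow> 'e \<Rightarrow> real" where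
  "vnorm M p w = sqrt (vmet M p w w)"

definition gnorm :: "('a, 'e::euclidean_space) sr_foliation \<Rightarrow> 'a \<Rightarrow> 'e \<Rightarrow> real" where
  "gnorm M p w = sqrt (gmet M p w w)"

definition vstar_norm :: "('a, 'e::euclidean_space) sr_foliation \<Rightarrow> 'a \<Rightarrow> ('e \<Rightarrow> real) \<Rightarrow> real" where
  "vstar_norm M p \<alpha> = sqrt (vstar M p \<alpha> \<alpha>)"

text \<open>The norm induced by \<open>g\<close> on \<open>T\<^sup>*M \<otimes> TM\<close>, i.e. the Hilbert-Schmidt norm.\<close>

definition end_norm :: "('a, 'e::euclidean_space) sr_foliation \<Rightarrow> 'a \<Rightarrow> ('e \<Rightarrow> 'e) \<Rightarrow> real" where
  "end_norm M p T = sqrt (trG M p (\<lambda>e e'. gmet M p (T e) (T e')))"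

definition is_M_R :: "('a, 'e::euclidean_space) sr_foliation \<Rightarrow> real \<Rightarrow> bool" where
  "is_M_R M C \<longleftrightarrow>
     (\<forall>p w. end_norm M p (hcurv M p w) \<le> C * gnorm M p (prH M p w)) \<and>
     (\<forall>C'. (\<forall>p w. end_norm M p (hcurv M p w) \<le> C' * gnorm M p (prH M p w)) \<longrightarrow> C \<le> C')"

text \<open>The norm of the covariant derivative of \<open>v\<^sup>*\<close> in \<open>T\<^sup>*M \<otimes> Sym\<^sup>2 TM\<close>, with \<open>Sym\<^sup>2 TM\<close>
  carrying the norm of \<open>TM \<otimes> TM\<close>. The covectors \<open>gmet M p e\<close>, for \<open>e\<close> in a \<open>g\<close>-orthonormal basis,
  form the dual basis.\<close>

definition cov_vstar_norm ::
    "('a, 'e::euclidean_space) sr_foliation \<Rightarrow> (('a \<Rightarrow> 'e) \<Rightarrow> ('a \<Rightarrow> 'e) \<Rightarrow> ('a \<Rightarrow> 'e)) \<Rightarrow> 'a \<Rightarrow> real" where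
  "cov_vstar_norm M D p =
     (let E = onb UNIV (gmet M p) in
        sqrt (\<Sum>i<DIM('e). \<Sum>j<DIM('e). \<Sum>k<DIM('e).
          (cov_bitensor M D (ext_vec (atlas M) p (E i)) (vstar M) p (gmet M p (E j)) (gmet M p (E k)))\<^sup>2))"

definition wedge2_hstar_norm ::
    "('a, 'e::euclidean_space) sr_foliation \<Rightarrow> 'a \<Rightarrow> ('e \<Rightarrow> 'e \<Rightarrow> real) \<Rightarrow> real" where
  "wedge2_hstar_norm M p \<eta> =
     (let b = onb (hor M p) (hmet M p) in
        sqrt (\<Sum>j<dim (hor M p). \<Sum>i<j. (\<eta> (b i) (b j))\<^sup>2))"

definition m_R_bound :: "('a, 'e::euclidean_space) sr_foliation \<Rightarrow> real \<Rightarrow> bool" where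
  "m_R_bound M m \<longleftrightarrow>
     (\<forall>p \<alpha>. linear \<alpha> \<longrightarrow>
        m * vstar_norm M p \<alpha> \<le> wedge2_hstar_norm M p (\<lambda>u w. \<alpha> (hcurv M p u w)))"

definition is_m_R :: "('a, 'e::euclidean_space) sr_foliation \<Rightarrow> real \<Rightarrow> bool" where
  "is_m_R M m \<longleftrightarrow> 0 \<le> m \<and> m_R_bound M m \<and> (\<forall>m'\<ge>0. m_R_bound M m' \<longrightarrow> m' \<le> m)"

end

theory Submission
  imports Defs
begin

text \<open>The connection \<open>\<nabla>\<close> with a ring preserves \<open>\<H>\<close> and \<open>\<V>\<close>, is metric on \<open>\<H>\<close>, and has torsion
  \<open>-\<R>\<close>. Commuting the third derivatives of \<open>f\<close> therefore produces, in the Bochner formula for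
  \<open>\<Gamma>\<^sub>2\<close> of \<open>h\<^sup>*\<close>, the terms \<open>|\<nabla> df|\<^sup>2\<close>, \<open>Ric\<^sub>\<H>\<close>, \<open>Ric\<^sub>\<H>\<^sub>\<V>\<close> and \<open>2 tr \<nabla>df(\<times>, \<R>(\<times>, grad\<^sub>\<H> f))\<close>, while for \<open>v\<^sup>*\<close> all
  curvature terms vanish by the first Bianchi identity and only the derivatives of \<open>v\<^sup>*\<close> remain.
  In \<open>|\<nabla> df|\<^sup>2\<close> the symmetric part of the horizontal Hessian gives \<open>(Lf)\<^sup>2 / n\<close>, its antisymmetric part
  is \<open>df \<circ> \<R> / 2\<close> and gives \<open>m\<^sub>\<R>\<^sup>2 / 2\<close>; the mixed components are removed by completing the square
  in the norm scaled by \<open>l\<close>.\<close>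

section \<open>Smooth functions on open subsets of a normed space\<close>

text \<open>The constants come from the completed square. With x and y the norms of the horizontal
  and vertical gradients and Mv the bound on the derivative of \<open>vstar\<close>, it costs x^2 /
  l (because \<open>M_R = 1\<close>; the origin of 1/l), l Mv^2 y^2 and a cross term 2 Mv x y.
  \<open>Ric_HV\<close> costs a cross term 2 MHV x y of the same kind, so only the sum MHV + Mv
  matters, and Young's inequality with weight c splits it into x^2 / c and c (MHV + Mv)^2 y^2. The
  formal obstacle is that tensors are evaluated through extensions picked by choice, and that
  vectors are written in preferred charts that jump from point to point. Each tensor is therefore
  shown to be linear over smooth functions, hence independent of the extension, and is then computed
  on a frame of global fields, cut off so that it is orthonormal only near p; derivatives at p see
  no more than that. The frame is not assumed parallel at p: skew-symmetry of its connection
  coefficients replaces this.\<close>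

lemma has_derivative_cong_nhds:
  assumes "\<forall>\<^sub>F y in nhds x. f y = g y"
  shows "(f has_derivative D) (at x) \<longleftrightarrow> (g has_derivative D) (at x)"
proof -
  have ev: "\<forall>\<^sub>F y in at x. f y = g y" "f x = g x"
    using assms by (auto simp: eventually_at_filter elim: eventually_mono dest: eventually_nhds_x_imp_x)
  show ?thesis
    using has_derivative_transform_eventually[of f D x UNIV g]
      has_derivative_transform_eventually[of g D x UNIV f] ev
    by (auto simp: eq_commute)
qed

lemma frechet_derivative_cong_nhds:
  "\<forall>\<^sub>F y in nhds x. f y = g y \<Longrightarrow> frechet_derivative f (at x) = frechet_derivative g (at x)"
  unfolding frechet_derivative_def by (simp add: has_derivative_cong_nhds)

lemma differentiable_cong_nhds:
  "\<forall>\<^sub>F y in nhds x. f y = g y \<Longrightarrow> f differentiable (at x) \<longleftrightarrow> g differentiable (at x)"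
  unfolding differentiable_def by (simp add: has_derivative_cong_nhds)

lemma frechet_derivative_eq:
  "(f has_derivative f') (at x) \<Longrightarrow> frechet_derivative f (at x) = f'"
  by (metis frechet_derivative_at)

lemma has_derivative_frechet:
  "f differentiable (at x) \<Longrightarrow> (f has_derivative frechet_derivative f (at x)) (at x)"
  by (simp add: frechet_derivative_works)

section \<open>Smoothness of finite order: locality and closure rules\<close>

lemma ck_on_Suc_differentiable:
  "open S \<Longrightarrow> ck_on (Suc k) S f \<Longrightarrow> x \<in> S \<Longrightarrow> f differentiable (at x)"
  by (auto simp: differentiable_on_eq_differentiable_at)

lemma ck_on_Suc_has_derivative:
  "open S \<Longrightarrow> ck_on (Suc k) S f \<Longrightarrow> x \<in> S \<Longrightarrow> (f has_derivative frechet_derivative f (at x)) (at x)"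
  by (rule has_derivative_frechet) (rule ck_on_Suc_differentiable)

lemma ck_on_Suc_derivative: "ck_on (Suc k) S f \<Longrightarrow> ck_on k S (\<lambda>x. frechet_derivative f (at x) v)"
  by simp

text \<open>A derivative at a point depends only on the function nearby, and S, being open, contains
  a neighbourhood of each of its points; so agreement on S is inherited by all derivatives.\<close>

lemma ck_on_cong:
  assumes "open S"
  shows "(\<And>x. x \<in> S \<Longrightarrow> f x = g x) \<Longrightarrow> ck_on k S f = ck_on k S g"
proof (induction k arbitrary: f g)
  case 0
  then show ?case by (simp cong: continuous_on_cong)
next
  case (Suc k)
  have ev: "\<forall>\<^sub>F y in nhds x. f y = g y" if "x \<in> S" for x
    using eventually_nhds_in_open[OF assms that] by (rule eventually_mono) (use Suc.prems in auto)
  have "f differentiable_on S \<longleftrightarrow> g differentiable_on S"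
    using differentiable_cong_nhds[OF ev] by (auto simp: differentiable_on_eq_differentiable_at[OF assms])
  moreover have "ck_on k S (\<lambda>x. frechet_derivative f (at x) v) =
      ck_on k S (\<lambda>x. frechet_derivative g (at x) v)" for v
    by (rule Suc.IH) (metis frechet_derivative_cong_nhds[OF ev])
  ultimately show ?case by simp
qed

text \<open>Frechet derivatives are unique, so an explicit family of derivatives may stand in for
  the chosen \<open>frechet_derivative\<close>. The closure rules below use this with the usual
  formulas of calculus.\<close>

lemma ck_on_SucI:
  assumes "open S" "\<And>x. x \<in> S \<Longrightarrow> (f has_derivative f' x) (at x)"
    and "\<And>v. ck_on k S (\<lambda>x. f' x v)"
  shows "ck_on (Suc k) S f"
proof -
  have "ck_on k S (\<lambda>x. frechet_derivative f (at x) v)" for v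
    using assms(3)[of v] ck_on_cong[OF assms(1), of "\<lambda>x. frechet_derivative f (at x) v" "\<lambda>x. f' x v"]
      frechet_derivative_eq[OF assms(2)] by auto
  moreover have "f differentiable_on S"
    using assms(1,2) by (auto simp: differentiable_on_eq_differentiable_at intro: differentiableI)
  ultimately show ?thesis by simp
qed

lemma ck_on_Suc_imp: "open S \<Longrightarrow> ck_on (Suc k) S f \<Longrightarrow> ck_on k S f"
proof (induction k arbitrary: f)
  case 0
  then show ?case by (simp add: differentiable_imp_continuous_on)
next
  case (Suc k)
  then show ?case by simp
qed

lemma ck_on_subset: "T \<subseteq> S \<Longrightarrow> ck_on k S f \<Longrightarrow> ck_on k T f"
  by (induction k arbitrary: f) (auto intro: continuous_on_subset differentiable_on_subset)

lemma ck_on_local: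
  assumes "\<And>x. x \<in> S \<Longrightarrow> \<exists>T. open T \<and> x \<in> T \<and> ck_on k T f"
  shows "ck_on k S f"
  using assms
proof (induction k arbitrary: f)
  case 0
  have "isCont f x" if "x \<in> S" for x
    using 0[OF that] by (auto simp: continuous_on_eq_continuous_at)
  then show ?case by (simp add: continuous_at_imp_continuous_on)
next
  case (Suc k)
  have "f differentiable (at x)" if "x \<in> S" for x
    using Suc.prems[OF that] ck_on_Suc_differentiable by blast
  then have "f differentiable_on S"
    by (simp add: differentiable_at_imp_differentiable_on)
  moreover have "ck_on k S (\<lambda>x. frechet_derivative f (at x) v)" for v
  proof (rule Suc.IH)
    show "\<exists>T. open T \<and> x \<in> T \<and> ck_on k T (\<lambda>x. frechet_derivative f (at x) v)" if "x \<in> S" for x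
      using Suc.prems[OF that] by auto
  qed
  ultimately show ?case by simp
qed

lemma ck_on_const: "open S \<Longrightarrow> ck_on k S (\<lambda>x. a)"
  by (induction k arbitrary: a) auto

lemma ck_on_bounded_linear: "open S \<Longrightarrow> bounded_linear F \<Longrightarrow> ck_on k S F"
proof (induction k)
  case 0
  then show ?case by (simp add: linear_continuous_on)
next
  case (Suc k)
  then show ?case
    by (intro ck_on_SucI[where f' = "\<lambda>x. F"] ck_on_const bounded_linear_imp_has_derivative)
qed

lemma ck_on_add:
  "open S \<Longrightarrow> ck_on k S f \<Longrightarrow> ck_on k S g \<Longrightarrow> ck_on k S (\<lambda>x. f x + g x)"
proof (induction k arbitrary: f g)
  case 0
  then show ?case by (simp add: continuous_on_add)
next
  case (Suc k)
  show ?case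
    by (rule ck_on_SucI[OF Suc.prems(1) has_derivative_add[OF ck_on_Suc_has_derivative[OF Suc.prems(1,2)]
            ck_on_Suc_has_derivative[OF Suc.prems(1,3)]]])
      (use Suc in simp_all)
qed

text \<open>The product rule pairs each factor with a derivative of the other, so both vary in the
  induction. Products, scalings and inner products are instances.\<close>

lemma ck_on_bilinear:
  assumes "bounded_bilinear B" "open S"
  shows "ck_on k S f \<Longrightarrow> ck_on k S g \<Longrightarrow> ck_on k S (\<lambda>x. B (f x) (g x))"
proof (induction k arbitrary: f g)
  case 0
  then show ?case using assms by (simp add: bounded_bilinear.continuous_on)
next
  case (Suc k)
  show ?case
  proof (rule ck_on_SucI[where f' = "\<lambda>x v. B (f x) (frechet_derivative g (at x) v) + B (frechet_derivative f (at x) v) (g x)"])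
    show "open S" by fact
    show "((\<lambda>x. B (f x) (g x)) has_derivative
        (\<lambda>v. B (f x) (frechet_derivative g (at x) v) + B (frechet_derivative f (at x) v) (g x))) (at x)"
      if "x \<in> S" for x
      by (rule bounded_bilinear.FDERIV[OF assms(1) ck_on_Suc_has_derivative[OF assms(2) Suc.prems(1) that]
            ck_on_Suc_has_derivative[OF assms(2) Suc.prems(2) that]])
    show "ck_on k S (\<lambda>x. B (f x) (frechet_derivative g (at x) v) + B (frechet_derivative f (at x) v) (g x))" for v
      using ck_on_Suc_imp[OF assms(2) Suc.prems(1)] ck_on_Suc_imp[OF assms(2) Suc.prems(2)]
        ck_on_Suc_derivative[OF Suc.prems(1)] ck_on_Suc_derivative[OF Suc.prems(2)]
      by (intro ck_on_add assms(2) Suc.IH)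
  qed
qed

lemma ck_on_sum:
  "open S \<Longrightarrow> (\<And>i. i \<in> I \<Longrightarrow> ck_on k S (f i)) \<Longrightarrow> ck_on k S (\<lambda>x. \<Sum>i\<in>I. f i x)"
  by (induction I rule: infinite_finite_induct) (auto simp: ck_on_const ck_on_add)

text \<open>\<open>ck_on\<close> speaks of derivatives in fixed directions only. This expansion
  turns a derivative in a direction that varies with the point into a finite sum over fixed
  directions.\<close>

lemma linear_sum_Basis:
  fixes F :: "'e::euclidean_space \<Rightarrow> 'y::real_vector"
  assumes "linear F"
  shows "F w = (\<Sum>b\<in>Basis. (w \<bullet> b) *\<^sub>R F b)"
proof -
  have "F w = F (\<Sum>b\<in>Basis. (w \<bullet> b) *\<^sub>R b)" by (simp only: euclidean_representation)
  also have "\<dots> = (\<Sum>b\<in>Basis. (w \<bullet> b) *\<^sub>R F b)"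
    by (simp only: linear_sum[OF assms] linear_scale[OF assms])
  finally show ?thesis .
qed

lemma ck_on_compose:
  fixes f :: "'e::euclidean_space \<Rightarrow> 'y::real_normed_vector"
  assumes "open S" "open T" "g ` S \<subseteq> T"
  shows "ck_on k S g \<Longrightarrow> ck_on k T f \<Longrightarrow> ck_on k S (\<lambda>x. f (g x))"
proof (induction k arbitrary: f)
  case 0
  then show ?case using assms by (auto intro: continuous_on_compose2)
next
  case (Suc k)
  let ?D = "\<lambda>x v. \<Sum>b\<in>Basis. (frechet_derivative g (at x) v \<bullet> b) *\<^sub>R frechet_derivative f (at (g x)) b"
  show ?case
  proof (rule ck_on_SucI[where f' = ?D])
    show "open S" by fact
    fix x assume x: "x \<in> S"
    have f: "(f has_derivative frechet_derivative f (at (g x))) (at (g x))"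
      by (rule ck_on_Suc_has_derivative[OF assms(2) Suc.prems(2)]) (use assms x in auto)
    have g: "(g has_derivative frechet_derivative g (at x)) (at x)"
      by (rule ck_on_Suc_has_derivative[OF assms(1) Suc.prems(1) x])
    have "frechet_derivative f (at (g x)) (frechet_derivative g (at x) v) = ?D x v" for v
      by (rule linear_sum_Basis[OF has_derivative_linear[OF f]])
    then show "((\<lambda>x. f (g x)) has_derivative ?D x) (at x)"
      using has_derivative_compose[OF g f] by simp
  next
    fix v
    have "ck_on k S (\<lambda>x. frechet_derivative g (at x) v \<bullet> b)" for b
      by (rule ck_on_bilinear[OF bounded_bilinear_inner \<open>open S\<close> ck_on_Suc_derivative[OF Suc.prems(1)]
            ck_on_const[OF assms(1)]])
    moreover have "ck_on k S (\<lambda>x. frechet_derivative f (at (g x)) b)" for b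
      by (rule Suc.IH[OF ck_on_Suc_imp[OF assms(1) Suc.prems(1)] ck_on_Suc_derivative[OF Suc.prems(2)]])
    ultimately show "ck_on k S (\<lambda>x. ?D x v)"
      by (intro ck_on_sum ck_on_bilinear[OF bounded_bilinear_scaleR] assms)
  qed
qed

text \<open>Differentiation lowers the exponent, so the induction covers all exponents at once. The
  exponent -1 serves in bump functions, -1/2 in normalising vectors.\<close>

lemma ck_on_powr:
  fixes f :: "'x::real_normed_vector \<Rightarrow> real"
  assumes "open S" "\<And>x. x \<in> S \<Longrightarrow> f x > 0"
  shows "ck_on k S f \<Longrightarrow> ck_on k S (\<lambda>x. f x powr a)"
proof (induction k arbitrary: a)
  case 0
  then show ?case using assms(2) by (fastforce intro!: continuous_on_powr continuous_on_const)
next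
  case (Suc k)
  let ?D = "\<lambda>x v. frechet_derivative f (at x) v * (a * f x powr (a - 1))"
  show ?case
  proof (rule ck_on_SucI[where f' = ?D])
    show "open S" by fact
    fix x assume x: "x \<in> S"
    have f: "(f has_derivative frechet_derivative f (at x)) (at x)"
      by (rule ck_on_Suc_has_derivative[OF assms(1) Suc.prems x])
    have "((\<lambda>t. t powr a) has_derivative (\<lambda>h. h * (a * f x powr (a - 1)))) (at (f x))"
      using has_real_derivative_powr[of "f x" a] assms(2)[OF x]
      by (simp add: has_field_derivative_def mult_commute_abs)
    then show "((\<lambda>x. f x powr a) has_derivative ?D x) (at x)"
      using has_derivative_compose[OF f, of "\<lambda>t. t powr a"] by blast
  next
    fix v
    show "ck_on k S (\<lambda>x. ?D x v)"
      by (intro ck_on_bilinear[OF bounded_bilinear_mult assms(1)] ck_on_const assms(1) Suc.IH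
          ck_on_Suc_imp[OF assms(1) Suc.prems] ck_on_Suc_derivative[OF Suc.prems])
  qed
qed

lemma smooth_on_cong:
  "open S \<Longrightarrow> (\<And>x. x \<in> S \<Longrightarrow> f x = g x) \<Longrightarrow> smooth_on S f = smooth_on S g"
  unfolding smooth_on_def using ck_on_cong[of S f g] by simp

lemma smooth_on_subset: "smooth_on S f \<Longrightarrow> T \<subseteq> S \<Longrightarrow> smooth_on T f"
  unfolding smooth_on_def using ck_on_subset by blast

lemma smooth_on_local:
  assumes "\<And>x. x \<in> S \<Longrightarrow> \<exists>T. open T \<and> x \<in> T \<and> smooth_on T f"
  shows "smooth_on S f"
proof -
  have "ck_on k S f" for k
    by (rule ck_on_local) (use assms in \<open>auto simp: smooth_on_def\<close>)
  then show ?thesis by (simp add: smooth_on_def)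
qed

lemma smooth_on_const: "open S \<Longrightarrow> smooth_on S (\<lambda>x. a)"
  by (simp add: smooth_on_def ck_on_const)

lemma smooth_on_bounded_linear: "open S \<Longrightarrow> bounded_linear F \<Longrightarrow> smooth_on S F"
  by (simp add: smooth_on_def ck_on_bounded_linear)

lemma smooth_on_add:
  "open S \<Longrightarrow> smooth_on S f \<Longrightarrow> smooth_on S g \<Longrightarrow> smooth_on S (\<lambda>x. f x + g x)"
  by (simp add: smooth_on_def ck_on_add)

lemma smooth_on_bilinear:
  "bounded_bilinear B \<Longrightarrow> open S \<Longrightarrow> smooth_on S f \<Longrightarrow> smooth_on S g \<Longrightarrow> smooth_on S (\<lambda>x. B (f x) (g x))"
  by (simp add: smooth_on_def ck_on_bilinear)

lemmas smooth_on_scaleR = smooth_on_bilinear[OF bounded_bilinear_scaleR]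
  and smooth_on_mult = smooth_on_bilinear[OF bounded_bilinear_mult]
  and smooth_on_inner = smooth_on_bilinear[OF bounded_bilinear_inner]

lemma smooth_on_sum:
  "open S \<Longrightarrow> (\<And>i. i \<in> I \<Longrightarrow> smooth_on S (f i)) \<Longrightarrow> smooth_on S (\<lambda>x. \<Sum>i\<in>I. f i x)"
  by (simp add: smooth_on_def ck_on_sum)

lemma smooth_on_compose:
  fixes f :: "'e::euclidean_space \<Rightarrow> 'y::real_normed_vector"
  shows "open S \<Longrightarrow> open T \<Longrightarrow> g ` S \<subseteq> T \<Longrightarrow> smooth_on S g \<Longrightarrow> smooth_on T f \<Longrightarrow>
    smooth_on S (\<lambda>x. f (g x))"
  by (simp add: smooth_on_def ck_on_compose)

lemma smooth_on_powr:
  fixes f :: "'x::real_normed_vector \<Rightarrow> real"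
  shows "open S \<Longrightarrow> (\<And>x. x \<in> S \<Longrightarrow> f x > 0) \<Longrightarrow> smooth_on S f \<Longrightarrow> smooth_on S (\<lambda>x. f x powr a)"
  by (simp add: smooth_on_def ck_on_powr)

lemma smooth_on_differentiable:
  "open S \<Longrightarrow> smooth_on S f \<Longrightarrow> x \<in> S \<Longrightarrow> f differentiable (at x)"
  unfolding smooth_on_def using ck_on_Suc_differentiable by blast

lemma smooth_on_has_derivative:
  "open S \<Longrightarrow> smooth_on S f \<Longrightarrow> x \<in> S \<Longrightarrow> (f has_derivative frechet_derivative f (at x)) (at x)"
  by (simp add: has_derivative_frechet smooth_on_differentiable)

lemma smooth_on_derivative:
  "smooth_on S f \<Longrightarrow> smooth_on S (\<lambda>x. frechet_derivative f (at x) v)"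
proof -
  assume "smooth_on S f"
  then have "ck_on (Suc k) S f" for k by (simp only: smooth_on_def)
  then show ?thesis by (simp add: smooth_on_def)
qed

lemma smooth_on_continuous: "smooth_on S f \<Longrightarrow> continuous_on S f"
proof -
  assume "smooth_on S f"
  then have "ck_on 0 S f" by (simp only: smooth_on_def)
  then show ?thesis by simp
qed

lemma smooth_on_derivative_field:
  fixes f :: "'e::euclidean_space \<Rightarrow> 'y::real_normed_vector"
  assumes "open S" "smooth_on S f" "smooth_on S X"
  shows "smooth_on S (\<lambda>x. frechet_derivative f (at x) (X x))"
proof -
  have "smooth_on S (\<lambda>x. \<Sum>b\<in>Basis. (X x \<bullet> b) *\<^sub>R frechet_derivative f (at x) b)"
    by (intro smooth_on_sum smooth_on_scaleR smooth_on_inner smooth_on_const smooth_on_derivative assms)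
  then show ?thesis
    using smooth_on_cong[OF assms(1) linear_sum_Basis[OF linear_frechet_derivative[OF
          smooth_on_differentiable[OF assms(1,2)]]]] by simp
qed

section \<open>Symmetry of second derivatives\<close>

text \<open>The mean value theorem is applied in the direction u to the difference of two translates
  of f along v, and then in the direction v to the derivative along u. The bound on t keeps the
  whole parallelogram inside the ball.\<close>

lemma second_difference_mvt:
  fixes f :: "'e::euclidean_space \<Rightarrow> real"
  assumes f: "smooth_on (ball x r) f" and t: "0 < t" "t * (norm u + norm v) < r"
  shows "\<exists>y\<in>ball x r. f (x + t *\<^sub>R u + t *\<^sub>R v) - f (x + t *\<^sub>R u) - f (x + t *\<^sub>R v) + f x =
    t * t * frechet_derivative (\<lambda>z. frechet_derivative f (at z) u) (at y) v"
proof -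
  have inb: "x + a *\<^sub>R u + b *\<^sub>R v \<in> ball x r" if "0 \<le> a" "a \<le> t" "0 \<le> b" "b \<le> t" for a b
  proof -
    have "norm (a *\<^sub>R u + b *\<^sub>R v) \<le> a * norm u + b * norm v"
      by (rule norm_triangle_le) (use that in simp)
    also have "\<dots> \<le> t * norm u + t * norm v"
      by (intro add_mono mult_right_mono) (use that in auto)
    also have "\<dots> < r" using t by (simp add: algebra_simps)
    finally show ?thesis by (simp add: dist_norm norm_minus_commute algebra_simps)
  qed
  have d: "((\<lambda>s. h (z + s *\<^sub>R w)) has_real_derivative frechet_derivative h (at (z + s *\<^sub>R w)) w) (at s)"
    if "smooth_on (ball x r) h" "z + s *\<^sub>R w \<in> ball x r" for h :: "'e \<Rightarrow> real" and z w s
  proof -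
    have h: "(h has_derivative frechet_derivative h (at (z + s *\<^sub>R w))) (at (z + s *\<^sub>R w))"
      by (rule smooth_on_has_derivative[OF _ that]) simp
    have "((\<lambda>s. z + s *\<^sub>R w) has_derivative (\<lambda>s. s *\<^sub>R w)) (at s)"
      by (auto intro!: derivative_eq_intros)
    from has_derivative_compose[OF this h] show ?thesis
      using linear_scale[OF has_derivative_linear[OF h]]
      by (simp add: has_field_derivative_def mult_commute_abs)
  qed
  let ?g = "\<lambda>s. f (x + t *\<^sub>R v + s *\<^sub>R u) - f (x + s *\<^sub>R u)"
  let ?Du = "\<lambda>z. frechet_derivative f (at z) u"
  have "(?g has_real_derivative ?Du (x + t *\<^sub>R v + s *\<^sub>R u) - ?Du (x + s *\<^sub>R u)) (at s)"
    if "0 \<le> s" "s \<le> t" for s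
    using inb[of s t] inb[of s 0] that t by (intro DERIV_diff d[OF f]) (auto simp: algebra_simps)
  from MVT2[OF t(1) this] obtain s where s: "0 < s" "s < t"
    and 1: "?g t - ?g 0 = t * (?Du (x + t *\<^sub>R v + s *\<^sub>R u) - ?Du (x + s *\<^sub>R u))"
    by auto
  let ?k = "\<lambda>b. ?Du (x + s *\<^sub>R u + b *\<^sub>R v)"
  have "(?k has_real_derivative frechet_derivative ?Du (at (x + s *\<^sub>R u + b *\<^sub>R v)) v) (at b)"
    if "0 \<le> b" "b \<le> t" for b
    by (rule d[OF smooth_on_derivative[OF f]]) (use inb[of s b] s that in auto)
  from MVT2[OF t(1) this] obtain b where b: "0 < b" "b < t"
    and 2: "?k t - ?k 0 = t * frechet_derivative ?Du (at (x + s *\<^sub>R u + b *\<^sub>R v)) v"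
    by auto
  show ?thesis
    by (rule bexI[of _ "x + s *\<^sub>R u + b *\<^sub>R v"]) (use 1 2 s b inb[of s b] in \<open>auto simp: algebra_simps\<close>)
qed

text \<open>The second difference is symmetric in u and v, so the two mixed derivatives take a
  common value at points y and z as close to x as desired; continuity of both excludes a gap at
  x.\<close>

lemma second_derivative_symmetric:
  fixes f :: "'e::euclidean_space \<Rightarrow> real"
  assumes "open S" "smooth_on S f" "x \<in> S"
  shows "frechet_derivative (\<lambda>z. frechet_derivative f (at z) u) (at x) v =
    frechet_derivative (\<lambda>z. frechet_derivative f (at z) v) (at x) u"
proof (rule ccontr)
  define P where "P = (\<lambda>y. frechet_derivative (\<lambda>z. frechet_derivative f (at z) u) (at y) v)"
  define Q where "Q = (\<lambda>y. frechet_derivative (\<lambda>z. frechet_derivative f (at z) v) (at y) u)"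
  assume "\<not> ?thesis"
  then have "\<bar>P x - Q x\<bar> / 2 > 0" (is "?e > 0") by (simp add: P_def Q_def)
  have "continuous_on S P" "continuous_on S Q"
    unfolding P_def Q_def by (intro smooth_on_continuous smooth_on_derivative assms)+
  then have "isCont P x" "isCont Q x"
    using assms by (auto simp: continuous_on_eq_continuous_at)
  then obtain r1 r2 where r1: "r1 > 0" "\<And>y. dist y x < r1 \<Longrightarrow> dist (P y) (P x) < ?e"
    and r2: "r2 > 0" "\<And>y. dist y x < r2 \<Longrightarrow> dist (Q y) (Q x) < ?e"
    unfolding continuous_at_eps_delta using \<open>?e > 0\<close> by metis
  obtain r3 where r3: "r3 > 0" "ball x r3 \<subseteq> S"
    using assms openE by blast
  define r where "r = min r1 (min r2 r3)"
  have r: "r > 0" "ball x r \<subseteq> S" using r1 r2 r3 by (auto simp: r_def)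
  \<comment> \<open>The summand 1 keeps the denominator positive when u and v both vanish.\<close>
  define t where "t = r / (2 * (norm u + norm v + 1))"
  have n: "norm u + norm v + 1 > 0" by (smt (verit) norm_ge_zero)
  have t: "t > 0" using r n by (simp add: t_def)
  have "t * (norm u + norm v) < t * (2 * (norm u + norm v + 1))"
    using t n by (intro mult_strict_left_mono) (smt (verit) norm_ge_zero)+
  also have "\<dots> = r" using n by (simp add: t_def)
  finally have tr: "t * (norm u + norm v) < r" .
  have sm: "smooth_on (ball x r) f" using smooth_on_subset[OF assms(2) r(2)] .
  obtain y where y: "y \<in> ball x r"
    "f (x + t *\<^sub>R u + t *\<^sub>R v) - f (x + t *\<^sub>R u) - f (x + t *\<^sub>R v) + f x = t * t * P y"
    using second_difference_mvt[OF sm t tr] unfolding P_def by auto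
  obtain z where z: "z \<in> ball x r"
    "f (x + t *\<^sub>R v + t *\<^sub>R u) - f (x + t *\<^sub>R v) - f (x + t *\<^sub>R u) + f x = t * t * Q z"
    using second_difference_mvt[OF sm t, of v u] tr unfolding Q_def by (auto simp: add.commute)
  have "t * t * P y = t * t * Q z" using y(2) z(2) by (simp add: algebra_simps)
  then have "P y = Q z" using t by simp
  moreover have "dist (P y) (P x) < ?e" "dist (Q z) (Q x) < ?e"
    using y(1) z(1) r1(2)[of y] r2(2)[of z] by (auto simp: r_def dist_commute)
  ultimately show False by (auto simp: dist_real_def abs_if split: if_splits)
qed

section \<open>Flat functions and bump functions\<close>

text \<open>For k = 0 this is the classical smooth function that vanishes to infinite order at 0.
  Differentiation leads to members with larger k, so the whole family is shown smooth in one
  induction.\<close>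

definition flat :: "nat \<Rightarrow> real \<Rightarrow> real" where
  "flat k t = (if t \<le> 0 then 0 else exp (- (1 / t)) / t ^ k)"

text \<open>From the right, y = 1/t turns the quotient into \<open>y ^ Suc k / exp y\<close>. The
  limit is the derivative of \<open>flat k\<close> at 0.\<close>

lemma flat_over_t_tendsto_0: "((\<lambda>t. flat k t / t) \<longlongrightarrow> 0) (at 0)"
proof -
  have "((\<lambda>y. y ^ Suc k / exp y) \<longlongrightarrow> (0::real)) at_top"
    by (rule tendsto_power_div_exp_0)
  from filterlim_compose[OF this filterlim_inverse_at_top_right]
  have "((\<lambda>t. inverse t ^ Suc k / exp (inverse t)) \<longlongrightarrow> (0::real)) (at_right 0)" .
  then have "((\<lambda>t. flat k t / t) \<longlongrightarrow> 0) (at_right 0)"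
  proof (rule Lim_transform_eventually)
    show "\<forall>\<^sub>F t in at_right 0. inverse t ^ Suc k / exp (inverse t) = flat k t / t"
      using eventually_at_right_less[of "0::real"]
      by (rule eventually_mono) (auto simp: flat_def exp_minus field_simps)
  qed
  moreover have "((\<lambda>t. flat k t / t) \<longlongrightarrow> 0) (at_left 0)"
    by (rule tendsto_eventually, rule eventually_at_leftI[of "-1"]) (auto simp: flat_def)
  ultimately show ?thesis by (simp add: filterlim_split_at)
qed

lemma flat_has_derivative:
  "(flat k has_real_derivative (flat (k + 2) t - real k * flat (k + 1) t)) (at t)"
proof (cases t "0::real" rule: linorder_cases)
  case less
  have "((\<lambda>_. 0) has_real_derivative (flat (k + 2) t - real k * flat (k + 1) t)) (at t)"
    using less by (simp add: flat_def)
  then show ?thesis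
    by (rule DERIV_cong_ev[THEN iffD1, rotated -1, OF _ refl _ refl])
      (use eventually_nhds_in_open[of "{..<0}" t] less in \<open>auto simp: flat_def elim: eventually_mono\<close>)
next
  case equal
  then show ?thesis
    using flat_over_t_tendsto_0[of k] by (simp add: has_field_derivative_iff flat_def)
next
  case greater
  \<comment> \<open>For k = 0 the exponent k - 1 is truncated to 0; the factor \<open>real k\<close>
    makes both sides 0.\<close>
  have k: "real k * t ^ (k - 1) = real k * t ^ k / t"
    using greater by (cases k) auto
  have "((\<lambda>t. exp (- (1 / t)) / t ^ k) has_real_derivative
      (exp (- (1 / t)) * (1 / t\<^sup>2) * t ^ k - exp (- (1 / t)) * (real k * t ^ (k - 1))) / (t ^ k * t ^ k)) (at t)"
    using greater by (auto intro!: derivative_eq_intros simp: power2_eq_square)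
  moreover have "(exp (- (1 / t)) * (1 / t\<^sup>2) * t ^ k - exp (- (1 / t)) * (real k * t ^ (k - 1))) / (t ^ k * t ^ k)
      = flat (k + 2) t - real k * flat (k + 1) t"
    unfolding k using greater by (simp add: flat_def field_simps power2_eq_square)
  ultimately have "((\<lambda>t. exp (- (1 / t)) / t ^ k) has_real_derivative
      (flat (k + 2) t - real k * flat (k + 1) t)) (at t)"
    by simp
  then show ?thesis
    by (rule DERIV_cong_ev[THEN iffD1, rotated -1, OF _ refl _ refl])
      (use eventually_nhds_in_open[of "{0<..}" t] greater in \<open>auto simp: flat_def elim: eventually_mono\<close>)
qed

lemma smooth_on_flat: "smooth_on UNIV (flat k)"
proof -
  have "ck_on m UNIV (flat k)" for m
  proof (induction m arbitrary: k)
    case 0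
    then show ?case
      by (auto intro!: continuous_at_imp_continuous_on DERIV_isCont[OF flat_has_derivative])
  next
    case (Suc m)
    show ?case
    proof (rule ck_on_SucI)
      show "(flat k has_derivative (\<lambda>v. (flat (k + 2) x + (- real k) * flat (k + 1) x) * v)) (at x)" for x
        using flat_has_derivative[of k x] by (simp add: has_field_derivative_def)
      show "ck_on m UNIV (\<lambda>x. (flat (k + 2) x + (- real k) * flat (k + 1) x) * v)" for v
        by (intro ck_on_add ck_on_bilinear[OF bounded_bilinear_mult] ck_on_const Suc.IH open_UNIV)
    qed simp
  qed
  then show ?thesis by (simp add: smooth_on_def)
qed

lemma smooth_bump:
  fixes x0 :: "'e::euclidean_space"
  assumes "r > 0"
  obtains \<psi> :: "'e \<Rightarrow> real"
  where "smooth_on UNIV \<psi>" "\<And>x. x \<notin> cball x0 r \<Longrightarrow> \<psi> x = 0" "\<And>x. x \<in> ball x0 (r / 2) \<Longrightarrow> \<psi> x = 1"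
proof
  \<comment> \<open>t falls from 2 at the centre to 0 on the sphere of radius r and stays above 3/2
    on the ball of radius r/2. The quotient below is 0 for t \<le> 0 and 1 for t \<ge> 1, and its
    denominator never vanishes.\<close>
  define t where "t = (\<lambda>x. 2 + (- 2 / r\<^sup>2) * ((x - x0) \<bullet> (x - x0)))"
  define \<psi> where "\<psi> = (\<lambda>x. flat 0 (t x) * (flat 0 (t x) + flat 0 (1 + (- 1) * t x)) powr (- 1))"
  have "smooth_on UNIV (\<lambda>x::'e. x + (- x0))"
    by (intro smooth_on_add smooth_on_const smooth_on_bounded_linear bounded_linear_ident open_UNIV)
  then have t: "smooth_on UNIV t"
    unfolding t_def
    by (intro smooth_on_add smooth_on_const smooth_on_mult smooth_on_inner open_UNIV) simp_all
  have c: "smooth_on UNIV (\<lambda>x. flat 0 (h x))" if "smooth_on UNIV h" for h :: "'e \<Rightarrow> real"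
    by (rule smooth_on_compose[OF _ _ _ that smooth_on_flat]) auto
  have pos: "flat 0 s + flat 0 (1 + (- 1) * s) > 0" for s by (auto simp: flat_def add_pos_pos)
  show "smooth_on UNIV \<psi>"
    unfolding \<psi>_def
    by (intro smooth_on_mult smooth_on_powr c t smooth_on_add smooth_on_const open_UNIV pos)
  show "\<psi> x = 0" if "x \<notin> cball x0 r" for x
  proof -
    have "r < norm (x - x0)" using that by (simp add: dist_norm norm_minus_commute)
    then have "r\<^sup>2 < (x - x0) \<bullet> (x - x0)"
      using assms by (simp add: dot_square_norm power_strict_mono)
    then have "t x \<le> 0" using assms by (simp add: t_def field_simps)
    then show ?thesis by (simp add: \<psi>_def flat_def)
  qed
  show "\<psi> x = 1" if "x \<in> ball x0 (r / 2)" for x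
  proof -
    have "norm (x - x0) < r / 2" using that by (simp add: dist_norm norm_minus_commute)
    then have "(norm (x - x0))\<^sup>2 < (r / 2)\<^sup>2" by (intro power_strict_mono) auto
    then have "(x - x0) \<bullet> (x - x0) < (r / 2)\<^sup>2" by (simp add: dot_square_norm)
    then have "t x \<ge> 1" using assms inner_ge_zero[of "x - x0"] by (simp del: inner_ge_zero add: t_def field_simps power2_eq_square)
    then show ?thesis by (simp add: \<psi>_def flat_def powr_minus)
  qed
qed

text \<open>Product rule for the pairing of DF with Y: one term differentiates Y, the other freezes
  Y at x and differentiates DF. It isolates the second-order terms that cancel in a bracket.\<close>

lemma frechet_derivative_along_field:
  fixes F :: "'e::euclidean_space \<Rightarrow> 'y::real_normed_vector"
  assumes "open S" "smooth_on S F" "smooth_on S Y" "x \<in> S"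
  shows "frechet_derivative (\<lambda>y. frechet_derivative F (at y) (Y y)) (at x) v =
    frechet_derivative F (at x) (frechet_derivative Y (at x) v) +
    frechet_derivative (\<lambda>y. frechet_derivative F (at y) (Y x)) (at x) v"
proof -
  let ?D = "\<lambda>b y. frechet_derivative F (at y) b"
  have exp: "\<forall>\<^sub>F y in nhds x. frechet_derivative F (at y) (Z y) = (\<Sum>b\<in>Basis. (Z y \<bullet> b) *\<^sub>R ?D b y)" for Z
    using eventually_nhds_in_open[OF assms(1,4)]
    by (rule eventually_mono)
      (rule linear_sum_Basis[OF linear_frechet_derivative[OF smooth_on_differentiable[OF assms(1,2)]]])
  have D: "(?D b has_derivative frechet_derivative (?D b) (at x)) (at x)" for b
    by (rule smooth_on_has_derivative[OF assms(1) smooth_on_derivative[OF assms(2)] assms(4)])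
  have Y: "(Y has_derivative frechet_derivative Y (at x)) (at x)"
    by (rule smooth_on_has_derivative[OF assms(1) assms(3,4)])
  have "((\<lambda>y. \<Sum>b\<in>Basis. (Y y \<bullet> b) *\<^sub>R ?D b y) has_derivative
     (\<lambda>v. \<Sum>b\<in>Basis. (Y x \<bullet> b) *\<^sub>R frechet_derivative (?D b) (at x) v + (frechet_derivative Y (at x) v \<bullet> b) *\<^sub>R ?D b x)) (at x)"
    by (intro has_derivative_sum has_derivative_scaleR D has_derivative_inner_left Y)
  then have 1: "frechet_derivative (\<lambda>y. frechet_derivative F (at y) (Y y)) (at x) v =
     (\<Sum>b\<in>Basis. (Y x \<bullet> b) *\<^sub>R frechet_derivative (?D b) (at x) v + (frechet_derivative Y (at x) v \<bullet> b) *\<^sub>R ?D b x)"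
    unfolding frechet_derivative_cong_nhds[OF exp] by (simp only: frechet_derivative_eq)
  have "((\<lambda>y. \<Sum>b\<in>Basis. (Y x \<bullet> b) *\<^sub>R ?D b y) has_derivative
     (\<lambda>v. \<Sum>b\<in>Basis. (Y x \<bullet> b) *\<^sub>R frechet_derivative (?D b) (at x) v)) (at x)"
    by (intro has_derivative_sum has_derivative_scaleR_right D)
  then have 2: "frechet_derivative (\<lambda>y. frechet_derivative F (at y) (Y x)) (at x) v =
     (\<Sum>b\<in>Basis. (Y x \<bullet> b) *\<^sub>R frechet_derivative (?D b) (at x) v)"
    unfolding frechet_derivative_cong_nhds[OF exp] by (simp only: frechet_derivative_eq)
  have "frechet_derivative F (at x) (frechet_derivative Y (at x) v) =
    (\<Sum>b\<in>Basis. (frechet_derivative Y (at x) v \<bullet> b) *\<^sub>R ?D b x)"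
    by (rule linear_sum_Basis[OF linear_frechet_derivative[OF smooth_on_differentiable[OF assms(1,2,4)]]])
  with 1 2 show ?thesis by (simp add: sum.distrib)
qed

section \<open>Calculus on a manifold\<close>

locale manifold =
  fixes A :: "('a::{t2_space, second_countable_topology}, 'e::euclidean_space) chart set"
  assumes atlas: "smooth_atlas A"
begin

section \<open>Transition maps and components of tangent vectors\<close>

abbreviation tr :: "('a, 'e) chart \<Rightarrow> ('a, 'e) chart \<Rightarrow> 'e \<Rightarrow> 'e" where
  "tr c d \<equiv> \<lambda>x. snd d (chart_inv c x)"

lemma chart_homeomorphism:
  "c \<in> A \<Longrightarrow> homeomorphism (fst c) (snd c ` fst c) (snd c) (chart_inv c)"
  using atlas by (simp add: smooth_atlas_def)

lemma open_chart_domain: "c \<in> A \<Longrightarrow> open (fst c)"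
  using atlas by (simp add: smooth_atlas_def)

lemma chart_inv_chart [simp]: "c \<in> A \<Longrightarrow> p \<in> fst c \<Longrightarrow> chart_inv c (snd c p) = p"
  using chart_homeomorphism by (metis homeomorphism_def)

lemma open_chart_image:
  assumes "c \<in> A" "open W"
  shows "open (snd c ` (fst c \<inter> W))"
proof -
  have "open (snd c ` fst c)" using atlas assms by (simp add: smooth_atlas_def)
  moreover have "continuous_on (snd c ` fst c) (chart_inv c)"
    using chart_homeomorphism[OF assms(1)] by (simp add: homeomorphism_def)
  ultimately have "open (snd c ` fst c \<inter> chart_inv c -` W)"
    using assms(2) by (simp add: continuous_open_preimage)
  moreover have "snd c ` fst c \<inter> chart_inv c -` W = snd c ` (fst c \<inter> W)"
    using assms(1) by auto
  ultimately show ?thesis by simp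
qed

lemma eventually_chart_inv:
  assumes "c \<in> A" "p \<in> fst c" "\<forall>\<^sub>F q in nhds p. P q"
  shows "\<forall>\<^sub>F x in nhds (snd c p). P (chart_inv c x)"
proof -
  obtain W where W: "open W" "p \<in> W" "\<And>q. q \<in> W \<Longrightarrow> P q"
    using assms(3) by (auto simp: eventually_nhds)
  show ?thesis
    unfolding eventually_nhds
    by (rule exI[of _ "snd c ` (fst c \<inter> W)"]) (use assms W in \<open>auto simp: open_chart_image\<close>)
qed

lemma chart_at: "chart_at A p \<in> A" "p \<in> fst (chart_at A p)"
proof -
  have "\<exists>c. c \<in> A \<and> p \<in> fst c" using atlas unfolding smooth_atlas_def by blast
  then have "chart_at A p \<in> A \<and> p \<in> fst (chart_at A p)"
    unfolding chart_at_def by (rule someI_ex)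
  then show "chart_at A p \<in> A" "p \<in> fst (chart_at A p)" by auto
qed

lemma smooth_tr: "c \<in> A \<Longrightarrow> d \<in> A \<Longrightarrow> smooth_on (snd c ` (fst c \<inter> fst d)) (tr c d)"
  using atlas by (simp add: smooth_atlas_def)

lemma tr_has_derivative:
  assumes "c \<in> A" "d \<in> A" "p \<in> fst c" "p \<in> fst d"
  shows "(tr c d has_derivative frechet_derivative (tr c d) (at (snd c p))) (at (snd c p))"
  by (rule smooth_on_has_derivative[OF open_chart_image smooth_tr])
    (use assms open_chart_domain in auto)

text \<open>Chain rule for transition maps. Through it \<open>vec_in\<close> changes between any two
  charts by a Jacobian, although it is defined through the preferred chart of each point.\<close>

lemma tr_cocycle:
  assumes "c \<in> A" "d \<in> A" "e \<in> A" "p \<in> fst c" "p \<in> fst d" "p \<in> fst e"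
  shows "frechet_derivative (tr d e) (at (snd d p)) (frechet_derivative (tr c d) (at (snd c p)) w) =
    frechet_derivative (tr c e) (at (snd c p)) w"
proof -
  have "((\<lambda>x. tr d e (tr c d x)) has_derivative
      (\<lambda>w. frechet_derivative (tr d e) (at (snd d p)) (frechet_derivative (tr c d) (at (snd c p)) w))) (at (snd c p))"
    by (rule has_derivative_compose[OF tr_has_derivative])
      (use assms tr_has_derivative[of d e p] in auto)
  moreover have "\<forall>\<^sub>F x in nhds (snd c p). tr d e (tr c d x) = tr c e x"
    by (rule eventually_chart_inv, use assms in simp_all)
      (rule eventually_mono[OF eventually_nhds_in_open[of "fst d"]],
        use assms open_chart_domain in auto)
  ultimately show ?thesis
    by (simp add: has_derivative_cong_nhds frechet_derivative_eq)
qed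

lemma tr_self:
  assumes "c \<in> A" "p \<in> fst c"
  shows "frechet_derivative (tr c c) (at (snd c p)) w = w"
proof -
  have "\<forall>\<^sub>F x in nhds (snd c p). tr c c x = x"
    using eventually_nhds_in_open[OF open_chart_image[OF assms(1) open_UNIV], of "snd c p"] assms
    by (auto elim!: eventually_mono)
  then show ?thesis
    using frechet_derivative_cong_nhds[of "tr c c" "\<lambda>x. x"] by simp
qed

lemma vec_in_tr:
  assumes "c \<in> A" "d \<in> A" "p \<in> fst c" "p \<in> fst d"
  shows "vec_in A d p w = frechet_derivative (tr c d) (at (snd c p)) (vec_in A c p w)"
  unfolding vec_in_def using tr_cocycle[OF chart_at(1) assms(1,2) chart_at(2)] assms by metis

lemma vec_in_chart_at [simp]: "vec_in A (chart_at A p) p w = w"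
  unfolding vec_in_def by (rule tr_self[OF chart_at])

lemma linear_vec_in: "c \<in> A \<Longrightarrow> p \<in> fst c \<Longrightarrow> linear (vec_in A c p)"
  unfolding vec_in_def
  using has_derivative_linear[OF tr_has_derivative[OF chart_at(1) _ chart_at(2)]] by metis

lemma vec_in_inj:
  "c \<in> A \<Longrightarrow> p \<in> fst c \<Longrightarrow> vec_in A c p v = vec_in A c p w \<Longrightarrow> v = w"
  using vec_in_tr[OF _ chart_at(1) _ chart_at(2)] vec_in_chart_at by metis

section \<open>Smoothness tested in one chart around each point\<close>

lemma smooth_fun_onI:
  assumes "\<And>p. p \<in> U \<Longrightarrow> \<exists>c\<in>A. \<exists>V. open V \<and> p \<in> V \<and> V \<subseteq> fst c \<and> smooth_on (snd c ` V) (\<lambda>x. f (chart_inv c x))"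
  shows "smooth_fun_on A U f"
  unfolding smooth_fun_on_def
proof (intro ballI smooth_on_local)
  fix d x assume d: "d \<in> A" and "x \<in> snd d ` (fst d \<inter> U)"
  then obtain p where p: "p \<in> fst d" "p \<in> U" "x = snd d p" by auto
  obtain c V where c: "c \<in> A" and V: "open V" "p \<in> V" "V \<subseteq> fst c" "smooth_on (snd c ` V) (\<lambda>x. f (chart_inv c x))"
    using assms[OF p(2)] by blast
  let ?T = "snd d ` (fst d \<inter> V)"
  have T: "open ?T" by (rule open_chart_image[OF d V(1)])
  have "open (snd c ` V)" using open_chart_image[OF c V(1)] V(3) by (simp add: Int_absorb1)
  then have "smooth_on ?T (\<lambda>x. f (chart_inv c (tr d c x)))"
    by (rule smooth_on_compose[OF T _ _ smooth_on_subset[OF smooth_tr[OF d c]] V(4)])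
      (use V d in auto)
  then have "smooth_on ?T (\<lambda>x. f (chart_inv d x))"
    by (rule smooth_on_cong[OF T, THEN iffD1, rotated]) (use V c d in auto)
  then show "\<exists>T. open T \<and> x \<in> T \<and> smooth_on T (\<lambda>x. f (chart_inv d x))"
    using T p V by blast
qed

text \<open>As for functions, except that the components are also multiplied by the Jacobian of the
  transition map, which is itself smooth in the base point.\<close>

lemma smooth_vf_onI:
  assumes "\<And>p. p \<in> U \<Longrightarrow> \<exists>c\<in>A. \<exists>V. open V \<and> p \<in> V \<and> V \<subseteq> fst c \<and> smooth_on (snd c ` V) (vf_in A c X)"
  shows "smooth_vf_on A U X"
  unfolding smooth_vf_on_def
proof (intro ballI smooth_on_local)
  fix d x assume d: "d \<in> A" and "x \<in> snd d ` (fst d \<inter> U)"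
  then obtain p where p: "p \<in> fst d" "p \<in> U" "x = snd d p" by auto
  obtain c V where c: "c \<in> A" and V: "open V" "p \<in> V" "V \<subseteq> fst c" "smooth_on (snd c ` V) (vf_in A c X)"
    using assms[OF p(2)] by blast
  let ?T = "snd d ` (fst d \<inter> V)"
  let ?S = "snd c ` (fst c \<inter> (V \<inter> fst d))"
  have T: "open ?T" by (rule open_chart_image[OF d V(1)])
  have S: "open ?S" by (rule open_chart_image[OF c]) (use V open_chart_domain[OF d] in auto)
  have *: "smooth_on ?S (\<lambda>y. frechet_derivative (tr c d) (at y) (vf_in A c X y))"
    by (intro smooth_on_derivative_field S smooth_on_subset[OF smooth_tr[OF c d]] smooth_on_subset[OF V(4)]) auto
  have "smooth_on ?T (\<lambda>x. frechet_derivative (tr c d) (at (tr d c x)) (vf_in A c X (tr d c x)))"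
    by (rule smooth_on_compose[OF T S _ smooth_on_subset[OF smooth_tr[OF d c]] *])
      (use V d in auto)
  then have "smooth_on ?T (vf_in A d X)"
    by (rule smooth_on_cong[OF T, THEN iffD1, rotated])
      (use V(3) c d in \<open>auto simp: vf_in_def vec_in_tr[OF c d] subset_eq\<close>)
  then show "\<exists>T. open T \<and> x \<in> T \<and> smooth_on T (vf_in A d X)"
    using T p V by blast
qed

lemma smooth_fun_on_chart:
  "smooth_fun_on A U f \<Longrightarrow> c \<in> A \<Longrightarrow> smooth_on (snd c ` (fst c \<inter> U)) (\<lambda>x. f (chart_inv c x))"
  by (simp add: smooth_fun_on_def)

lemma smooth_vf_on_chart:
  "smooth_vf_on A U X \<Longrightarrow> c \<in> A \<Longrightarrow> smooth_on (snd c ` (fst c \<inter> U)) (vf_in A c X)"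
  by (simp add: smooth_vf_on_def)

lemma smooth_fun_on_subset: "smooth_fun_on A U f \<Longrightarrow> V \<subseteq> U \<Longrightarrow> smooth_fun_on A V f"
  unfolding smooth_fun_on_def by (blast intro: smooth_on_subset)

lemma smooth_vf_on_subset: "smooth_vf_on A U X \<Longrightarrow> V \<subseteq> U \<Longrightarrow> smooth_vf_on A V X"
  unfolding smooth_vf_on_def by (blast intro: smooth_on_subset)

lemma smooth_fun_on_local:
  assumes "\<And>p. p \<in> U \<Longrightarrow> \<exists>V. open V \<and> p \<in> V \<and> smooth_fun_on A V f"
  shows "smooth_fun_on A U f"
proof (rule smooth_fun_onI)
  fix p assume "p \<in> U"
  then obtain V where V: "open V" "p \<in> V" "smooth_fun_on A V f" using assms by blast
  show "\<exists>c\<in>A. \<exists>V. open V \<and> p \<in> V \<and> V \<subseteq> fst c \<and> smooth_on (snd c ` V) (\<lambda>x. f (chart_inv c x))"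
    by (rule bexI[OF _ chart_at(1)[of p]], rule exI[of _ "fst (chart_at A p) \<inter> V"])
      (use V chart_at[of p] open_chart_domain[OF chart_at(1)] smooth_fun_on_chart[OF V(3) chart_at(1)] in auto)
qed

lemma smooth_vf_on_local:
  assumes "\<And>p. p \<in> U \<Longrightarrow> \<exists>V. open V \<and> p \<in> V \<and> smooth_vf_on A V X"
  shows "smooth_vf_on A U X"
proof (rule smooth_vf_onI)
  fix p assume "p \<in> U"
  then obtain V where V: "open V" "p \<in> V" "smooth_vf_on A V X" using assms by blast
  show "\<exists>c\<in>A. \<exists>V. open V \<and> p \<in> V \<and> V \<subseteq> fst c \<and> smooth_on (snd c ` V) (vf_in A c X)"
    by (rule bexI[OF _ chart_at(1)[of p]], rule exI[of _ "fst (chart_at A p) \<inter> V"])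
      (use V chart_at[of p] open_chart_domain[OF chart_at(1)] smooth_vf_on_chart[OF V(3) chart_at(1)] in auto)
qed

lemma smooth_fun_on_cong:
  assumes "open U" "\<And>q. q \<in> U \<Longrightarrow> f q = g q"
  shows "smooth_fun_on A U f = smooth_fun_on A U g"
proof -
  have "smooth_on (snd c ` (fst c \<inter> U)) (\<lambda>x. f (chart_inv c x)) =
      smooth_on (snd c ` (fst c \<inter> U)) (\<lambda>x. g (chart_inv c x))" if "c \<in> A" for c
    by (rule smooth_on_cong[OF open_chart_image[OF that assms(1)]]) (use assms that in auto)
  then show ?thesis by (auto simp: smooth_fun_on_def)
qed

lemma smooth_vf_on_cong:
  assumes "open U" "\<And>q. q \<in> U \<Longrightarrow> X q = Y q"
  shows "smooth_vf_on A U X = smooth_vf_on A U Y"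
proof -
  have "smooth_on (snd c ` (fst c \<inter> U)) (vf_in A c X) = smooth_on (snd c ` (fst c \<inter> U)) (vf_in A c Y)"
    if "c \<in> A" for c
    by (rule smooth_on_cong[OF open_chart_image[OF that assms(1)]])
      (use assms that in \<open>auto simp: vf_in_def\<close>)
  then show ?thesis by (auto simp: smooth_vf_on_def)
qed

lemma smooth_fun_on_const: "open U \<Longrightarrow> smooth_fun_on A U (\<lambda>q. a)"
  by (simp add: smooth_fun_on_def smooth_on_const open_chart_image)

lemma smooth_fun_on_add:
  "open U \<Longrightarrow> smooth_fun_on A U f \<Longrightarrow> smooth_fun_on A U g \<Longrightarrow> smooth_fun_on A U (\<lambda>q. f q + g q)"
  by (simp add: smooth_fun_on_def smooth_on_add open_chart_image)

lemma smooth_fun_on_mult: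
  "open U \<Longrightarrow> smooth_fun_on A U f \<Longrightarrow> smooth_fun_on A U g \<Longrightarrow> smooth_fun_on A U (\<lambda>q. f q * g q)"
  by (simp add: smooth_fun_on_def smooth_on_mult open_chart_image)

lemma smooth_fun_on_diff:
  "open U \<Longrightarrow> smooth_fun_on A U f \<Longrightarrow> smooth_fun_on A U g \<Longrightarrow> smooth_fun_on A U (\<lambda>q. f q - g q)"
  using smooth_fun_on_add[of U f "\<lambda>q. (-1) * g q"] smooth_fun_on_mult[of U "\<lambda>q. -1" g]
  by (simp add: smooth_fun_on_const)

lemma smooth_fun_on_sum:
  "open U \<Longrightarrow> (\<And>i. i \<in> I \<Longrightarrow> smooth_fun_on A U (f i)) \<Longrightarrow> smooth_fun_on A U (\<lambda>q. \<Sum>i\<in>I. f i q)"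
  by (simp add: smooth_fun_on_def smooth_on_sum open_chart_image)

lemma smooth_fun_on_powr:
  assumes "open U" "\<And>q. q \<in> U \<Longrightarrow> f q > 0" "smooth_fun_on A U f"
  shows "smooth_fun_on A U (\<lambda>q. f q powr a)"
  unfolding smooth_fun_on_def
proof
  fix c assume c: "c \<in> A"
  show "smooth_on (snd c ` (fst c \<inter> U)) (\<lambda>x. f (chart_inv c x) powr a)"
    by (rule smooth_on_powr[OF open_chart_image[OF c assms(1)] _ smooth_fun_on_chart[OF assms(3) c]])
      (use assms(2) c in auto)
qed

lemma smooth_vf_on_zero: "open U \<Longrightarrow> smooth_vf_on A U (\<lambda>q. 0)"
  unfolding smooth_vf_on_def
proof
  fix c assume c: "open U" "c \<in> A"
  have "smooth_on (snd c ` (fst c \<inter> U)) (\<lambda>x. 0 :: 'e)"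
    by (intro smooth_on_const open_chart_image c)
  then show "smooth_on (snd c ` (fst c \<inter> U)) (vf_in A c (\<lambda>q. 0))"
    by (rule smooth_on_cong[OF open_chart_image[OF c(2,1)], THEN iffD1, rotated])
      (use c in \<open>auto simp: vf_in_def linear_0 linear_vec_in\<close>)
qed

lemma smooth_vf_on_add:
  assumes "open U" "smooth_vf_on A U X" "smooth_vf_on A U Y"
  shows "smooth_vf_on A U (\<lambda>q. X q + Y q)"
  unfolding smooth_vf_on_def
proof
  fix c assume c: "c \<in> A"
  have "smooth_on (snd c ` (fst c \<inter> U)) (\<lambda>x. vf_in A c X x + vf_in A c Y x)"
    by (intro smooth_on_add smooth_vf_on_chart open_chart_image c assms)
  then show "smooth_on (snd c ` (fst c \<inter> U)) (vf_in A c (\<lambda>q. X q + Y q))"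
    by (rule smooth_on_cong[OF open_chart_image[OF c assms(1)], THEN iffD1, rotated])
      (use c in \<open>auto simp: vf_in_def linear_add linear_vec_in\<close>)
qed

lemma smooth_vf_on_scale:
  assumes "open U" "smooth_fun_on A U f" "smooth_vf_on A U X"
  shows "smooth_vf_on A U (\<lambda>q. f q *\<^sub>R X q)"
  unfolding smooth_vf_on_def
proof
  fix c assume c: "c \<in> A"
  have "smooth_on (snd c ` (fst c \<inter> U)) (\<lambda>x. f (chart_inv c x) *\<^sub>R vf_in A c X x)"
    by (intro smooth_on_scaleR smooth_vf_on_chart smooth_fun_on_chart open_chart_image c assms)
  then show "smooth_on (snd c ` (fst c \<inter> U)) (vf_in A c (\<lambda>q. f q *\<^sub>R X q))"
    by (rule smooth_on_cong[OF open_chart_image[OF c assms(1)], THEN iffD1, rotated])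
      (use c in \<open>auto simp: vf_in_def linear_scale linear_vec_in\<close>)
qed

lemma smooth_vf_on_diff:
  "open U \<Longrightarrow> smooth_vf_on A U X \<Longrightarrow> smooth_vf_on A U Y \<Longrightarrow> smooth_vf_on A U (\<lambda>q. X q - Y q)"
  using smooth_vf_on_add[of U X "\<lambda>q. (-1) *\<^sub>R Y q"] smooth_vf_on_scale[of U "\<lambda>q. -1" Y]
  by (simp add: smooth_fun_on_const)

lemma smooth_vf_on_sum:
  "open U \<Longrightarrow> (\<And>i. i \<in> I \<Longrightarrow> smooth_vf_on A U (X i)) \<Longrightarrow> smooth_vf_on A U (\<lambda>q. \<Sum>i\<in>I. X i q)"
  by (induction I rule: infinite_finite_induct) (simp_all add: smooth_vf_on_zero smooth_vf_on_add)

lemma smooth_fun_on_differentiable: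
  assumes "open U" "smooth_fun_on A U f" "p \<in> U" "c \<in> A" "p \<in> fst c"
  shows "(\<lambda>x. f (chart_inv c x)) differentiable (at (snd c p))"
  by (rule smooth_on_differentiable[OF open_chart_image smooth_fun_on_chart]) (use assms in auto)

text \<open>The preferred chart in the definition changes with p in no continuous way. By the chain
  rule a fixed chart gives the same value on transformed components, which makes derivatives along
  smooth fields smooth.\<close>

lemma differential_chart:
  assumes "open U" "smooth_fun_on A U f" "p \<in> U" "c \<in> A" "p \<in> fst c"
  shows "differential A f p w = frechet_derivative (\<lambda>x. f (chart_inv c x)) (at (snd c p)) (vec_in A c p w)"
proof -
  let ?c = "chart_at A p"
  have "((\<lambda>x. f (chart_inv c (tr ?c c x))) has_derivative
     (\<lambda>w. frechet_derivative (\<lambda>x. f (chart_inv c x)) (at (snd c p)) (frechet_derivative (tr ?c c) (at (snd ?c p)) w)))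
     (at (snd ?c p))"
    using has_derivative_compose[OF tr_has_derivative[OF chart_at(1) assms(4) chart_at(2) assms(5)],
        of "\<lambda>x. f (chart_inv c x)"] has_derivative_frechet[OF smooth_fun_on_differentiable[OF assms]] chart_at
    by simp
  moreover have "\<forall>\<^sub>F x in nhds (snd ?c p). f (chart_inv c (tr ?c c x)) = f (chart_inv ?c x)"
    by (rule eventually_chart_inv[OF chart_at], rule eventually_mono[OF eventually_nhds_in_open[of "fst c"]])
      (use assms open_chart_domain in auto)
  ultimately show ?thesis
    by (simp add: has_derivative_cong_nhds frechet_derivative_eq differential_def vec_in_def)
qed

lemma linear_differential:
  "open U \<Longrightarrow> smooth_fun_on A U f \<Longrightarrow> p \<in> U \<Longrightarrow> linear (differential A f p)"
  unfolding differential_def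
  by (rule linear_frechet_derivative[OF smooth_fun_on_differentiable]) (auto simp: chart_at)

lemma differential_cong:
  assumes "\<forall>\<^sub>F q in nhds p. f q = g q"
  shows "differential A f p = differential A g p"
  unfolding differential_def
  by (rule frechet_derivative_cong_nhds) (rule eventually_chart_inv[OF chart_at assms])

lemma differential_const: "differential A (\<lambda>q. a) p = (\<lambda>w. 0)"
  by (simp add: differential_def)

lemma differential_add:
  assumes "open U" "smooth_fun_on A U f" "smooth_fun_on A U g" "p \<in> U"
  shows "differential A (\<lambda>q. f q + g q) p = (\<lambda>w. differential A f p w + differential A g p w)"
  unfolding differential_def
  by (intro frechet_derivative_eq has_derivative_add has_derivative_frechet smooth_fun_on_differentiable[OF assms(1)])
    (use assms chart_at in auto)

lemma differential_mult:
  assumes "open U" "smooth_fun_on A U f" "smooth_fun_on A U g" "p \<in> U"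
  shows "differential A (\<lambda>q. f q * g q) p = (\<lambda>w. f p * differential A g p w + differential A f p w * g p)"
proof -
  have d: "((\<lambda>x. h (chart_inv (chart_at A p) x)) has_derivative differential A h p) (at (snd (chart_at A p) p))"
    if "smooth_fun_on A U h" for h
    unfolding differential_def
    by (intro has_derivative_frechet smooth_fun_on_differentiable[OF assms(1)]) (use that assms chart_at in auto)
  show ?thesis
    using has_derivative_mult[OF d[OF assms(2)] d[OF assms(3)]]
    by (subst differential_def) (simp add: frechet_derivative_eq chart_at)
qed

lemma smooth_fun_on_along:
  assumes "open U" "smooth_fun_on A U f" "smooth_vf_on A U X"
  shows "smooth_fun_on A U (along A X f)"
  unfolding smooth_fun_on_def
proof
  fix c assume c: "c \<in> A"
  have "smooth_on (snd c ` (fst c \<inter> U)) (\<lambda>x. frechet_derivative (\<lambda>x. f (chart_inv c x)) (at x) (vf_in A c X x))"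
    by (intro smooth_on_derivative_field smooth_vf_on_chart smooth_fun_on_chart open_chart_image c assms)
  then show "smooth_on (snd c ` (fst c \<inter> U)) (\<lambda>x. along A X f (chart_inv c x))"
    by (rule smooth_on_cong[OF open_chart_image[OF c assms(1)], THEN iffD1, rotated])
      (use c in \<open>auto simp: vf_in_def along_def differential_chart[OF assms(1,2) _ c]\<close>)
qed

text \<open>The second derivatives of \<open>f\<close> cancel by Schwarz's theorem.\<close>

lemma differential_bracket:
  assumes f: "smooth_fun A f" and X: "vfield A X" and Y: "vfield A Y"
  shows "differential A f p (bracket A X Y p) = along A X (along A Y f) p - along A Y (along A X f) p"
proof -
  let ?c = "chart_at A p"
  let ?x = "snd ?c p" and ?S = "snd ?c ` fst ?c"
  let ?F = "\<lambda>x. f (chart_inv ?c x)"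
  note c = chart_at[of p]
  have S: "open ?S" using open_chart_image[OF c(1) open_UNIV] by simp
  have F: "smooth_on ?S ?F" using smooth_fun_on_chart[OF f c(1)] by simp
  have x: "?x \<in> ?S" using c by simp
  have v: "smooth_on ?S (vf_in A ?c Z)" if "vfield A Z" for Z
    using smooth_vf_on_chart[OF that c(1)] by simp
  have vx: "vf_in A ?c Z ?x = Z p" for Z using c by (simp add: vf_in_def)
  have *: "along A Z (along A W f) p = frechet_derivative ?F (at ?x) (frechet_derivative (vf_in A ?c W) (at ?x) (Z p)) +
     frechet_derivative (\<lambda>y. frechet_derivative ?F (at y) (W p)) (at ?x) (Z p)" if "vfield A W" for Z W
  proof -
    have "\<forall>\<^sub>F y in nhds ?x. along A W f (chart_inv ?c y) = frechet_derivative ?F (at y) (vf_in A ?c W y)"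
      using eventually_nhds_in_open[OF S x]
      by (rule eventually_mono)
        (use c in \<open>auto simp: along_def vf_in_def differential_chart[OF open_UNIV f _ c(1)]\<close>)
    then have "along A Z (along A W f) p = frechet_derivative (\<lambda>y. frechet_derivative ?F (at y) (vf_in A ?c W y)) (at ?x) (Z p)"
      unfolding along_def[of A Z] differential_def[of A "along A W f"]
      by (simp add: frechet_derivative_cong_nhds)
    then show ?thesis
      by (simp add: frechet_derivative_along_field[OF S F v[OF that] x] vx)
  qed
  have "linear (frechet_derivative ?F (at ?x))"
    by (rule linear_frechet_derivative[OF smooth_on_differentiable[OF S F x]])
  then show ?thesis
    unfolding *[OF X] *[OF Y] differential_def[of A f] bracket_def Let_def
    using second_derivative_symmetric[OF S F x, of "X p" "Y p"]
    by (simp add: linear_diff)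
qed

section \<open>Cutoffs and coordinate frames\<close>

text \<open>A bump in the chart is extended by zero. It vanishes off K, the image of a closed ball,
  which is compact and hence closed in a Hausdorff space; so the chart domain and the complement of
  K form an open cover on which smoothness is checked.\<close>

lemma smooth_bump_fun:
  assumes "open U" "p \<in> U"
  obtains \<theta> K V where "smooth_fun A \<theta>" "closed K" "K \<subseteq> U" "\<And>q. q \<notin> K \<Longrightarrow> \<theta> q = 0"
    "open V" "p \<in> V" "V \<subseteq> U" "\<And>q. q \<in> V \<Longrightarrow> \<theta> q = 1"
proof -
  let ?c = "chart_at A p"
  note c = chart_at[of p]
  let ?T = "snd ?c ` (fst ?c \<inter> U)"
  have T: "open ?T" by (rule open_chart_image[OF c(1) assms(1)])
  have pT: "snd ?c p \<in> ?T" using c assms by auto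
  obtain r where r: "r > 0" "cball (snd ?c p) r \<subseteq> ?T"
    using T pT open_contains_cball by blast
  obtain \<psi> where \<psi>: "smooth_on UNIV \<psi>" "\<And>x. x \<notin> cball (snd ?c p) r \<Longrightarrow> \<psi> x = 0"
    "\<And>x. x \<in> ball (snd ?c p) (r / 2) \<Longrightarrow> \<psi> x = (1::real)"
    using smooth_bump[OF r(1)] by metis
  define \<theta> where "\<theta> q = (if q \<in> fst ?c then \<psi> (snd ?c q) else 0)" for q
  define K where "K = chart_inv ?c ` cball (snd ?c p) r"
  define V where "V = fst ?c \<inter> snd ?c -` ball (snd ?c p) (r / 2)"
  have hom: "homeomorphism (fst ?c) (snd ?c ` fst ?c) (snd ?c) (chart_inv ?c)"
    by (rule chart_homeomorphism[OF c(1)])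
  have "compact K"
    unfolding K_def
    by (rule compact_continuous_image[OF _ compact_cball])
      (use hom r in \<open>auto simp: homeomorphism_def intro: continuous_on_subset\<close>)
  then have K: "closed K" by (rule compact_imp_closed)
  have inj: "q \<in> K" if "q \<in> fst ?c" "snd ?c q \<in> cball (snd ?c p) r" for q
    using that chart_inv_chart[OF c(1) that(1)] unfolding K_def by (metis imageI)
  have KU: "K \<subseteq> fst ?c \<inter> U"
  proof
    fix q assume "q \<in> K"
    then obtain x where x: "x \<in> cball (snd ?c p) r" "q = chart_inv ?c x" unfolding K_def by auto
    then obtain q' where "q' \<in> fst ?c \<inter> U" "x = snd ?c q'" using r by blast
    then show "q \<in> fst ?c \<inter> U" using x c by simp
  qed
  have 0: "\<theta> q = 0" if "q \<notin> K" for q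
    unfolding \<theta>_def using inj[of q] that \<psi>(2) by auto
  have V: "open V"
    unfolding V_def using hom open_chart_domain[OF c(1)]
    by (intro continuous_open_preimage) (auto simp: homeomorphism_def)
  have pV: "p \<in> V" using c r by (simp add: V_def)
  have 1: "\<theta> q = 1" if "q \<in> V" for q
    using that \<psi>(3) by (simp add: V_def \<theta>_def)
  have VU: "V \<subseteq> U"
    using 0 1 KU by (metis Int_iff subset_eq zero_neq_one)
  have "smooth_fun_on A (fst ?c) \<theta>"
  proof (rule smooth_fun_onI)
    fix q assume q: "q \<in> fst ?c"
    have S: "open (snd ?c ` fst ?c)" using open_chart_image[OF c(1) open_UNIV] by simp
    have "smooth_on (snd ?c ` fst ?c) \<psi>" by (rule smooth_on_subset[OF \<psi>(1)]) simp
    then have "smooth_on (snd ?c ` fst ?c) (\<lambda>x. \<theta> (chart_inv ?c x))"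
      by (rule smooth_on_cong[OF S, THEN iffD1, rotated]) (use c in \<open>auto simp: \<theta>_def\<close>)
    then show "\<exists>c\<in>A. \<exists>V. open V \<and> q \<in> V \<and> V \<subseteq> fst c \<and> smooth_on (snd c ` V) (\<lambda>x. \<theta> (chart_inv c x))"
      using c q open_chart_domain by blast
  qed
  moreover have "smooth_fun_on A (- K) \<theta>"
    using smooth_fun_on_const[of "- K" 0] smooth_fun_on_cong[of "- K" \<theta> "\<lambda>q. 0"] K 0 by auto
  ultimately have "smooth_fun A \<theta>"
  proof (intro smooth_fun_on_local)
    fix q
    show "\<exists>V. open V \<and> q \<in> V \<and> smooth_fun_on A V \<theta>"
      if "smooth_fun_on A (fst ?c) \<theta>" "smooth_fun_on A (- K) \<theta>"
      using that K KU open_chart_domain[OF c(1)] by (cases "q \<in> K") (blast, metis ComplI open_Compl)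
  qed
  then show ?thesis
    using that K KU 0 V pV VU 1 by blast
qed

text \<open>Outside U the function f is arbitrary, but there the product vanishes: U and the open
  complement of K cover the manifold.\<close>

lemma smooth_fun_cutoff:
  assumes "open U" "smooth_fun_on A U f" "smooth_fun A \<theta>" "closed K" "K \<subseteq> U" "\<And>q. q \<notin> K \<Longrightarrow> \<theta> q = 0"
  shows "smooth_fun A (\<lambda>q. \<theta> q * f q)"
proof (rule smooth_fun_on_local)
  have 1: "smooth_fun_on A U (\<lambda>q. \<theta> q * f q)"
    by (intro smooth_fun_on_mult assms smooth_fun_on_subset[OF assms(3)]) simp
  have 2: "smooth_fun_on A (- K) (\<lambda>q. \<theta> q * f q)"
    using smooth_fun_on_const[of "- K" 0] smooth_fun_on_cong[of "- K" "\<lambda>q. \<theta> q * f q" "\<lambda>q. 0"] assms by auto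
  show "\<exists>V. open V \<and> q \<in> V \<and> smooth_fun_on A V (\<lambda>q. \<theta> q * f q)" for q
    using 1 2 assms by (cases "q \<in> K") (blast, metis ComplI open_Compl)
qed

lemma smooth_vf_cutoff:
  assumes "open U" "smooth_vf_on A U X" "smooth_fun A \<theta>" "closed K" "K \<subseteq> U" "\<And>q. q \<notin> K \<Longrightarrow> \<theta> q = 0"
  shows "vfield A (\<lambda>q. \<theta> q *\<^sub>R X q)"
proof (rule smooth_vf_on_local)
  have 1: "smooth_vf_on A U (\<lambda>q. \<theta> q *\<^sub>R X q)"
    by (intro smooth_vf_on_scale assms smooth_fun_on_subset[OF assms(3)]) simp
  have 2: "smooth_vf_on A (- K) (\<lambda>q. \<theta> q *\<^sub>R X q)"
    using smooth_vf_on_zero[of "- K"] smooth_vf_on_cong[of "- K" "\<lambda>q. \<theta> q *\<^sub>R X q" "\<lambda>q. 0"] assms by auto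
  show "\<exists>V. open V \<and> q \<in> V \<and> smooth_vf_on A V (\<lambda>q. \<theta> q *\<^sub>R X q)" for q
    using 1 2 assms by (cases "q \<in> K") (blast, metis ComplI open_Compl)
qed

text \<open>Coordinates and coordinate fields after a cutoff: global, so that they may enter
  statements about global fields, but dual to each other only on U.\<close>

definition coord_frame :: "('e \<Rightarrow> 'a \<Rightarrow> real) \<Rightarrow> ('e \<Rightarrow> 'a \<Rightarrow> 'e) \<Rightarrow> 'a set \<Rightarrow> bool" where
  "coord_frame x E U \<longleftrightarrow> (\<forall>b. smooth_fun A (x b)) \<and> (\<forall>b. vfield A (E b)) \<and> open U \<and>
    (\<forall>q\<in>U. \<forall>w. (\<Sum>b\<in>Basis. differential A (x b) q w *\<^sub>R E b q) = w)"

lemma coord_frameD: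
  assumes "coord_frame x E U"
  shows "smooth_fun A (x b)" "vfield A (E b)" "open U"
    "q \<in> U \<Longrightarrow> (\<Sum>b\<in>Basis. differential A (x b) q w *\<^sub>R E b q) = w"
  using assms by (simp_all add: coord_frame_def)

lemma coordinate_frame:
  fixes p :: 'a
  shows "\<exists>x E U. coord_frame x E U \<and> p \<in> U"
proof -
  let ?c = "chart_at A p"
  note c = chart_at[of p]
  have S: "open (snd ?c ` fst ?c)" using open_chart_image[OF c(1) open_UNIV] by simp
  have oc: "open (fst ?c)" by (rule open_chart_domain[OF c(1)])
  \<comment> \<open>\<open>X b\<close> has constant components b in the chart at p; its value at q
    is rewritten in the preferred chart at q by the Jacobian.\<close>
  define X where "X b q = frechet_derivative (tr ?c (chart_at A q)) (at (snd ?c q)) b" for b q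
  have vX: "vec_in A ?c q (X b q) = b" if "q \<in> fst ?c" for q b
    unfolding X_def vec_in_def
    using tr_cocycle[OF c(1) chart_at(1) c(1) that chart_at(2) that] tr_self[OF c(1) that] by simp
  have X: "smooth_vf_on A (fst ?c) (X b)" for b
  proof (rule smooth_vf_onI)
    fix q assume q: "q \<in> fst ?c"
    have "smooth_on (snd ?c ` fst ?c) (\<lambda>x. b)" by (rule smooth_on_const[OF S])
    then have "smooth_on (snd ?c ` fst ?c) (vf_in A ?c (X b))"
      by (rule smooth_on_cong[OF S, THEN iffD1, rotated]) (use c vX in \<open>auto simp: vf_in_def\<close>)
    then show "\<exists>c\<in>A. \<exists>V. open V \<and> q \<in> V \<and> V \<subseteq> fst c \<and> smooth_on (snd c ` V) (vf_in A c (X b))"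
      using c q oc by blast
  qed
  define y where "y b q = snd ?c q \<bullet> b" for b q
  have y: "smooth_fun_on A (fst ?c) (y b)" for b
  proof (rule smooth_fun_onI)
    fix q assume q: "q \<in> fst ?c"
    have "smooth_on (snd ?c ` fst ?c) (\<lambda>x. x \<bullet> b)"
      by (rule smooth_on_bounded_linear[OF S bounded_linear_inner_left])
    then have "smooth_on (snd ?c ` fst ?c) (\<lambda>x. y b (chart_inv ?c x))"
      by (rule smooth_on_cong[OF S, THEN iffD1, rotated]) (use c in \<open>auto simp: y_def\<close>)
    then show "\<exists>c\<in>A. \<exists>V. open V \<and> q \<in> V \<and> V \<subseteq> fst c \<and> smooth_on (snd c ` V) (\<lambda>x. y b (chart_inv c x))"
      using c q oc by blast
  qed
  obtain \<theta> K V where \<theta>: "smooth_fun A \<theta>" "closed K" "K \<subseteq> fst ?c" "\<And>q. q \<notin> K \<Longrightarrow> \<theta> q = 0"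
    and V: "open V" "p \<in> V" "V \<subseteq> fst ?c" "\<And>q. q \<in> V \<Longrightarrow> \<theta> q = 1"
    using smooth_bump_fun[OF oc c(2)] by metis
  have d: "differential A (\<lambda>q. \<theta> q * y b q) q w = vec_in A ?c q w \<bullet> b" if "q \<in> V" for q w b
  proof -
    have qc: "q \<in> fst ?c" using that V by auto
    have "\<forall>\<^sub>F q' in nhds q. \<theta> q' * y b q' = y b q'"
      using eventually_nhds_in_open[OF V(1) that] by (rule eventually_mono) (simp add: V)
    then have "differential A (\<lambda>q. \<theta> q * y b q) q w = differential A (y b) q w"
      using differential_cong by metis
    also have "\<dots> = frechet_derivative (\<lambda>x. y b (chart_inv ?c x)) (at (snd ?c q)) (vec_in A ?c q w)"
      by (rule differential_chart[OF oc y qc c(1) qc])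
    also have "frechet_derivative (\<lambda>x. y b (chart_inv ?c x)) (at (snd ?c q)) =
        frechet_derivative (\<lambda>x. x \<bullet> b) (at (snd ?c q))"
      by (rule frechet_derivative_cong_nhds, rule eventually_mono[OF eventually_nhds_in_open[OF S]])
        (use qc c in \<open>auto simp: y_def\<close>)
    also have "\<dots> = (\<lambda>x. x \<bullet> b)"
      by (intro frechet_derivative_eq bounded_linear_imp_has_derivative bounded_linear_inner_left)
    finally show ?thesis .
  qed
  have "(\<Sum>b\<in>Basis. differential A (\<lambda>q. \<theta> q * y b q) q w *\<^sub>R (\<theta> q *\<^sub>R X b q)) = w" if q: "q \<in> V" for q w
  proof -
    have qc: "q \<in> fst ?c" using q V by auto
    note lin = linear_vec_in[OF c(1) qc]
    have "vec_in A ?c q (\<Sum>b\<in>Basis. (vec_in A ?c q w \<bullet> b) *\<^sub>R X b q) = vec_in A ?c q w"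
      by (simp add: linear_sum[OF lin] linear_scale[OF lin] vX[OF qc] euclidean_representation)
    then show ?thesis
      using vec_in_inj[OF c(1) qc] V(4)[OF q] by (simp add: d[OF q])
  qed
  then have "coord_frame (\<lambda>b q. \<theta> q * y b q) (\<lambda>b q. \<theta> q *\<^sub>R X b q) V"
    unfolding coord_frame_def
    using smooth_fun_cutoff[OF oc y \<theta>] smooth_vf_cutoff[OF oc X \<theta>] V(1) by simp
  then show ?thesis using V(2) by blast
qed

lemmas sf_const = smooth_fun_on_const[OF open_UNIV]
  and sf_add = smooth_fun_on_add[OF open_UNIV]
  and sf_diff = smooth_fun_on_diff[OF open_UNIV]
  and sf_mult = smooth_fun_on_mult[OF open_UNIV]
  and sf_sum = smooth_fun_on_sum[OF open_UNIV]
  and sf_along = smooth_fun_on_along[OF open_UNIV]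
  and vf_zero = smooth_vf_on_zero[OF open_UNIV]
  and vf_add = smooth_vf_on_add[OF open_UNIV]
  and vf_diff = smooth_vf_on_diff[OF open_UNIV]
  and vf_scale = smooth_vf_on_scale[OF open_UNIV]
  and vf_sum = smooth_vf_on_sum[OF open_UNIV]

section \<open>Fields and covectors through functions; tensoriality\<close>

text \<open>In a coordinate frame the coefficients of Z are its derivatives of the coordinate
  functions, smooth by assumption. This yields smoothness of brackets without their coordinate
  formula.\<close>

lemma vfieldI:
  assumes "\<And>f. smooth_fun A f \<Longrightarrow> smooth_fun A (along A Z f)"
  shows "vfield A Z"
proof (rule smooth_vf_on_local)
  fix p :: 'a
  obtain x E U where C: "coord_frame x E U" and pU: "p \<in> U"
    using coordinate_frame[of p] by blast
  note x = coord_frameD(1)[OF C] and E = coord_frameD(2)[OF C] and U = coord_frameD(3)[OF C] pU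
    and * = coord_frameD(4)[OF C]
  have "vfield A (\<lambda>q. \<Sum>b\<in>Basis. along A Z (x b) q *\<^sub>R E b q)"
    by (intro vf_sum vf_scale assms x E)
  then have "smooth_vf_on A U (\<lambda>q. \<Sum>b\<in>Basis. along A Z (x b) q *\<^sub>R E b q)"
    by (rule smooth_vf_on_subset) simp
  then have "smooth_vf_on A U Z"
    by (rule smooth_vf_on_cong[OF U(1), THEN iffD1, rotated]) (simp add: along_def *)
  then show "\<exists>V. open V \<and> p \<in> V \<and> smooth_vf_on A V Z" using U by blast
qed

text \<open>The differentials of the coordinates separate tangent vectors. Identities between
  brackets thereby reduce to identities between derivations.\<close>

lemma vec_eqI:
  assumes "\<And>f. smooth_fun A f \<Longrightarrow> differential A f p u = differential A f p w"
  shows "u = w"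
proof -
  obtain x E U where C: "coord_frame x E U" and pU: "p \<in> U"
    using coordinate_frame[of p] by blast
  note x = coord_frameD(1)[OF C] and E = coord_frameD(2)[OF C] and U = coord_frameD(3)[OF C] pU
    and * = coord_frameD(4)[OF C]
  have "(\<Sum>b\<in>Basis. differential A (x b) p u *\<^sub>R E b p) = (\<Sum>b\<in>Basis. differential A (x b) p w *\<^sub>R E b p)"
    by (simp only: assms[OF x])
  then show ?thesis by (simp only: *[OF U(2)])
qed

text \<open>A combination of the frame fields with constant coefficients is a global extension, so
  the choice in the definition picks a genuine one.\<close>

lemma ext_vec: "vfield A (ext_vec A p w)" "ext_vec A p w p = w"
proof -
  obtain x E U where C: "coord_frame x E U" and pU: "p \<in> U"
    using coordinate_frame[of p] by blast
  note x = coord_frameD(1)[OF C] and E = coord_frameD(2)[OF C] and U = coord_frameD(3)[OF C] pU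
    and * = coord_frameD(4)[OF C]
  have "vfield A (\<lambda>q. \<Sum>b\<in>Basis. differential A (x b) p w *\<^sub>R E b q)"
    by (intro vf_sum vf_scale sf_const E)
  with *[OF U(2)] have "\<exists>X. vfield A X \<and> X p = w" by blast
  then have "vfield A (ext_vec A p w) \<and> ext_vec A p w p = w"
    unfolding ext_vec_def by (rule someI_ex)
  then show "vfield A (ext_vec A p w)" "ext_vec A p w p = w" by auto
qed

lemma linear_differential': "smooth_fun A f \<Longrightarrow> linear (differential A f p)"
  by (rule linear_differential[OF open_UNIV]) auto

lemma one_form_differential: "smooth_fun A f \<Longrightarrow> one_form A (differential A f)"
  using sf_along by (simp add: one_form_def linear_differential' along_def[abs_def])

lemma one_form_linear: "one_form A \<omega> \<Longrightarrow> linear (\<omega> p)"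
  by (simp add: one_form_def)

lemma one_form_smooth: "one_form A \<omega> \<Longrightarrow> vfield A X \<Longrightarrow> smooth_fun A (\<lambda>p. \<omega> p (X p))"
  by (simp add: one_form_def)

lemma one_form_add: "one_form A \<omega> \<Longrightarrow> one_form A \<eta> \<Longrightarrow> one_form A (\<lambda>q w. \<omega> q w + \<eta> q w)"
  by (simp add: one_form_def sf_add linear_compose_add)

lemma one_form_scale:
  assumes "smooth_fun A f" "one_form A \<omega>"
  shows "one_form A (\<lambda>q w. f q * \<omega> q w)"
  using assms linear_compose_scale_right[of "\<omega> _" "f _"] by (simp add: one_form_def sf_mult)

lemma one_form_sum: "(\<And>i. i \<in> I \<Longrightarrow> one_form A (\<omega> i)) \<Longrightarrow> one_form A (\<lambda>q w. \<Sum>i\<in>I. \<omega> i q w)"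
  by (simp add: one_form_def sf_sum linear_compose_sum)

text \<open>The function is the combination of the coordinates whose coefficients are the values of
  \<alpha> on the frame at p.\<close>

lemma covector_is_differential:
  assumes "linear \<alpha>"
  obtains f where "smooth_fun A f" "differential A f p = \<alpha>"
proof -
  obtain x E U where C: "coord_frame x E U" and pU: "p \<in> U"
    using coordinate_frame[of p] by blast
  note x = coord_frameD(1)[OF C] and E = coord_frameD(2)[OF C] and U = coord_frameD(3)[OF C] pU
    and * = coord_frameD(4)[OF C]
  have d: "smooth_fun A (\<lambda>q. \<Sum>b\<in>I. \<alpha> (E b p) * x b q) \<and>
    differential A (\<lambda>q. \<Sum>b\<in>I. \<alpha> (E b p) * x b q) p w = (\<Sum>b\<in>I. \<alpha> (E b p) * differential A (x b) p w)"
    for I w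
  proof (induction I rule: infinite_finite_induct)
    case (insert b I)
    then show ?case
      using differential_add[OF open_UNIV sf_mult[OF sf_const[of "\<alpha> (E b p)"] x[of b]], of _ p]
        differential_mult[OF open_UNIV sf_const[of "\<alpha> (E b p)"] x[of b], of p]
      by (simp add: differential_const sf_add sf_mult sf_const x)
  qed (auto simp: sf_const differential_const)
  have "\<alpha> w = (\<Sum>b\<in>Basis. \<alpha> (E b p) * differential A (x b) p w)" for w
  proof -
    have "\<alpha> w = \<alpha> (\<Sum>b\<in>Basis. differential A (x b) p w *\<^sub>R E b p)" by (simp only: *[OF U(2)])
    also have "\<dots> = (\<Sum>b\<in>Basis. \<alpha> (E b p) * differential A (x b) p w)"
      by (simp only: linear_sum[OF assms] linear_scale[OF assms] real_scaleR_def mult.commute)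
    finally show ?thesis .
  qed
  then have "differential A (\<lambda>q. \<Sum>b\<in>Basis. \<alpha> (E b p) * x b q) p = \<alpha>"
    using d[of Basis] by (intro ext) metis
  then show ?thesis
    using d[of Basis undefined] by (intro that) (rule conjunct1)
qed

lemma ext_cov:
  assumes "linear \<alpha>"
  shows "one_form A (ext_cov A p \<alpha>)" "ext_cov A p \<alpha> p = \<alpha>"
proof -
  have "\<exists>\<omega>. one_form A \<omega> \<and> \<omega> p = \<alpha>"
  proof -
    obtain f where f: "smooth_fun A f" "differential A f p = \<alpha>"
      by (rule covector_is_differential[OF assms])
    show ?thesis by (rule exI[of _ "differential A f"]) (simp add: f one_form_differential)
  qed
  then have "one_form A (ext_cov A p \<alpha>) \<and> ext_cov A p \<alpha> p = \<alpha>"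
    unfolding ext_cov_def by (rule someI_ex)
  then show "one_form A (ext_cov A p \<alpha>)" "ext_cov A p \<alpha> p = \<alpha>" by auto
qed

text \<open>With a bump function \<open>\<theta>\<close> supported where the coordinate frame \<open>E\<^sub>b\<close> is defined,
  \<open>X = (1 - \<theta>) X + \<Sum>\<^sub>b \<theta> X(x\<^sup>b) E\<^sub>b\<close> holds globally.\<close>

lemma vf_tensorial:
  fixes \<Phi> :: "('a \<Rightarrow> 'e) \<Rightarrow> 'r::real_vector"
  assumes add: "\<And>X Y. vfield A X \<Longrightarrow> vfield A Y \<Longrightarrow> \<Phi> (\<lambda>q. X q + Y q) = \<Phi> X + \<Phi> Y"
    and scale: "\<And>f X. smooth_fun A f \<Longrightarrow> vfield A X \<Longrightarrow> \<Phi> (\<lambda>q. f q *\<^sub>R X q) = f p *\<^sub>R \<Phi> X"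
    and XY: "vfield A X" "vfield A Y" "X p = Y p"
  shows "\<Phi> X = \<Phi> Y"
proof -
  obtain x E U where C: "coord_frame x E U" and pU: "p \<in> U"
    using coordinate_frame[of p] by blast
  note x = coord_frameD(1)[OF C] and E = coord_frameD(2)[OF C] and U = coord_frameD(3)[OF C] pU
    and * = coord_frameD(4)[OF C]
  obtain \<theta> K V where \<theta>: "smooth_fun A \<theta>" "K \<subseteq> U" "\<And>q. q \<notin> K \<Longrightarrow> \<theta> q = 0"
    and V: "p \<in> V" "\<And>q. q \<in> V \<Longrightarrow> \<theta> q = 1"
    using smooth_bump_fun[OF U] by metis
  have "\<Phi> (\<lambda>q. 0 *\<^sub>R (0 :: 'e)) = 0 *\<^sub>R \<Phi> (\<lambda>q. 0)"
    by (rule scale[OF sf_const vf_zero])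
  then have \<Phi>0: "\<Phi> (\<lambda>q. 0) = 0" by simp
  have sum: "\<Phi> (\<lambda>q. \<Sum>b\<in>I. Z b q) = (\<Sum>b\<in>I. \<Phi> (Z b))" if "\<And>b. vfield A (Z b)" for Z :: "'e \<Rightarrow> 'a \<Rightarrow> 'e" and I
    by (induction I rule: infinite_finite_induct) (simp_all add: \<Phi>0 add that vf_sum)
  have 0: "\<Phi> Z = (\<Sum>b\<in>Basis. differential A (x b) p (Z p) *\<^sub>R \<Phi> (E b))" if Z: "vfield A Z" for Z
  proof -
    have Zx: "smooth_fun A (\<lambda>q. \<theta> q * along A Z (x b) q)" for b by (intro sf_mult sf_along \<theta> x Z)
    have eq: "Z = (\<lambda>q. (1 - \<theta> q) *\<^sub>R Z q + (\<Sum>b\<in>Basis. (\<theta> q * along A Z (x b) q) *\<^sub>R E b q))"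
    proof
      fix q
      have "\<theta> q *\<^sub>R Z q = \<theta> q *\<^sub>R (\<Sum>b\<in>Basis. along A Z (x b) q *\<^sub>R E b q)"
      proof (cases "q \<in> U")
        case True
        then show ?thesis by (simp add: along_def *)
      next
        case False
        then have "\<theta> q = 0" using \<theta> by auto
        then show ?thesis by simp
      qed
      then have "Z q = (1 - \<theta> q) *\<^sub>R Z q + \<theta> q *\<^sub>R (\<Sum>b\<in>Basis. along A Z (x b) q *\<^sub>R E b q)"
        by (metis add.commute diff_add_cancel scaleR_left_diff_distrib scaleR_one)
      then show "Z q = (1 - \<theta> q) *\<^sub>R Z q + (\<Sum>b\<in>Basis. (\<theta> q * along A Z (x b) q) *\<^sub>R E b q)"
        by (simp add: scaleR_sum_right)
    qed
    have "\<Phi> Z = \<Phi> (\<lambda>q. (1 - \<theta> q) *\<^sub>R Z q + (\<Sum>b\<in>Basis. (\<theta> q * along A Z (x b) q) *\<^sub>R E b q))"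
      using arg_cong[OF eq, of \<Phi>] .
    also have "\<dots> = \<Phi> (\<lambda>q. (1 - \<theta> q) *\<^sub>R Z q) + (\<Sum>b\<in>Basis. \<Phi> (\<lambda>q. (\<theta> q * along A Z (x b) q) *\<^sub>R E b q))"
      by (subst add[OF vf_scale[OF sf_diff[OF sf_const \<theta>(1)] Z] vf_sum[OF vf_scale[OF Zx E]]])
        (simp add: sum[OF vf_scale[OF Zx E]])
    also have "\<dots> = (\<Sum>b\<in>Basis. differential A (x b) p (Z p) *\<^sub>R \<Phi> (E b))"
      using scale[OF sf_diff[OF sf_const \<theta>(1)] Z, of 1] V
      by (simp add: scale[OF Zx E]) (simp add: along_def)
    finally show ?thesis .
  qed
  show ?thesis using 0[OF XY(1)] 0[OF XY(2)] XY(3) by simp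
qed

text \<open>\<open>ext_vec\<close> makes an unrelated choice for every vector and need not be linear
  in w. The extension of a sum and the sum of the extensions agree at p, and tensoriality lets
  \<Phi> see only that.\<close>

lemma vf_tensorial_linear:
  fixes \<Phi> :: "('a \<Rightarrow> 'e) \<Rightarrow> 'r::real_vector"
  assumes add: "\<And>X Y. vfield A X \<Longrightarrow> vfield A Y \<Longrightarrow> \<Phi> (\<lambda>q. X q + Y q) = \<Phi> X + \<Phi> Y"
    and scale: "\<And>f X. smooth_fun A f \<Longrightarrow> vfield A X \<Longrightarrow> \<Phi> (\<lambda>q. f q *\<^sub>R X q) = f p *\<^sub>R \<Phi> X"
  shows "linear (\<lambda>w. \<Phi> (ext_vec A p w))"
proof (rule linearI)
  show "\<Phi> (ext_vec A p (u + w)) = \<Phi> (ext_vec A p u) + \<Phi> (ext_vec A p w)" for u w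
  proof -
    have "\<Phi> (ext_vec A p (u + w)) = \<Phi> (\<lambda>q. ext_vec A p u q + ext_vec A p w q)"
      by (rule vf_tensorial[of \<Phi> p, OF add scale ext_vec(1) vf_add[OF ext_vec(1) ext_vec(1)]])
        (simp_all only: ext_vec(2))
    then show ?thesis by (simp only: add[OF ext_vec(1) ext_vec(1)])
  qed
  show "\<Phi> (ext_vec A p (r *\<^sub>R w)) = r *\<^sub>R \<Phi> (ext_vec A p w)" for r w
  proof -
    have "\<Phi> (ext_vec A p (r *\<^sub>R w)) = \<Phi> (\<lambda>q. r *\<^sub>R ext_vec A p w q)"
      by (rule vf_tensorial[of \<Phi> p, OF add scale ext_vec(1) vf_scale[OF sf_const ext_vec(1)]])
        (simp_all only: ext_vec(2))
    then show ?thesis by (simp only: scale[OF sf_const ext_vec(1)])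
  qed
qed

text \<open>Dual to the argument for fields: globally Z equals \<open>(1 - \<theta>) Z\<close> plus
  the sum of the \<open>\<theta> Z(E_b) dx_b\<close>, so \<Phi> depends only on the values of Z on
  the frame at p.\<close>

lemma form_tensorial:
  fixes \<Phi> :: "('a \<Rightarrow> 'e \<Rightarrow> real) \<Rightarrow> real"
  assumes add: "\<And>\<omega> \<eta>. one_form A \<omega> \<Longrightarrow> one_form A \<eta> \<Longrightarrow> \<Phi> (\<lambda>q w. \<omega> q w + \<eta> q w) = \<Phi> \<omega> + \<Phi> \<eta>"
    and scale: "\<And>f \<omega>. smooth_fun A f \<Longrightarrow> one_form A \<omega> \<Longrightarrow> \<Phi> (\<lambda>q w. f q * \<omega> q w) = f p * \<Phi> \<omega>"
    and forms: "one_form A \<omega>" "one_form A \<eta>" "\<omega> p = \<eta> p"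
  shows "\<Phi> \<omega> = \<Phi> \<eta>"
proof -
  obtain x E U where C: "coord_frame x E U" and pU: "p \<in> U"
    using coordinate_frame[of p] by blast
  note x = coord_frameD(1)[OF C] and E = coord_frameD(2)[OF C] and U = coord_frameD(3)[OF C] pU
    and * = coord_frameD(4)[OF C]
  obtain \<theta> K V where \<theta>: "smooth_fun A \<theta>" "K \<subseteq> U" "\<And>q. q \<notin> K \<Longrightarrow> \<theta> q = 0"
    and V: "p \<in> V" "\<And>q. q \<in> V \<Longrightarrow> \<theta> q = 1"
    using smooth_bump_fun[OF U] by metis
  have f0: "one_form A (\<lambda>q w. 0)" by (simp add: one_form_def sf_const linear_iff)
  have "\<Phi> (\<lambda>q w. 0 * 0) = 0 * \<Phi> (\<lambda>q w. 0)"
    by (rule scale[OF sf_const f0])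
  then have \<Phi>0: "\<Phi> (\<lambda>q w. 0) = 0" by simp
  have sum: "\<Phi> (\<lambda>q w. \<Sum>b\<in>I. Z b q w) = (\<Sum>b\<in>I. \<Phi> (Z b))" if "\<And>b. one_form A (Z b)"
    for Z :: "'e \<Rightarrow> 'a \<Rightarrow> 'e \<Rightarrow> real" and I
    by (induction I rule: infinite_finite_induct) (simp_all add: \<Phi>0 add that one_form_sum)
  have 0: "\<Phi> Z = (\<Sum>b\<in>Basis. Z p (E b p) * \<Phi> (differential A (x b)))" if Z: "one_form A Z" for Z
  proof -
    have ZE: "smooth_fun A (\<lambda>q. \<theta> q * Z q (E b q))" for b by (intro sf_mult one_form_smooth \<theta> E Z)
    have dx: "one_form A (differential A (x b))" for b by (rule one_form_differential[OF x])
    have eq: "Z = (\<lambda>q w. (1 - \<theta> q) * Z q w + (\<Sum>b\<in>Basis. (\<theta> q * Z q (E b q)) * differential A (x b) q w))"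
    proof (intro ext)
      fix q w
      have "\<theta> q * Z q w = \<theta> q * (\<Sum>b\<in>Basis. Z q (E b q) * differential A (x b) q w)"
      proof (cases "q \<in> U")
        case True
        have "Z q w = Z q (\<Sum>b\<in>Basis. differential A (x b) q w *\<^sub>R E b q)" by (simp only: *[OF True])
        also have "\<dots> = (\<Sum>b\<in>Basis. Z q (E b q) * differential A (x b) q w)"
          by (simp only: linear_sum[OF one_form_linear[OF Z]] linear_scale[OF one_form_linear[OF Z]]
              real_scaleR_def mult.commute)
        finally show ?thesis by (rule arg_cong)
      next
        case False
        then have "\<theta> q = 0" using \<theta> by auto
        then show ?thesis by simp
      qed
      then show "Z q w = (1 - \<theta> q) * Z q w + (\<Sum>b\<in>Basis. (\<theta> q * Z q (E b q)) * differential A (x b) q w)"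
        by (simp add: sum_distrib_left algebra_simps)
    qed
    have "\<Phi> Z = \<Phi> (\<lambda>q w. (1 - \<theta> q) * Z q w + (\<Sum>b\<in>Basis. (\<theta> q * Z q (E b q)) * differential A (x b) q w))"
      using arg_cong[OF eq, of \<Phi>] .
    also have "\<dots> = \<Phi> (\<lambda>q w. (1 - \<theta> q) * Z q w) + (\<Sum>b\<in>Basis. \<Phi> (\<lambda>q w. (\<theta> q * Z q (E b q)) * differential A (x b) q w))"
      by (subst add[OF one_form_scale[OF sf_diff[OF sf_const \<theta>(1)] Z] one_form_sum[OF one_form_scale[OF ZE dx]]])
        (simp add: sum[OF one_form_scale[OF ZE dx]])
    also have "\<dots> = (\<Sum>b\<in>Basis. Z p (E b p) * \<Phi> (differential A (x b)))"
      using scale[OF sf_diff[OF sf_const \<theta>(1)] Z, of 1] V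
      by (simp add: scale[OF ZE dx])
    finally show ?thesis .
  qed
  show ?thesis using 0[OF forms(1)] 0[OF forms(2)] forms(3) by simp
qed

section \<open>Derivations and the Lie bracket\<close>

lemma along_add:
  "smooth_fun A f \<Longrightarrow> smooth_fun A g \<Longrightarrow> along A X (\<lambda>q. f q + g q) p = along A X f p + along A X g p"
  by (simp add: along_def differential_add[OF open_UNIV])

lemma along_mult:
  "smooth_fun A f \<Longrightarrow> smooth_fun A g \<Longrightarrow>
    along A X (\<lambda>q. f q * g q) p = f p * along A X g p + along A X f p * g p"
  by (simp add: along_def differential_mult[OF open_UNIV])

lemma along_const: "along A X (\<lambda>q. a) p = 0"
  by (simp add: along_def differential_const)

lemma along_diff:
  assumes "smooth_fun A f" "smooth_fun A g"
  shows "along A X (\<lambda>q. f q - g q) p = along A X f p - along A X g p"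
  using along_add[OF sf_diff[OF assms] assms(2), of X p] by simp

lemma along_sum:
  "(\<And>i. i \<in> I \<Longrightarrow> smooth_fun A (f i)) \<Longrightarrow> along A X (\<lambda>q. \<Sum>i\<in>I. f i q) p = (\<Sum>i\<in>I. along A X (f i) p)"
  by (induction I rule: infinite_finite_induct) (simp_all add: along_const along_add sf_sum)

lemma along_cong: "\<forall>\<^sub>F q in nhds p. f q = g q \<Longrightarrow> along A X f p = along A X g p"
  by (simp add: along_def differential_cong)

lemma along_vec_add:
  "smooth_fun A f \<Longrightarrow> along A (\<lambda>q. X q + Y q) f p = along A X f p + along A Y f p"
  by (simp add: along_def linear_add linear_differential')


lemma along_vec_scale:
  "smooth_fun A f \<Longrightarrow> along A (\<lambda>q. h q *\<^sub>R X q) f p = h p * along A X f p"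
  by (simp add: along_def linear_scale linear_differential')

lemma along_bracket:
  "smooth_fun A f \<Longrightarrow> vfield A X \<Longrightarrow> vfield A Y \<Longrightarrow>
    along A (bracket A X Y) f p = along A X (along A Y f) p - along A Y (along A X f) p"
  by (simp add: along_def[of A "bracket A X Y"] differential_bracket)

lemma along_bracket_fun:
  "smooth_fun A f \<Longrightarrow> vfield A X \<Longrightarrow> vfield A Y \<Longrightarrow>
    along A (bracket A X Y) f = (\<lambda>p. along A X (along A Y f) p - along A Y (along A X f) p)"
  by (rule ext) (rule along_bracket)

lemma vf_bracket: "vfield A X \<Longrightarrow> vfield A Y \<Longrightarrow> vfield A (bracket A X Y)"
  by (rule vfieldI) (simp add: along_bracket_fun sf_diff sf_along)

text \<open>Tested on functions, where a bracket is a commutator of derivations. The algebra of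
  brackets rests on this and never reopens the coordinate formula.\<close>

lemma bracket_add_right:
  assumes "vfield A X" "vfield A Y" "vfield A Z"
  shows "bracket A X (\<lambda>q. Y q + Z q) p = bracket A X Y p + bracket A X Z p"
proof (rule vec_eqI[of p])
  fix f assume f: "smooth_fun A f"
  show "differential A f p (bracket A X (\<lambda>q. Y q + Z q) p) = differential A f p (bracket A X Y p + bracket A X Z p)"
    by (simp add: linear_add[OF linear_differential'[OF f]] differential_bracket[OF f] assms vf_add
        along_vec_add[OF f, abs_def] along_vec_add[OF sf_along[OF f assms(1)]] along_add sf_along f)
qed

lemma bracket_antisym:
  assumes "vfield A X" "vfield A Y"
  shows "bracket A X Y p = - bracket A Y X p"
  by (rule vec_eqI[of p])
    (simp add: linear_neg[OF linear_differential'] differential_bracket assms)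

lemma bracket_scale_right:
  assumes "smooth_fun A h" "vfield A X" "vfield A Y"
  shows "bracket A X (\<lambda>q. h q *\<^sub>R Y q) p = along A X h p *\<^sub>R Y p + h p *\<^sub>R bracket A X Y p"
proof (rule vec_eqI[of p])
  fix f assume f: "smooth_fun A f"
  have "along A (\<lambda>q. h q *\<^sub>R Y q) f = (\<lambda>q. h q * along A Y f q)"
    by (rule ext) (rule along_vec_scale[OF f])
  then show "differential A f p (bracket A X (\<lambda>q. h q *\<^sub>R Y q) p) =
      differential A f p (along A X h p *\<^sub>R Y p + h p *\<^sub>R bracket A X Y p)"
    by (simp add: linear_add[OF linear_differential'[OF f]] linear_scale[OF linear_differential'[OF f]]
        differential_bracket[OF f] assms vf_scale along_mult sf_along f
        along_vec_scale[OF sf_along[OF f assms(2)]])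
      (simp add: along_def[of A Y f p] along_def[of A X h p] algebra_simps)
qed

text \<open>Applied to a function, each double bracket is four triple derivatives; the twelve of
  them cancel in pairs.\<close>

lemma bracket_jacobi:
  assumes "vfield A X" "vfield A Y" "vfield A Z"
  shows "bracket A X (bracket A Y Z) p + bracket A Y (bracket A Z X) p + bracket A Z (bracket A X Y) p = 0"
proof (rule vec_eqI[of p])
  fix f assume f: "smooth_fun A f"
  have *: "differential A f p (bracket A U (bracket A V W) p) =
      along A U (along A V (along A W f)) p - along A U (along A W (along A V f)) p
      - (along A V (along A W (along A U f)) p - along A W (along A V (along A U f)) p)"
    if "vfield A U" "vfield A V" "vfield A W" for U V W
    by (simp add: differential_bracket[OF f] vf_bracket that along_bracket_fun f along_diff sf_along)
  show "differential A f p (bracket A X (bracket A Y Z) p + bracket A Y (bracket A Z X) p + bracket A Z (bracket A X Y) p)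
     = differential A f p 0"
    by (simp add: linear_add[OF linear_differential'[OF f]] linear_0[OF linear_differential'[OF f]] * assms)
qed

end

section \<open>Orthonormal bases and traces\<close>

text \<open>The fibrewise part of \<open>metric_on\<close>: values of s outside S remain
  unconstrained.\<close>

definition inner_on :: "'e::euclidean_space set \<Rightarrow> ('e \<Rightarrow> 'e \<Rightarrow> real) \<Rightarrow> bool" where
  "inner_on S s \<longleftrightarrow> subspace S \<and>
     (\<forall>u\<in>S. \<forall>w\<in>S. s u w = s w u) \<and>
     (\<forall>u\<in>S. \<forall>u'\<in>S. \<forall>w\<in>S. s (u + u') w = s u w + s u' w) \<and>
     (\<forall>u\<in>S. \<forall>w\<in>S. \<forall>a. s (a *\<^sub>R u) w = a * s u w) \<and>
     (\<forall>u\<in>S. u \<noteq> 0 \<longrightarrow> s u u > 0)"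

definition orthonormal :: "nat \<Rightarrow> 'e::euclidean_space set \<Rightarrow> ('e \<Rightarrow> 'e \<Rightarrow> real) \<Rightarrow> (nat \<Rightarrow> 'e) \<Rightarrow> bool" where
  "orthonormal r S s b \<longleftrightarrow> (\<forall>i<r. b i \<in> S) \<and> (\<forall>i<r. \<forall>j<r. s (b i) (b j) = (if i = j then 1 else 0))"

lemma inner_on_subspace: "inner_on S s \<Longrightarrow> subspace S"
  by (simp add: inner_on_def)

lemma inner_on_commute: "inner_on S s \<Longrightarrow> u \<in> S \<Longrightarrow> w \<in> S \<Longrightarrow> s u w = s w u"
  unfolding inner_on_def by blast

lemma inner_on_add:
  "inner_on S s \<Longrightarrow> u \<in> S \<Longrightarrow> u' \<in> S \<Longrightarrow> w \<in> S \<Longrightarrow> s (u + u') w = s u w + s u' w"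
  by (simp add: inner_on_def)

lemma inner_on_scale: "inner_on S s \<Longrightarrow> u \<in> S \<Longrightarrow> w \<in> S \<Longrightarrow> s (a *\<^sub>R u) w = a * s u w"
  by (simp add: inner_on_def)

lemma inner_on_pos: "inner_on S s \<Longrightarrow> u \<in> S \<Longrightarrow> u \<noteq> 0 \<Longrightarrow> s u u > 0"
  by (simp add: inner_on_def)

lemma inner_on_zero: "inner_on S s \<Longrightarrow> w \<in> S \<Longrightarrow> s 0 w = 0"
  using inner_on_scale[of S s 0 w 0] by (simp add: inner_on_subspace subspace_0)

lemma inner_on_nonneg: "inner_on S s \<Longrightarrow> u \<in> S \<Longrightarrow> s u u \<ge> 0"
  using inner_on_pos[of S s u] inner_on_zero[of S s u] by (cases "u = 0") auto

lemma inner_on_sum: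
  assumes "inner_on S s" "\<And>i. i \<in> I \<Longrightarrow> u i \<in> S" "w \<in> S"
  shows "s (\<Sum>i\<in>I. u i) w = (\<Sum>i\<in>I. s (u i) w)"
  using assms(2)
proof (induction I rule: infinite_finite_induct)
  case (insert i I)
  then show ?case
    using inner_on_add[OF assms(1), of "u i" "\<Sum>i\<in>I. u i" w] assms(3)
      subspace_sum[OF inner_on_subspace[OF assms(1)], of I u]
    by simp
qed (use inner_on_zero[OF assms(1,3)] in simp_all)

lemma inner_on_mono: "inner_on S s \<Longrightarrow> subspace T \<Longrightarrow> T \<subseteq> S \<Longrightarrow> inner_on T s"
  unfolding inner_on_def by blast

lemma inner_on_sum_orthonormal:
  assumes "inner_on S s" "orthonormal r S s b" "j < r"
  shows "s (\<Sum>i<r. c i *\<^sub>R b i) (b j) = c j"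
proof -
  have b: "b i \<in> S" if "i < r" for i using assms that by (simp add: orthonormal_def)
  have "s (\<Sum>i<r. c i *\<^sub>R b i) (b j) = (\<Sum>i<r. s (c i *\<^sub>R b i) (b j))"
    using assms b by (intro inner_on_sum) (auto intro: subspace_scale inner_on_subspace)
  also have "\<dots> = (\<Sum>i<r. if i = j then c i else 0)"
    by (rule sum.cong) (use assms b in \<open>auto simp: inner_on_scale orthonormal_def\<close>)
  finally show ?thesis using assms(3) by simp
qed

text \<open>Orthonormal vectors are independent, and there are as many as the dimension, so they
  span S. The vectors that satisfy the expansion form a subspace containing each
  \<open>b i\<close>.\<close>

lemma orthonormal_expansion:
  assumes s: "inner_on S s" and b: "orthonormal r S s b" and r: "r = dim S" and w: "w \<in> S"
  shows "(\<Sum>i<r. s w (b i) *\<^sub>R b i) = w"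
proof -
  have bS: "b i \<in> S" if "i < r" for i using b that by (simp add: orthonormal_def)
  have inj: "inj_on b {..<r}"
  proof (rule inj_onI)
    fix i j assume "i \<in> {..<r}" "j \<in> {..<r}" "b i = b j"
    then show "i = j" using b unfolding orthonormal_def by (metis lessThan_iff zero_neq_one)
  qed
  have "independent (b ` {..<r})"
  proof (rule independent_if_scalars_zero)
    fix f x assume *: "(\<Sum>x\<in>b ` {..<r}. f x *\<^sub>R x) = 0" and "x \<in> b ` {..<r}"
    then obtain j where j: "j < r" "x = b j" by auto
    have "(\<Sum>i<r. f (b i) *\<^sub>R b i) = 0" using * by (simp add: sum.reindex[OF inj])
    then have "f (b j) = s 0 (b j)"
      using inner_on_sum_orthonormal[OF s b j(1), of "\<lambda>i. f (b i)"] by simp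
    then show "f x = 0" using inner_on_zero[OF s bS[OF j(1)]] j by simp
  qed simp
  moreover have "card (b ` {..<r}) = r" using inj by (simp add: card_image)
  ultimately have span: "S \<subseteq> span (b ` {..<r})"
    using bS r by (intro card_ge_dim_independent) auto
  define P where "P = {w \<in> S. w = (\<Sum>i<r. s w (b i) *\<^sub>R b i)}"
  have P0: "0 \<in> P"
    using s bS by (simp add: P_def inner_on_subspace subspace_0 inner_on_zero[OF s])
  have P1: "x + y \<in> P" if "x \<in> P" "y \<in> P" for x y
  proof -
    have xy: "x \<in> S" "x = (\<Sum>i<r. s x (b i) *\<^sub>R b i)" "y \<in> S" "y = (\<Sum>i<r. s y (b i) *\<^sub>R b i)"
      using that unfolding P_def by blast+
    have "(\<Sum>i<r. s (x + y) (b i) *\<^sub>R b i) = (\<Sum>i<r. s x (b i) *\<^sub>R b i) + (\<Sum>i<r. s y (b i) *\<^sub>R b i)"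
      unfolding sum.distrib[symmetric]
      by (rule sum.cong) (use xy(1,3) bS in \<open>simp_all add: inner_on_add[OF s] scaleR_add_left\<close>)
    also have "\<dots> = x + y" by (rule arg_cong2[OF xy(2,4)[symmetric]])
    finally show ?thesis
      using xy(1,3) s unfolding P_def by (auto intro: subspace_add inner_on_subspace)
  qed
  have P2: "a *\<^sub>R x \<in> P" if "x \<in> P" for a x
  proof -
    have x: "x \<in> S" "x = (\<Sum>i<r. s x (b i) *\<^sub>R b i)"
      using that unfolding P_def by blast+
    have "(\<Sum>i<r. s (a *\<^sub>R x) (b i) *\<^sub>R b i) = a *\<^sub>R (\<Sum>i<r. s x (b i) *\<^sub>R b i)"
      unfolding scaleR_sum_right
      by (rule sum.cong) (use x(1) bS in \<open>simp_all add: inner_on_scale[OF s]\<close>)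
    also have "\<dots> = a *\<^sub>R x" by (rule arg_cong[OF x(2)[symmetric]])
    finally show ?thesis
      using x(1) s unfolding P_def by (auto intro: subspace_scale inner_on_subspace)
  qed
  have "subspace P" using P0 P1 P2 by (rule subspaceI)
  moreover have "b ` {..<r} \<subseteq> P"
  proof clarsimp
    fix j assume j: "j < r"
    have "(\<Sum>i<r. s (b j) (b i) *\<^sub>R b i) = (\<Sum>i<r. if i = j then b i else 0)"
      by (rule sum.cong) (use b j in \<open>auto simp: orthonormal_def\<close>)
    then show "b j \<in> P" using j bS by (simp add: P_def)
  qed
  ultimately have "span (b ` {..<r}) \<subseteq> P" by (simp add: span_minimal)
  then have "w \<in> P" using span w by blast
  then have "w = (\<Sum>i<r. s w (b i) *\<^sub>R b i)" unfolding P_def by blast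
  then show ?thesis by (rule sym)
qed

text \<open>After b is expanded in e, the coefficient of T(e_i, e_j) is the sum over k of s(b_k,
  e_i) s(b_k, e_j), which is 1 or 0 because a change of orthonormal basis is orthogonal. This frees
  \<open>trace_on\<close> from the basis picked by choice.\<close>

lemma trace_orthonormal_unique:
  assumes s: "inner_on S s" and r: "r = dim S"
    and b: "orthonormal r S s b" and e: "orthonormal r S s e"
    and T1: "\<And>w. linear (\<lambda>u. T u w)" and T2: "\<And>u. linear (T u)"
  shows "(\<Sum>i<r. T (b i) (b i)) = (\<Sum>i<r. T (e i) (e i) :: real)"
proof -
  have bS: "b i \<in> S" "e i \<in> S" if "i < r" for i using b e that by (simp_all add: orthonormal_def)
  have T: "T (\<Sum>i<r. x i *\<^sub>R e i) (\<Sum>j<r. y j *\<^sub>R e j) = (\<Sum>i<r. \<Sum>j<r. x i * y j * T (e i) (e j))" for x y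
    unfolding linear_sum[OF T1] linear_scale[OF T1]
    by (simp add: linear_sum[OF T2] linear_scale[OF T2] sum_distrib_left mult_ac)
  have "(\<Sum>k<r. T (b k) (b k)) = (\<Sum>k<r. \<Sum>i<r. \<Sum>j<r. s (b k) (e i) * s (b k) (e j) * T (e i) (e j))"
  proof (rule sum.cong)
    fix k assume "k \<in> {..<r}"
    then have "(\<Sum>i<r. s (b k) (e i) *\<^sub>R e i) = b k" using bS by (intro orthonormal_expansion[OF s e r]) auto
    then show "T (b k) (b k) = (\<Sum>i<r. \<Sum>j<r. s (b k) (e i) * s (b k) (e j) * T (e i) (e j))"
      using T[of "\<lambda>i. s (b k) (e i)" "\<lambda>i. s (b k) (e i)"] by simp
  qed simp
  also have "\<dots> = (\<Sum>i<r. \<Sum>j<r. (\<Sum>k<r. s (b k) (e i) * s (b k) (e j)) * T (e i) (e j))"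
    unfolding sum_distrib_right
    by (subst sum.swap) (rule sum.cong[OF refl], rule sum.swap)
  also have "\<dots> = (\<Sum>i<r. \<Sum>j<r. (if i = j then T (e i) (e j) else 0))"
  proof (intro sum.cong refl)
    fix i j assume ij: "i \<in> {..<r}" "j \<in> {..<r}"
    have "s (e i) (e j) = s (\<Sum>k<r. s (e i) (b k) *\<^sub>R b k) (e j)"
      using ij bS by (subst orthonormal_expansion[OF s b r]) auto
    also have "\<dots> = (\<Sum>k<r. s (s (e i) (b k) *\<^sub>R b k) (e j))"
      using ij bS by (intro inner_on_sum[OF s]) (auto intro: subspace_scale inner_on_subspace[OF s])
    also have "\<dots> = (\<Sum>k<r. s (b k) (e i) * s (b k) (e j))"
      by (rule sum.cong) (use ij bS in \<open>auto simp: inner_on_scale[OF s] inner_on_commute[OF s]\<close>)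
    finally show "(\<Sum>k<r. s (b k) (e i) * s (b k) (e j)) * T (e i) (e j) = (if i = j then T (e i) (e j) else 0)"
      using e ij by (auto simp: orthonormal_def)
  qed
  also have "\<dots> = (\<Sum>i<r. T (e i) (e i))" by simp
  finally show ?thesis .
qed

text \<open>The choice in \<open>onb\<close> is meaningful once some orthonormal basis exists; the
  local frames provide one.\<close>

lemma onb_orthonormal:
  assumes "orthonormal (dim S) S s b"
  shows "orthonormal (dim S) S s (onb S s)"
proof -
  have "orthonormal (dim S) S s (SOME b. orthonormal (dim S) S s b)"
    using assms by (rule someI[of "orthonormal (dim S) S s"])
  then show ?thesis by (simp only: onb_def orthonormal_def)
qed

lemma trace_on_eq:
  assumes "inner_on S s" "r = dim S" "orthonormal r S s b"
    "\<And>w. linear (\<lambda>u. T u w)" "\<And>u. linear (T u)"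
  shows "trace_on S s T = (\<Sum>i<r. T (b i) (b i))"
  unfolding trace_on_def
  using trace_orthonormal_unique[OF assms(1) refl onb_orthonormal[of S s b] _ assms(4,5)] assms(2,3) by simp

section \<open>Orthonormal frames\<close>

context manifold
begin

text \<open>The process runs on all fibres over U at once. Equality of the spans is carried along
  because it keeps \<open>X r\<close> off the span of the vectors already built; so the remainder Z
  never vanishes and division by its norm is smooth.\<close>

lemma gram_schmidt:
  assumes U: "open U" and s: "\<And>q. q \<in> U \<Longrightarrow> inner_on (B q) (s q)"
    and smooth: "\<And>X Y. smooth_vf_on A U X \<Longrightarrow> smooth_vf_on A U Y \<Longrightarrow>
        (\<And>q. q \<in> U \<Longrightarrow> X q \<in> B q \<and> Y q \<in> B q) \<Longrightarrow> smooth_fun_on A U (\<lambda>q. s q (X q) (Y q))"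
  shows "(\<And>i. i < r \<Longrightarrow> smooth_vf_on A U (X i)) \<Longrightarrow> (\<And>i q. i < r \<Longrightarrow> q \<in> U \<Longrightarrow> X i q \<in> B q) \<Longrightarrow>
    (\<And>i q. i < r \<Longrightarrow> q \<in> U \<Longrightarrow> X i q \<notin> span ((\<lambda>j. X j q) ` {..<i})) \<Longrightarrow>
    \<exists>E. (\<forall>i<r. smooth_vf_on A U (E i)) \<and>
      (\<forall>q\<in>U. orthonormal r (B q) (s q) (\<lambda>i. E i q) \<and>
        span ((\<lambda>i. E i q) ` {..<r}) = span ((\<lambda>i. X i q) ` {..<r}))"
proof (induction r)
  case 0
  then show ?case by (simp add: orthonormal_def)
next
  case (Suc r)
  have "\<exists>E. (\<forall>i<r. smooth_vf_on A U (E i)) \<and>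
      (\<forall>q\<in>U. orthonormal r (B q) (s q) (\<lambda>i. E i q) \<and>
        span ((\<lambda>i. E i q) ` {..<r}) = span ((\<lambda>i. X i q) ` {..<r}))"
    by (rule Suc.IH) (use Suc.prems in auto)
  then obtain E where E': "\<forall>i<r. smooth_vf_on A U (E i)"
    "\<forall>q\<in>U. orthonormal r (B q) (s q) (\<lambda>i. E i q) \<and>
        span ((\<lambda>i. E i q) ` {..<r}) = span ((\<lambda>i. X i q) ` {..<r})"
    by blast
  have E: "smooth_vf_on A U (E i)" if "i < r" for i using E'(1) that by blast
  have on: "orthonormal r (B q) (s q) (\<lambda>i. E i q)" if "q \<in> U" for q using E'(2) that by blast
  have sp: "span ((\<lambda>i. E i q) ` {..<r}) = span ((\<lambda>i. X i q) ` {..<r})" if "q \<in> U" for q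
    using E'(2) that by blast
  have EB: "E i q \<in> B q" if "i < r" "q \<in> U" for i q using on[OF that(2)] that by (simp add: orthonormal_def)
  have sub: "subspace (B q)" if "q \<in> U" for q using s[OF that] by (rule inner_on_subspace)
  define P where "P q = (\<Sum>j<r. s q (X r q) (E j q) *\<^sub>R E j q)" for q
  define Z where "Z q = X r q - P q" for q
  define N where "N q = s q (Z q) (Z q)" for q
  define F where "F q = (N q powr (- 1/2)) *\<^sub>R Z q" for q
  have PB: "P q \<in> B q" if "q \<in> U" for q
    unfolding P_def using sub that EB by (auto intro!: subspace_sum subspace_scale)
  have ZB: "Z q \<in> B q" if "q \<in> U" for q
    unfolding Z_def using sub PB that Suc.prems(2) by (auto intro!: subspace_diff)
  have Pspan: "P q \<in> span ((\<lambda>i. E i q) ` {..<r})" if "q \<in> U" for q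
    unfolding P_def by (intro span_sum span_scale span_base) auto
  have Z0: "Z q \<noteq> 0" if "q \<in> U" for q
    using Pspan[OF that] Suc.prems(3)[of r q] that sp[OF that] by (auto simp: Z_def)
  have N: "N q > 0" if "q \<in> U" for q
    unfolding N_def using inner_on_pos[OF s] ZB Z0 that by auto
  have sZ: "smooth_vf_on A U Z"
    unfolding Z_def P_def
    by (intro smooth_vf_on_diff smooth_vf_on_sum smooth_vf_on_scale smooth U) (use E EB Suc.prems in auto)
  have sF: "smooth_vf_on A U F"
    unfolding F_def
    by (intro smooth_vf_on_scale smooth_fun_on_powr U N sZ) (auto simp: N_def intro!: smooth sZ ZB)
  have FB: "F q \<in> B q" if "q \<in> U" for q
    unfolding F_def using sub ZB that by (auto intro: subspace_scale)
  have ZE: "s q (Z q) (E j q) = 0" if "q \<in> U" "j < r" for q j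
  proof -
    have "s q (Z q + P q) (E j q) = s q (Z q) (E j q) + s q (P q) (E j q)"
      by (rule inner_on_add[OF s]) (use that ZB PB EB in auto)
    moreover have "s q (P q) (E j q) = s q (X r q) (E j q)"
      unfolding P_def using inner_on_sum_orthonormal[OF s on] that by auto
    ultimately show ?thesis by (simp add: Z_def)
  qed
  have FE: "s q (F q) (E j q) = 0" if "q \<in> U" "j < r" for q j
    using inner_on_scale[OF s, of q "Z q" "E j q"] that ZB EB ZE by (simp add: F_def)
  have FF: "s q (F q) (F q) = 1" if "q \<in> U" for q
  proof -
    have F: "s q (F q) w = N q powr (- 1/2) * s q (Z q) w" if "w \<in> B q" for w
      unfolding F_def by (rule inner_on_scale[OF s]) (use \<open>q \<in> U\<close> ZB that in auto)
    have "s q (F q) (F q) = N q powr (- 1/2) * s q (Z q) (F q)"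
      by (rule F[OF FB[OF that]])
    also have "s q (Z q) (F q) = s q (F q) (Z q)"
      by (rule inner_on_commute[OF s]) (use that ZB FB in auto)
    also have "\<dots> = N q powr (- 1/2) * N q"
      unfolding N_def[of q] by (subst F[OF ZB[OF that]]) (simp add: N_def)
    also have "N q powr (- 1/2) * (N q powr (- 1/2) * N q) = (N q powr (- 1/2) * N q powr (- 1/2)) * N q"
      by simp
    also have "\<dots> = 1"
      unfolding powr_add[symmetric] using N[OF that] by (simp add: powr_minus)
    finally show ?thesis .
  qed
  define E' where "E' = E(r := F)"
  have "orthonormal (Suc r) (B q) (s q) (\<lambda>i. E' i q)" if q: "q \<in> U" for q
    unfolding orthonormal_def
  proof (intro conjI allI impI)
    fix i assume i: "i < Suc r"
    then show "E' i q \<in> B q" using EB FB q by (auto simp: E'_def less_Suc_eq)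
    fix j assume j: "j < Suc r"
    have "s q (E j q) (F q) = 0" if "j < r" for j
      using inner_on_commute[OF s[OF q] EB[OF that q] FB[OF q]] FE[OF q that] by simp
    then show "s q (E' i q) (E' j q) = (if i = j then 1 else 0)"
      using i j on[OF q] FE[OF q] FF[OF q] by (auto simp: E'_def less_Suc_eq orthonormal_def)
  qed
  moreover have "span ((\<lambda>i. E' i q) ` {..<Suc r}) = span ((\<lambda>i. X i q) ` {..<Suc r})" if q: "q \<in> U" for q
  proof -
    let ?E = "(\<lambda>i. E i q) ` {..<r}" and ?X = "(\<lambda>i. X i q) ` {..<r}"
    have E': "(\<lambda>i. E' i q) ` {..<Suc r} = insert (F q) ?E"
      by (auto simp: E'_def lessThan_Suc)
    have X': "(\<lambda>i. X i q) ` {..<Suc r} = insert (X r q) ?X"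
      by (auto simp: lessThan_Suc)
    have EX: "span ?E = span ?X" by (rule sp[OF q])
    have m: "span ?E \<subseteq> span (insert (X r q) ?X)" "span ?X \<subseteq> span (insert (F q) ?E)"
      unfolding EX using EX by (auto intro: span_mono[THEN subsetD] simp: EX[symmetric])
    have "Z q \<in> span (insert (X r q) ?X)"
      unfolding Z_def using Pspan[OF q] m by (intro span_diff) (auto intro: span_base)
    then have F: "F q \<in> span (insert (X r q) ?X)" unfolding F_def by (rule span_scale)
    have "Z q = (N q powr (1/2)) *\<^sub>R F q"
      using N[OF q] by (simp add: F_def powr_minus)
    then have "Z q \<in> span (insert (F q) ?E)" by (simp add: span_scale span_base)
    then have "Z q + P q \<in> span (insert (F q) ?E)"
      by (rule span_add) (use Pspan[OF q] span_mono[of ?E "insert (F q) ?E"] in auto)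
    then have X: "X r q \<in> span (insert (F q) ?E)" by (simp add: Z_def)
    show ?thesis
      unfolding E' X' span_eq using F X m by (auto intro: span_base)
  qed
  moreover have "\<forall>i<Suc r. smooth_vf_on A U (E' i)"
    using E sF by (simp add: E'_def less_Suc_eq)
  ultimately show ?case by blast
qed

text \<open>Fields that span a fibre and are as many as its dimension are independent: otherwise one
  could be dropped and r - 1 vectors would span a space of dimension r.\<close>

lemma subbundle_local_frame:
  assumes "subbundle A r B"
  obtains U X where "open U" "p \<in> U" "\<And>i. i < r \<Longrightarrow> smooth_vf_on A U (X i)"
    "\<And>q. q \<in> U \<Longrightarrow> B q = span ((\<lambda>i. X i q) ` {..<r})"
    "\<And>i q. i < r \<Longrightarrow> q \<in> U \<Longrightarrow> X i q \<notin> span ((\<lambda>j. X j q) ` {..<i})"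
proof -
  obtain U and X :: "nat \<Rightarrow> 'a \<Rightarrow> 'e" where U: "open U" "p \<in> U" and X: "\<forall>i<r. smooth_vf_on A U (X i)"
    and sp: "\<forall>q\<in>U. B q = span ((\<lambda>i. X i q) ` {..<r})"
    using assms unfolding subbundle_def by metis
  have "X i q \<notin> span ((\<lambda>j. X j q) ` {..<i})" if "i < r" "q \<in> U" for i q
  proof
    let ?S = "(\<lambda>j. X j q) ` ({..<r} - {i})"
    assume "X i q \<in> span ((\<lambda>j. X j q) ` {..<i})"
    also have "\<dots> \<subseteq> span ?S" by (rule span_mono) (use that in auto)
    finally have "(\<lambda>j. X j q) ` {..<r} \<subseteq> span ?S" by (auto intro: span_base)
    then have "B q \<subseteq> span ?S"
      using sp that(2) span_minimal[OF _ subspace_span, of "(\<lambda>j. X j q) ` {..<r}" ?S] by auto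
    then have "dim (B q) \<le> card ?S" by (rule dim_le_card) simp
    also have "\<dots> \<le> card ({..<r} - {i})" by (rule card_image_le) simp
    also have "\<dots> < r" using that by simp
    finally show False using assms by (simp add: subbundle_def)
  qed
  then show ?thesis using that[OF U] X sp by blast
qed

end

section \<open>Adapted frames\<close>

lemma proj_eqI:
  assumes "subspace S" "subspace S'" "S \<inter> S' = {0}" "a \<in> S" "w - a \<in> S'"
  shows "proj S S' w = a"
  unfolding proj_def
proof (rule the_equality)
  fix b assume b: "b \<in> S \<and> w - b \<in> S'"
  have "b - a \<in> S" using b assms by (auto intro: subspace_diff)
  moreover have "b - a = (w - a) - (w - b)" by simp
  then have "b - a \<in> S'" using b assms by (metis subspace_diff)
  ultimately have "b - a = 0" using assms(3) by blast
  then show "b = a" by simp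
qed (use assms in simp)

lemma inner_on_metric: "subbundle A r B \<Longrightarrow> metric_on A B s \<Longrightarrow> inner_on (B p) (s p)"
  by (auto simp: inner_on_def metric_on_def subbundle_def)

lemma metric_on_smooth:
  assumes "metric_on A B s" "open U" "smooth_vf_on A U X" "smooth_vf_on A U Y"
    "\<And>q. q \<in> U \<Longrightarrow> X q \<in> B q \<and> Y q \<in> B q"
  shows "smooth_fun_on A U (\<lambda>q. s q (X q) (Y q))"
  using assms unfolding metric_on_def by simp

text \<open>D is any operator obeying the Levi-Civita axioms. These constrain it on global smooth
  fields only, so all computations stay within such fields.\<close>

locale sr_geometry =
  fixes M :: "('a::{t2_space, second_countable_topology}, 'e::euclidean_space) sr_foliation"
    and n \<nu> :: nat
    and D :: "('a \<Rightarrow> 'e) \<Rightarrow> ('a \<Rightarrow> 'e) \<Rightarrow> ('a \<Rightarrow> 'e)"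
  assumes sub_riemannian: "sub_riemannian M n"
    and complement: "complement M \<nu>"
    and integrable: "integrable_complement M"
    and metric_preserving: "metric_preserving M"
    and vertical_metric: "metric_on (atlas M) (ver M) (vmet M)"
    and levi_civita: "levi_civita M D"
begin

sublocale manifold "atlas M"
  by unfold_locales (use sub_riemannian in \<open>simp add: sub_riemannian_def\<close>)

lemma subbundle_hor: "subbundle (atlas M) n (hor M)" and horizontal_metric: "metric_on (atlas M) (hor M) (hmet M)"
  using sub_riemannian by (simp_all add: sub_riemannian_def)

lemma subbundle_ver: "subbundle (atlas M) \<nu> (ver M)" and hor_int_ver: "hor M p \<inter> ver M p = {0}"
  using complement by (simp_all add: complement_def)

lemma inner_hor: "inner_on (hor M p) (hmet M p)"
  by (rule inner_on_metric[OF subbundle_hor horizontal_metric])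

lemma inner_ver: "inner_on (ver M p) (vmet M p)"
  by (rule inner_on_metric[OF subbundle_ver vertical_metric])

lemma subspace_hor [simp]: "subspace (hor M p)" and dim_hor: "dim (hor M p) = n"
  using subbundle_hor by (simp_all add: subbundle_def)

lemma subspace_ver [simp]: "subspace (ver M p)" and dim_ver: "dim (ver M p) = \<nu>"
  using subbundle_ver by (simp_all add: subbundle_def)

section \<open>The complementary projections and their smoothness\<close>

lemma prH_sum: "a \<in> hor M p \<Longrightarrow> b \<in> ver M p \<Longrightarrow> prH M p (a + b) = a"
  unfolding prH_def by (rule proj_eqI) (use hor_int_ver in auto)

lemma prV_sum: "a \<in> hor M p \<Longrightarrow> b \<in> ver M p \<Longrightarrow> prV M p (a + b) = b"
  unfolding prV_def by (rule proj_eqI) (use hor_int_ver in auto)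

lemma hor_ver_cases:
  obtains a b where "a \<in> hor M p" "b \<in> ver M p" "w = a + b"
  using complement unfolding complement_def by blast

lemma prH_in [simp]: "prH M p w \<in> hor M p"
  by (rule hor_ver_cases[of p w]) (simp add: prH_sum)

lemma prV_in [simp]: "prV M p w \<in> ver M p"
  by (rule hor_ver_cases[of p w]) (simp add: prV_sum)

lemma prH_add_prV: "prH M p w + prV M p w = w"
  by (rule hor_ver_cases[of p w]) (simp add: prV_sum prH_sum)

lemma prH_hor [simp]: "w \<in> hor M p \<Longrightarrow> prH M p w = w"
  using prH_sum[of w p 0] by (simp add: subspace_0)

lemma prV_hor [simp]: "w \<in> hor M p \<Longrightarrow> prV M p w = 0"
  using prV_sum[of w p 0] by (simp add: subspace_0)

lemma prH_ver [simp]: "w \<in> ver M p \<Longrightarrow> prH M p w = 0"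
  using prH_sum[of 0 p w] by (simp add: subspace_0)

lemma prV_ver [simp]: "w \<in> ver M p \<Longrightarrow> prV M p w = w"
  using prV_sum[of 0 p w] by (simp add: subspace_0)

lemma linear_prH: "linear (prH M p)"
proof (rule linearI)
  show "prH M p (u + w) = prH M p u + prH M p w" for u w
  proof -
    have "prH M p ((prH M p u + prH M p w) + (prV M p u + prV M p w)) = prH M p u + prH M p w"
      by (rule prH_sum) (auto intro: subspace_add)
    moreover have "(prH M p u + prH M p w) + (prV M p u + prV M p w) =
        (prH M p u + prV M p u) + (prH M p w + prV M p w)"
      by (simp add: algebra_simps)
    ultimately show ?thesis by (simp only: prH_add_prV)
  qed
  show "prH M p (r *\<^sub>R w) = r *\<^sub>R prH M p w" for r w
  proof -
    have "prH M p (r *\<^sub>R prH M p w + r *\<^sub>R prV M p w) = r *\<^sub>R prH M p w"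
      by (rule prH_sum) (auto intro: subspace_scale)
    then show ?thesis by (simp add: scaleR_add_right[symmetric] prH_add_prV)
  qed
qed

lemma prV_eq: "prV M p w = w - prH M p w"
  using prH_add_prV[of p w] by (simp add: algebra_simps)

lemma linear_prV: "linear (prV M p)"
  unfolding prV_eq[abs_def] by (intro linear_compose_sub linear_ident linear_prH)

lemma PH_in [simp]: "PH M X p \<in> hor M p" and PV_in [simp]: "PV M X p \<in> ver M p"
  by (simp_all add: PH_def PV_def)

lemma PH_add_PV: "PH M X p + PV M X p = X p"
  by (simp add: PH_def PV_def prH_add_prV)

lemma PH_hor: "(\<And>q. X q \<in> hor M q) \<Longrightarrow> PH M X = X" and PV_hor: "(\<And>q. X q \<in> hor M q) \<Longrightarrow> PV M X = (\<lambda>q. 0)"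
  by (auto simp: PH_def PV_def)

lemma PH_ver: "(\<And>q. X q \<in> ver M q) \<Longrightarrow> PH M X = (\<lambda>q. 0)" and PV_ver: "(\<And>q. X q \<in> ver M q) \<Longrightarrow> PV M X = X"
  by (auto simp: PH_def PV_def)

lemma PH_PH [simp]: "PH M (PH M X) = PH M X" and PV_PH [simp]: "PV M (PH M X) = (\<lambda>q. 0)"
  and PH_PV [simp]: "PH M (PV M X) = (\<lambda>q. 0)" and PV_PV [simp]: "PV M (PV M X) = PV M X"
  by (simp_all add: PH_hor PV_hor PH_ver PV_ver)

lemma PH_add: "PH M (\<lambda>q. X q + Y q) = (\<lambda>q. PH M X q + PH M Y q)"
  and PV_add: "PV M (\<lambda>q. X q + Y q) = (\<lambda>q. PV M X q + PV M Y q)"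
  by (auto simp: PH_def PV_def linear_add[OF linear_prH] linear_add[OF linear_prV])

lemma PH_scale: "PH M (\<lambda>q. f q *\<^sub>R X q) = (\<lambda>q. f q *\<^sub>R PH M X q)"
  and PV_scale: "PV M (\<lambda>q. f q *\<^sub>R X q) = (\<lambda>q. f q *\<^sub>R PV M X q)"
  by (auto simp: PH_def PV_def linear_scale[OF linear_prH] linear_scale[OF linear_prV])

text \<open>The inner product in which the coordinate fields are orthonormal; it is positive because
  the coordinate differentials separate vectors. \<open>gmet\<close> cannot serve here: it is built
  from the projections, whose smoothness is still to be shown.\<close>

lemma smooth_local_frame_metric:
  assumes C: "coord_frame x E U0" and "U \<subseteq> U0"
  shows "q \<in> U \<Longrightarrow> inner_on UNIV (\<lambda>u w. \<Sum>b\<in>Basis. differential (atlas M) (x b) q u * differential (atlas M) (x b) q w)"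
    and "open U \<Longrightarrow> smooth_vf_on (atlas M) U X \<Longrightarrow> smooth_vf_on (atlas M) U Y \<Longrightarrow>
      smooth_fun_on (atlas M) U (\<lambda>q. \<Sum>b\<in>Basis. differential (atlas M) (x b) q (X q) * differential (atlas M) (x b) q (Y q))"
proof -
  note x = coord_frameD(1)[OF C]
  show "inner_on UNIV (\<lambda>u w. \<Sum>b\<in>Basis. differential (atlas M) (x b) q u * differential (atlas M) (x b) q w)"
    if q: "q \<in> U"
    unfolding inner_on_def
  proof (intro conjI ballI impI allI)
    fix u :: 'e assume "u \<noteq> 0"
    have "\<exists>b\<in>Basis. differential (atlas M) (x b) q u \<noteq> 0"
    proof (rule ccontr)
      assume "\<not> ?thesis"
      then have "(\<Sum>b\<in>Basis. differential (atlas M) (x b) q u *\<^sub>R E b q) = 0" by simp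
      moreover have "(\<Sum>b\<in>Basis. differential (atlas M) (x b) q u *\<^sub>R E b q) = u"
        by (rule coord_frameD(4)[OF C]) (use q assms in auto)
      ultimately show False using \<open>u \<noteq> 0\<close> by metis
    qed
    then obtain b where b: "b \<in> Basis" "differential (atlas M) (x b) q u \<noteq> 0" by blast
    show "(\<Sum>b\<in>Basis. differential (atlas M) (x b) q u * differential (atlas M) (x b) q u) > 0"
      by (rule sum_pos2[OF finite_Basis b(1)]) (use b in \<open>auto simp: zero_less_mult_iff not_less_iff_gr_or_eq\<close>)
  qed (simp_all add: linear_add[OF linear_differential'[OF x]] linear_scale[OF linear_differential'[OF x]]
      algebra_simps sum.distrib sum_distrib_left)
  show "smooth_fun_on (atlas M) U (\<lambda>q. \<Sum>b\<in>Basis. differential (atlas M) (x b) q (X q) * differential (atlas M) (x b) q (Y q))"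
    if "open U" "smooth_vf_on (atlas M) U X" "smooth_vf_on (atlas M) U Y"
    unfolding along_def[symmetric]
    by (intro smooth_fun_on_sum smooth_fun_on_mult smooth_fun_on_along that smooth_fun_on_subset[OF x]) auto
qed

text \<open>With \<open>Q\<close> the orthogonal projection onto \<open>\<V>\<^sup>\<bottom>\<close> for an auxiliary inner product, \<open>\<langle>Q\<cdot>, Q\<cdot>\<rangle>\<close> is an inner product on
  \<open>\<H>\<close> whose kernel is \<open>\<V>\<close>; an orthonormal frame \<open>H\<^sub>i\<close> for it gives \<open>pr\<^sub>\<H> w = \<Sum>\<^sub>i \<langle>Q w, Q H\<^sub>i\<rangle> H\<^sub>i\<close>.\<close>

lemma vf_PH:
  assumes X: "vfield (atlas M) X"
  shows "vfield (atlas M) (PH M X)"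
proof (rule smooth_vf_on_local)
  fix p :: 'a
  obtain x E U0 where C: "coord_frame x E U0" and pU0: "p \<in> U0"
    using coordinate_frame[of p] by blast
  obtain U1 S where U1: "open U1" "p \<in> U1" and S: "\<And>i. i < n \<Longrightarrow> smooth_vf_on (atlas M) U1 (S i)"
    and Ssp: "\<And>q. q \<in> U1 \<Longrightarrow> hor M q = span ((\<lambda>i. S i q) ` {..<n})"
    and Sind: "\<And>i q. i < n \<Longrightarrow> q \<in> U1 \<Longrightarrow> S i q \<notin> span ((\<lambda>j. S j q) ` {..<i})"
    using subbundle_local_frame[OF subbundle_hor, of p] by blast
  obtain U2 T where U2: "open U2" "p \<in> U2" and T: "\<And>i. i < \<nu> \<Longrightarrow> smooth_vf_on (atlas M) U2 (T i)"
    and Tsp: "\<And>q. q \<in> U2 \<Longrightarrow> ver M q = span ((\<lambda>i. T i q) ` {..<\<nu>})"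
    and Tind: "\<And>i q. i < \<nu> \<Longrightarrow> q \<in> U2 \<Longrightarrow> T i q \<notin> span ((\<lambda>j. T j q) ` {..<i})"
    using subbundle_local_frame[OF subbundle_ver, of p] by blast
  define U where "U = U0 \<inter> U1 \<inter> U2"
  have U: "open U" "p \<in> U" "U \<subseteq> U0"
    using U1 U2 pU0 coord_frameD(3)[OF C] by (auto simp: U_def)
  have "U \<subseteq> U1" "U \<subseteq> U2" by (auto simp: U_def)
  have SU: "smooth_vf_on (atlas M) U (S i)" if "i < n" for i
    by (rule smooth_vf_on_subset[OF S[OF that]]) (auto simp: U_def)
  have TU: "smooth_vf_on (atlas M) U (T i)" if "i < \<nu>" for i
    by (rule smooth_vf_on_subset[OF T[OF that]]) (auto simp: U_def)
  define e where "e q u w = (\<Sum>b\<in>Basis. differential (atlas M) (x b) q u * differential (atlas M) (x b) q w)" for q u w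
  have e: "inner_on UNIV (e q)" if "q \<in> U" for q
    using smooth_local_frame_metric(1)[OF C U(3) that] by (simp only: e_def[abs_def])
  have e_smooth: "smooth_fun_on (atlas M) U (\<lambda>q. e q (X q) (Y q))"
    if "smooth_vf_on (atlas M) U X" "smooth_vf_on (atlas M) U Y" for X Y
    unfolding e_def by (rule smooth_local_frame_metric(2)[OF C U(3,1) that])
  have e_ver: "inner_on (ver M q) (e q)" if "q \<in> U" for q
    by (rule inner_on_mono[OF e[OF that]]) simp_all
  have "\<exists>W. (\<forall>i<\<nu>. smooth_vf_on (atlas M) U (W i)) \<and>
      (\<forall>q\<in>U. orthonormal \<nu> (ver M q) (e q) (\<lambda>i. W i q) \<and>
        span ((\<lambda>i. W i q) ` {..<\<nu>}) = span ((\<lambda>i. T i q) ` {..<\<nu>}))"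
    by (rule gram_schmidt[where s = e and B = "ver M", OF U(1) e_ver e_smooth])
      (use TU Tsp Tind \<open>U \<subseteq> U2\<close> in \<open>auto intro!: span_base simp: subset_eq\<close>)
  then obtain W where W: "\<forall>i<\<nu>. smooth_vf_on (atlas M) U (W i)"
    and Won: "\<forall>q\<in>U. orthonormal \<nu> (ver M q) (e q) (\<lambda>i. W i q)"
    by blast
  have WV: "W i q \<in> ver M q" if "i < \<nu>" "q \<in> U" for i q using Won that by (simp add: orthonormal_def)
  define Q where "Q q u = u - (\<Sum>j<\<nu>. e q u (W j q) *\<^sub>R W j q)" for q u
  have Q_add: "Q q (u + w) = Q q u + Q q w" if "q \<in> U" for q u w
    using inner_on_add[OF e[OF that]]
    by (simp add: Q_def scaleR_add_left sum.distrib)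
  have Q_scale: "Q q (a *\<^sub>R w) = a *\<^sub>R Q q w" if "q \<in> U" for q a w
    using inner_on_scale[OF e[OF that]]
    by (simp add: Q_def scaleR_diff_right scaleR_sum_right)
  have Q_ver: "Q q w = 0" if "q \<in> U" "w \<in> ver M q" for q w
    using orthonormal_expansion[OF e_ver[OF that(1)] _ dim_ver[symmetric] that(2)] Won that
    by (simp add: Q_def)
  have Q0: "u \<in> ver M q" if "q \<in> U" "Q q u = 0" for q u
  proof -
    have "u = (\<Sum>j<\<nu>. e q u (W j q) *\<^sub>R W j q)" using that(2) unfolding Q_def by (rule eq_iff_diff_eq_0[THEN iffD2])
    moreover have "(\<Sum>j<\<nu>. e q u (W j q) *\<^sub>R W j q) \<in> ver M q"
      by (intro subspace_sum subspace_scale subspace_ver) (use WV that in auto)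
    ultimately show ?thesis by (rule ssubst)
  qed
  have Q_smooth: "smooth_vf_on (atlas M) U (\<lambda>q. Q q (X q))" if "smooth_vf_on (atlas M) U X" for X
    unfolding Q_def
    by (intro smooth_vf_on_diff smooth_vf_on_sum smooth_vf_on_scale e_smooth U that) (use W in auto)
  define s where "s q u w = e q (Q q u) (Q q w)" for q u w
  have s: "inner_on (hor M q) (s q)" if q: "q \<in> U" for q
    unfolding inner_on_def
  proof (intro conjI ballI impI allI)
    fix u assume u: "u \<in> hor M q" "u \<noteq> 0"
    then have "Q q u \<noteq> 0" using Q0[OF q] hor_int_ver[of q] by blast
    then show "s q u u > 0" unfolding s_def using inner_on_pos[OF e[OF q]] by simp
  next
    fix u w show "s q u w = s q w u"
      unfolding s_def by (rule inner_on_commute[OF e[OF q]]) auto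
  qed (simp_all add: s_def Q_add[OF q] Q_scale[OF q] inner_on_add[OF e[OF q]] inner_on_scale[OF e[OF q]])
  have s_smooth: "smooth_fun_on (atlas M) U (\<lambda>q. s q (X q) (Y q))"
    if "smooth_vf_on (atlas M) U X" "smooth_vf_on (atlas M) U Y" for X Y
    unfolding s_def by (intro e_smooth Q_smooth that)
  have "\<exists>H. (\<forall>i<n. smooth_vf_on (atlas M) U (H i)) \<and>
      (\<forall>q\<in>U. orthonormal n (hor M q) (s q) (\<lambda>i. H i q) \<and>
        span ((\<lambda>i. H i q) ` {..<n}) = span ((\<lambda>i. S i q) ` {..<n}))"
    by (rule gram_schmidt[where s = s and B = "hor M", OF U(1) s s_smooth])
      (use SU Ssp Sind \<open>U \<subseteq> U1\<close> in \<open>auto intro!: span_base simp: subset_eq\<close>)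
  then obtain H where H: "\<forall>i<n. smooth_vf_on (atlas M) U (H i)"
    and Hon: "\<forall>q\<in>U. orthonormal n (hor M q) (s q) (\<lambda>i. H i q)"
    by blast
  have XU: "smooth_vf_on (atlas M) U X" using X by (rule smooth_vf_on_subset) simp
  have "smooth_vf_on (atlas M) U (\<lambda>q. \<Sum>i<n. s q (X q) (H i q) *\<^sub>R H i q)"
    by (intro smooth_vf_on_sum smooth_vf_on_scale s_smooth U XU) (use H in auto)
  moreover have "(\<Sum>i<n. s q (X q) (H i q) *\<^sub>R H i q) = PH M X q" if q: "q \<in> U" for q
  proof -
    have "Q q (X q) = Q q (prH M q (X q))"
      using Q_add[OF q, of "prH M q (X q)" "prV M q (X q)"] Q_ver[OF q, of "prV M q (X q)"]
      by (simp add: prH_add_prV)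
    then have "(\<Sum>i<n. s q (X q) (H i q) *\<^sub>R H i q) = (\<Sum>i<n. s q (prH M q (X q)) (H i q) *\<^sub>R H i q)"
      by (simp add: s_def)
    also have "\<dots> = prH M q (X q)"
      by (rule orthonormal_expansion[OF s[OF q] _ dim_hor[symmetric] prH_in]) (use Hon q in blast)
    finally show ?thesis by (simp add: PH_def)
  qed
  ultimately have "smooth_vf_on (atlas M) U (PH M X)"
    by (rule smooth_vf_on_cong[OF U(1), THEN iffD1, rotated])
  then show "\<exists>V. open V \<and> p \<in> V \<and> smooth_vf_on (atlas M) V (PH M X)" using U by blast
qed

lemma vf_PV:
  assumes "vfield (atlas M) X"
  shows "vfield (atlas M) (PV M X)"
proof -
  have "PV M X = (\<lambda>q. X q - PH M X q)" by (auto simp: PV_def PH_def prV_eq)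
  then show ?thesis using vf_diff[OF assms vf_PH[OF assms]] by simp
qed

text \<open>Gram-Schmidt is local. A bump factor makes the fields global and keeps them in B
  everywhere, while orthonormality survives only where the factor is 1.\<close>

lemma metric_frame:
  assumes B: "subbundle (atlas M) r B" and s: "metric_on (atlas M) B s"
  shows "\<exists>E U. open U \<and> p \<in> U \<and> (\<forall>i<r. vfield (atlas M) (E i) \<and> (\<forall>q. E i q \<in> B q)) \<and>
    (\<forall>q\<in>U. orthonormal r (B q) (s q) (\<lambda>i. E i q))"
proof -
  obtain U S where U: "open U" "p \<in> U" and S: "\<And>i. i < r \<Longrightarrow> smooth_vf_on (atlas M) U (S i)"
    and Ssp: "\<And>q. q \<in> U \<Longrightarrow> B q = span ((\<lambda>i. S i q) ` {..<r})"
    and Sind: "\<And>i q. i < r \<Longrightarrow> q \<in> U \<Longrightarrow> S i q \<notin> span ((\<lambda>j. S j q) ` {..<i})"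
    using subbundle_local_frame[OF B, of p] by blast
  have "\<exists>E. (\<forall>i<r. smooth_vf_on (atlas M) U (E i)) \<and>
      (\<forall>q\<in>U. orthonormal r (B q) (s q) (\<lambda>i. E i q) \<and>
        span ((\<lambda>i. E i q) ` {..<r}) = span ((\<lambda>i. S i q) ` {..<r}))"
    by (rule gram_schmidt[where s = s and B = B, OF U(1) inner_on_metric[OF B s] metric_on_smooth[OF s U(1)]])
      (use S Ssp Sind in \<open>auto intro: span_base\<close>)
  then obtain E where E: "\<forall>i<r. smooth_vf_on (atlas M) U (E i)"
    and on: "\<forall>q\<in>U. orthonormal r (B q) (s q) (\<lambda>i. E i q)"
    by blast
  obtain \<theta> K V where \<theta>: "smooth_fun (atlas M) \<theta>" "closed K" "K \<subseteq> U" "\<And>q. q \<notin> K \<Longrightarrow> \<theta> q = 0"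
    and V: "open V" "p \<in> V" "V \<subseteq> U" "\<And>q. q \<in> V \<Longrightarrow> \<theta> q = 1"
    using smooth_bump_fun[OF U] by metis
  have sub: "subspace (B q)" for q using B by (simp add: subbundle_def)
  have "\<theta> q *\<^sub>R E i q \<in> B q" if "i < r" for i q
  proof (cases "q \<in> U")
    case True
    then show ?thesis using on that by (auto simp: orthonormal_def intro: subspace_scale sub)
  next
    case False
    then have "\<theta> q = 0" using \<theta>(3,4) by blast
    then show ?thesis using sub[of q] by (simp add: subspace_0)
  qed
  moreover have "vfield (atlas M) (\<lambda>q. \<theta> q *\<^sub>R E i q)" if "i < r" for i
    by (rule smooth_vf_cutoff[OF U(1) _ \<theta>]) (use E that in blast)
  moreover have "orthonormal r (B q) (s q) (\<lambda>i. \<theta> q *\<^sub>R E i q)" if "q \<in> V" for q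
    using on V that by (simp add: subset_eq)
  ultimately show ?thesis
    using V by (intro exI[of _ "\<lambda>i q. \<theta> q *\<^sub>R E i q"] exI[of _ V]) simp
qed

lemma inner_gmet: "inner_on UNIV (gmet M p)"
  unfolding inner_on_def
proof (intro conjI ballI impI allI)
  fix u :: 'e assume "u \<noteq> 0"
  then have "prH M p u \<noteq> 0 \<or> prV M p u \<noteq> 0" using prH_add_prV[of p u] by force
  moreover have "hmet M p (prH M p u) (prH M p u) \<ge> 0" "vmet M p (prV M p u) (prV M p u) \<ge> 0"
    by (rule inner_on_nonneg[OF inner_hor prH_in] inner_on_nonneg[OF inner_ver prV_in])+
  ultimately show "gmet M p u u > 0"
    using inner_on_pos[OF inner_hor prH_in, of p u] inner_on_pos[OF inner_ver prV_in, of p u]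
    unfolding gmet_def prH_hmet_def prV_vmet_def by linarith
next
  fix u w :: 'e
  show "gmet M p u w = gmet M p w u"
    unfolding gmet_def prH_hmet_def prV_vmet_def
    by (rule arg_cong2[OF inner_on_commute[OF inner_hor prH_in prH_in] inner_on_commute[OF inner_ver prV_in prV_in]])
qed (simp_all add: gmet_def prH_hmet_def prV_vmet_def linear_add[OF linear_prH] linear_add[OF linear_prV]
    linear_scale[OF linear_prH] linear_scale[OF linear_prV] inner_on_add[OF inner_hor] inner_on_add[OF inner_ver]
    inner_on_scale[OF inner_hor] inner_on_scale[OF inner_ver] algebra_simps)

lemma gmet_hor: "u \<in> hor M p \<Longrightarrow> gmet M p u w = hmet M p u (prH M p w)"
  and gmet_ver: "u \<in> ver M p \<Longrightarrow> gmet M p u w = vmet M p u (prV M p w)"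
  by (simp_all add: gmet_def prH_hmet_def prV_vmet_def inner_on_zero[OF inner_hor] inner_on_zero[OF inner_ver])

lemma gmet_commute: "gmet M p u w = gmet M p w u"
  by (rule inner_on_commute[OF inner_gmet]) auto

lemma linear_gmet_left: "linear (\<lambda>u. gmet M p u w)"
  by (rule linearI) (simp_all add: inner_on_add[OF inner_gmet] inner_on_scale[OF inner_gmet])

lemma linear_gmet: "linear (gmet M p u)"
proof -
  have "gmet M p u = (\<lambda>w. gmet M p w u)" by (rule ext) (rule gmet_commute)
  then show ?thesis using linear_gmet_left[of p u] by (simp only:)
qed

end

lemma inner_on_diff:
  assumes "inner_on S s" "u \<in> S" "u' \<in> S" "w \<in> S"
  shows "s (u - u') w = s u w - s u' w"
  using inner_on_add[OF assms(1), of "u - u'" u' w] assms by (simp add: inner_on_subspace subspace_diff)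

lemma inner_on_add_right:
  assumes "inner_on S s" "u \<in> S" "v \<in> S" "w \<in> S"
  shows "s u (v + w) = s u v + s u w"
proof -
  have "v + w \<in> S" using assms by (simp add: inner_on_subspace subspace_add)
  then show ?thesis
    using inner_on_add[OF assms(1,3,4,2)] inner_on_commute[OF assms(1)] assms(2-4) by metis
qed

section \<open>The connection preserving the horizontal and vertical bundles\<close>

context manifold
begin

lemma bracket_zero_right: "vfield A X \<Longrightarrow> bracket A X (\<lambda>q. 0) p = 0"
  using bracket_scale_right[OF sf_const[of 0] _ vf_zero, of X p] by (simp add: along_const)

lemma bracket_zero_left: "vfield A X \<Longrightarrow> bracket A (\<lambda>q. 0) X p = 0"
  using bracket_antisym[OF vf_zero, of X p] by (simp add: bracket_zero_right)

lemma bracket_add_left: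
  assumes "vfield A X" "vfield A Y" "vfield A Z"
  shows "bracket A (\<lambda>q. X q + Y q) Z p = bracket A X Z p + bracket A Y Z p"
  using bracket_antisym[OF vf_add[OF assms(1,2)] assms(3), of p] bracket_antisym[OF assms(1,3), of p]
    bracket_antisym[OF assms(2,3), of p] bracket_add_right[OF assms(3,1,2), of p]
  by simp

lemma bracket_scale_left:
  assumes "smooth_fun A f" "vfield A X" "vfield A Y"
  shows "bracket A (\<lambda>q. f q *\<^sub>R X q) Y p = f p *\<^sub>R bracket A X Y p - along A Y f p *\<^sub>R X p"
  using bracket_antisym[OF vf_scale[OF assms(1,2)] assms(3), of p] bracket_antisym[OF assms(2,3), of p]
    bracket_scale_right[OF assms(1,3,2), of p]
  by simp

end

context sr_geometry
begin

abbreviation "SF \<equiv> smooth_fun (atlas M)"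
abbreviation "VF \<equiv> vfield (atlas M)"
abbreviation "dir \<equiv> along (atlas M)"
abbreviation "br \<equiv> bracket (atlas M)"
abbreviation "N \<equiv> ring_conn M D"
abbreviation "RF X Y \<equiv> (\<lambda>q. hcurv M q (X q) (Y q))"

lemmas levi_civita_rules = levi_civita[unfolded levi_civita_def Let_def]

lemma D_vf: "VF X \<Longrightarrow> VF Y \<Longrightarrow> VF (D X Y)"
  by (rule levi_civita_rules[THEN conjunct1, rule_format]) (intro conjI)

lemma D_add_left: "VF X \<Longrightarrow> VF X' \<Longrightarrow> VF Y \<Longrightarrow> D (\<lambda>p. X p + X' p) Y = (\<lambda>p. D X Y p + D X' Y p)"
  by (rule levi_civita_rules[THEN conjunct2, THEN conjunct1, rule_format]) (intro conjI)

lemma D_scale_left: "SF f \<Longrightarrow> VF X \<Longrightarrow> VF Y \<Longrightarrow> D (\<lambda>p. f p *\<^sub>R X p) Y = (\<lambda>p. f p *\<^sub>R D X Y p)"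
  by (rule levi_civita_rules[THEN conjunct2, THEN conjunct2, THEN conjunct1, rule_format]) (intro conjI)

lemma D_add_right: "VF X \<Longrightarrow> VF Y \<Longrightarrow> VF Y' \<Longrightarrow> D X (\<lambda>p. Y p + Y' p) = (\<lambda>p. D X Y p + D X Y' p)"
  by (rule levi_civita_rules[THEN conjunct2, THEN conjunct2, THEN conjunct2, THEN conjunct1, rule_format]) (intro conjI)

lemma D_scale_right: "SF f \<Longrightarrow> VF X \<Longrightarrow> VF Y \<Longrightarrow>
    D X (\<lambda>p. f p *\<^sub>R Y p) = (\<lambda>p. dir X f p *\<^sub>R Y p + f p *\<^sub>R D X Y p)"
  by (rule levi_civita_rules[THEN conjunct2, THEN conjunct2, THEN conjunct2, THEN conjunct2, THEN conjunct1, rule_format]) (intro conjI)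

lemma D_torsion: "VF X \<Longrightarrow> VF Y \<Longrightarrow> D X Y p - D Y X p = br X Y p"
  by (rule levi_civita_rules[THEN conjunct2, THEN conjunct2, THEN conjunct2, THEN conjunct2, THEN conjunct2, THEN conjunct1, rule_format]) (intro conjI)

lemma D_metric: "VF X \<Longrightarrow> VF Y \<Longrightarrow> VF Z \<Longrightarrow>
    dir X (\<lambda>q. gmet M q (Y q) (Z q)) p = gmet M p (D X Y p) (Z p) + gmet M p (Y p) (D X Z p)"
  by (rule levi_civita_rules[THEN conjunct2, THEN conjunct2, THEN conjunct2, THEN conjunct2, THEN conjunct2, THEN conjunct2, rule_format]) (intro conjI)

lemma D_zero_right: "VF X \<Longrightarrow> D X (\<lambda>p. 0) = (\<lambda>p. 0)"
  using D_scale_right[OF sf_const[of 0] _ vf_zero, of X] by (simp add: along_const)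

lemma N_eq: "N X Z = (\<lambda>p. PH M (D (PH M X) (PH M Z)) p + PV M (D (PV M X) (PV M Z)) p
    + PH M (br (PV M X) (PH M Z)) p + PV M (br (PH M X) (PV M Z)) p)"
  by (rule ext) (simp only: ring_conn_def PH_def[of M "D _ _"] PV_def[of M "D _ _"]
      PH_def[of M "br _ _"] PV_def[of M "br _ _"])

lemma N_vf: "VF X \<Longrightarrow> VF Z \<Longrightarrow> VF (N X Z)"
  unfolding N_eq by (intro vf_add vf_PH vf_PV D_vf vf_bracket)

lemmas pr_linear = linear_add[OF linear_prH] linear_add[OF linear_prV] linear_scale[OF linear_prH]
  linear_scale[OF linear_prV] linear_diff[OF linear_prH] linear_diff[OF linear_prV]
  linear_0[OF linear_prH] linear_0[OF linear_prV] linear_neg[OF linear_prH] linear_neg[OF linear_prV]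

lemma N_add_left:
  assumes "VF X" "VF X'" "VF Z"
  shows "N (\<lambda>q. X q + X' q) Z p = N X Z p + N X' Z p"
  using assms by (simp add: ring_conn_def PH_add PV_add D_add_left vf_PH vf_PV bracket_add_left pr_linear)

text \<open>The projections make the bracket terms tensorial in X: rescaling the vertical field
  inside a bracket adds a multiple of that field, which \<open>prH\<close> removes, and likewise
  with the two bundles exchanged.\<close>

lemma N_scale_left:
  assumes "SF f" "VF X" "VF Z"
  shows "N (\<lambda>q. f q *\<^sub>R X q) Z p = f p *\<^sub>R N X Z p"
  using assms by (simp add: ring_conn_def PH_scale PV_scale D_scale_left vf_PH vf_PV bracket_scale_left
      pr_linear scaleR_add_right)

lemma N_add_right:
  assumes "VF X" "VF Z" "VF Z'"
  shows "N X (\<lambda>q. Z q + Z' q) p = N X Z p + N X Z' p"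
  using assms by (simp add: ring_conn_def PH_add PV_add D_add_right vf_PH vf_PV bracket_add_right pr_linear)

text \<open>The Leibniz term splits into four, one for each summand of N: horizontal or vertical
  part of X, horizontal or vertical part of Z.\<close>

lemma N_scale_right:
  assumes "SF f" "VF X" "VF Z"
  shows "N X (\<lambda>q. f q *\<^sub>R Z q) p = dir X f p *\<^sub>R Z p + f p *\<^sub>R N X Z p"
proof -
  have X: "dir X f p = dir (PH M X) f p + dir (PV M X) f p"
    unfolding along_def PH_add_PV[of X p, symmetric] by (rule linear_add[OF linear_differential'[OF assms(1)]])
  have Z: "Z p = PH M Z p + PV M Z p" by (simp only: PH_add_PV)
  show ?thesis
    using assms unfolding X
    by (subst Z) (simp add: ring_conn_def PH_scale PV_scale D_scale_right vf_PH vf_PV bracket_scale_right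
      pr_linear scaleR_add_right scaleR_add_left)
qed


lemma N_diff_right:
  assumes "VF X" "VF Z" "VF Z'"
  shows "N X (\<lambda>q. Z q - Z' q) p = N X Z p - N X Z' p"
  using N_add_right[OF assms(1) vf_diff[OF assms(2,3)] assms(3), of p] by simp

lemma N_diff_left:
  assumes "VF X" "VF X'" "VF Z"
  shows "N (\<lambda>q. X q - X' q) Z p = N X Z p - N X' Z p"
  using N_add_left[OF vf_diff[OF assms(1,2)] assms(2,3), of p] by simp

lemma N_hor:
  assumes "VF X" "VF Z" "\<And>q. Z q \<in> hor M q"
  shows "N X Z p = prH M p (D (PH M X) Z p) + prH M p (br (PV M X) Z p)"
  using assms by (simp add: ring_conn_def PH_hor PV_hor D_zero_right vf_PV vf_PH bracket_zero_right pr_linear)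

lemma N_ver:
  assumes "VF X" "VF Z" "\<And>q. Z q \<in> ver M q"
  shows "N X Z p = prV M p (D (PV M X) Z p) + prV M p (br (PH M X) Z p)"
  using assms by (simp add: ring_conn_def PH_ver PV_ver D_zero_right vf_PV vf_PH bracket_zero_right pr_linear)

lemma N_in_hor: "VF X \<Longrightarrow> VF Z \<Longrightarrow> (\<And>q. Z q \<in> hor M q) \<Longrightarrow> N X Z p \<in> hor M p"
  by (simp add: N_hor subspace_add)

lemma N_in_ver: "VF X \<Longrightarrow> VF Z \<Longrightarrow> (\<And>q. Z q \<in> ver M q) \<Longrightarrow> N X Z p \<in> ver M p"
  by (simp add: N_ver subspace_add)


section \<open>Curvature of the horizontal bundle, torsion and metricity\<close>

lemma bracket_ver:
  assumes "VF X" "VF Y"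
  shows "br (PV M X) (PV M Y) p \<in> ver M p"
  using integrable assms by (simp add: integrable_complement_def section_of_def vf_PV)

text \<open>A factor pulled out of the bracket leaves a multiple of a horizontal field, which
  \<open>prV\<close> kills. So the form is tensorial and may be computed on any fields through the
  given vectors.\<close>

lemma hcurv_field:
  assumes "VF X" "VF Y"
  shows "hcurv M p (X p) (Y p) = prV M p (br (PH M X) (PH M Y) p)"
proof -
  let ?F = "\<lambda>X Y. prV M p (br (PH M X) (PH M Y) p)"
  have 1: "?F X Y = ?F X' Y" if "VF X" "VF X'" "VF Y" "X p = X' p" for X X' Y
    by (rule vf_tensorial[of "\<lambda>X. ?F X Y" p])
      (use that in \<open>simp_all add: PH_add PH_scale bracket_add_left bracket_scale_left vf_PH pr_linear\<close>)
  have 2: "?F X Y = ?F X Y'" if "VF X" "VF Y" "VF Y'" "Y p = Y' p" for X Y Y'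
    by (rule vf_tensorial[of "\<lambda>Y. ?F X Y" p])
      (use that in \<open>simp_all add: PH_add PH_scale bracket_add_right bracket_scale_right vf_PH pr_linear\<close>)
  have "hcurv M p (X p) (Y p) = ?F X (ext_vec (atlas M) p (Y p))"
    unfolding hcurv_def by (rule 1) (use assms in \<open>simp_all add: ext_vec\<close>)
  also have "\<dots> = ?F X Y" by (rule 2) (use assms in \<open>simp_all add: ext_vec\<close>)
  finally show ?thesis .
qed

lemma vf_hcurv: 
  assumes "VF X" "VF Y" 
  shows "VF (RF X Y)"
proof -
  have "RF X Y = PV M (br (PH M X) (PH M Y))"
    by (rule ext) (simp add: hcurv_field assms PV_def)
  then show ?thesis using assms by (simp add: vf_PH vf_PV vf_bracket)
qed

lemma hcurv_in_ver [simp]: "hcurv M p u w \<in> ver M p"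
  by (simp add: hcurv_def)

lemma hcurv_antisym: "hcurv M p u w = - hcurv M p w u"
  unfolding hcurv_def
  by (subst bracket_antisym) (simp_all add: vf_PH ext_vec pr_linear)

lemma linear_hcurv_left: "linear (\<lambda>u. hcurv M p u w)"
  unfolding hcurv_def
  by (rule vf_tensorial_linear[where \<Phi> = "\<lambda>X. prV M p (br (PH M X) (PH M (ext_vec (atlas M) p w)) p)"])
    (simp_all add: PH_add PH_scale bracket_add_left bracket_scale_left vf_PH pr_linear ext_vec)

lemma linear_hcurv: "linear (hcurv M p u)"
proof -
  have "hcurv M p u = (\<lambda>w. - hcurv M p w u)" by (rule ext) (rule hcurv_antisym)
  then show ?thesis using linear_compose_neg[OF linear_hcurv_left[of p u]] by (simp only:)
qed

lemma hcurv_ver_left: "u \<in> ver M p \<Longrightarrow> hcurv M p u w = 0"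
  using hcurv_field[OF vf_PV[OF ext_vec(1)[of p u]] ext_vec(1)[of p w], of p]
  by (simp add: ext_vec PV_def bracket_zero_left vf_PH pr_linear)

lemma hcurv_ver_right: "w \<in> ver M p \<Longrightarrow> hcurv M p u w = 0"
  using hcurv_antisym[of p u w] by (simp add: hcurv_ver_left)

text \<open>D is torsion-free, which accounts for the horizontal part of [H, H] and the vertical
  part of [V, V]; the mixed brackets are built into N. There remain the vertical part of [H, H],
  which is \<open>hcurv\<close>, and the horizontal part of [V, V], zero by integrability.\<close>

lemma N_torsion:
  assumes "VF X" "VF Y"
  shows "N X Y p - N Y X p = br X Y p - hcurv M p (X p) (Y p)"
proof -
  let ?b = "\<lambda>X Y. br X Y p"
  note vf = vf_PH[OF assms(1)] vf_PH[OF assms(2)] vf_PV[OF assms(1)] vf_PV[OF assms(2)]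
  have "br X Y p = br (\<lambda>q. PH M X q + PV M X q) (\<lambda>q. PH M Y q + PV M Y q) p"
    by (simp only: PH_add_PV)
  also have "\<dots> = ?b (PH M X) (PH M Y) + ?b (PH M X) (PV M Y) + ?b (PV M X) (PH M Y) + ?b (PV M X) (PV M Y)"
    using vf by (simp add: bracket_add_left bracket_add_right vf_add)
  finally have b: "br X Y p = \<dots>" .
  have "prH M p (?b (PV M X) (PV M Y)) = 0" using bracket_ver[OF assms] by simp
  moreover have "prH M p (D (PH M X) (PH M Y) p) - prH M p (D (PH M Y) (PH M X) p) = prH M p (?b (PH M X) (PH M Y))"
    using D_torsion[OF vf(1,2), of p] by (simp add: pr_linear(5)[symmetric])
  moreover have "prV M p (D (PV M X) (PV M Y) p) - prV M p (D (PV M Y) (PV M X) p) = prV M p (?b (PV M X) (PV M Y))"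
    using D_torsion[OF vf(3,4), of p] by (simp add: pr_linear(6)[symmetric])
  moreover have "?b (PV M Y) (PH M X) = - ?b (PH M X) (PV M Y)" "?b (PH M Y) (PV M X) = - ?b (PV M X) (PH M Y)"
    using vf by (auto intro: bracket_antisym)
  ultimately show ?thesis
    unfolding b hcurv_field[OF assms] ring_conn_def
    by (simp add: pr_linear algebra_simps prV_eq[of p "?b (PH M X) (PH M Y)"]
        prV_eq[of p "?b (PH M X) (PV M Y)"] prV_eq[of p "?b (PV M X) (PH M Y)"] prV_ver[OF bracket_ver[OF assms]])
qed

lemma sf_hmet:
  "VF Y \<Longrightarrow> VF Z \<Longrightarrow> (\<And>q. Y q \<in> hor M q) \<Longrightarrow> (\<And>q. Z q \<in> hor M q) \<Longrightarrow> SF (\<lambda>q. hmet M q (Y q) (Z q))"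
  by (rule metric_on_smooth[OF horizontal_metric open_UNIV]) auto

text \<open>Along horizontal directions this is the metric property of D. Along vertical ones N is a
  projected Lie bracket, and the claim is the metric-preserving condition.\<close>

lemma N_metric:
  assumes X: "VF X" and Y: "VF Y" "\<And>q. Y q \<in> hor M q" and Z: "VF Z" "\<And>q. Z q \<in> hor M q"
  shows "dir X (\<lambda>q. hmet M q (Y q) (Z q)) p = hmet M p (N X Y p) (Z p) + hmet M p (Y p) (N X Z p)"
proof -
  let ?F = "\<lambda>q. hmet M q (Y q) (Z q)"
  have F: "SF ?F" using Y Z by (simp add: sf_hmet)
  have "dir X ?F p = dir (PH M X) ?F p + dir (PV M X) ?F p"
    unfolding along_def PH_add_PV[of X p, symmetric] by (rule linear_add[OF linear_differential'[OF F]])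
  moreover have "dir (PH M X) ?F p = hmet M p (prH M p (D (PH M X) Y p)) (Z p) + hmet M p (Y p) (prH M p (D (PH M X) Z p))"
  proof -
    have "?F = (\<lambda>q. gmet M q (Y q) (Z q))" using Y Z by (simp add: gmet_hor)
    then have "dir (PH M X) ?F p = gmet M p (D (PH M X) Y p) (Z p) + gmet M p (Y p) (D (PH M X) Z p)"
      using D_metric[OF vf_PH[OF X] Y(1) Z(1), of p] by simp
    then show ?thesis
      using Y(2) Z(2) gmet_commute[of p "D (PH M X) Y p" "Z p"]
        inner_on_commute[OF inner_hor prH_in Z(2)[of p], of "D (PH M X) Y p"]
      by (simp add: gmet_hor)
  qed
  moreover have "dir (PV M X) ?F p = hmet M p (prH M p (br (PV M X) Y p)) (Z p) + hmet M p (Y p) (prH M p (br (PV M X) Z p))"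
  proof -
    have "?F = (\<lambda>q. prH_hmet M q (Y q) (Z q))" using Y Z by (simp add: prH_hmet_def)
    moreover have "lie_derivative (atlas M) (PV M X) (prH_hmet M) Y Z p = 0"
      using metric_preserving X Y Z by (simp add: metric_preserving_def section_of_def vf_PV)
    ultimately show ?thesis
      using Y Z by (simp add: lie_derivative_def prH_hmet_def)
  qed
  ultimately show ?thesis
    using Y Z X
    by (simp add: N_hor inner_on_add[OF inner_hor] inner_on_add_right[OF inner_hor])
qed

section \<open>Curvature\<close>

lemma ring_curv_antisym:
  assumes "VF X" "VF Y" "VF Z"
  shows "ring_curv M D X Y Z p = - ring_curv M D Y X Z p"
proof -
  have "br X Y = (\<lambda>q. - br Y X q)" using bracket_antisym[OF assms(1,2)] by auto
  then have "N (br X Y) Z p = - N (br Y X) Z p"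
    using N_scale_left[OF sf_const[of "-1"] vf_bracket[OF assms(2,1)] assms(3), of p] by simp
  then show ?thesis by (simp add: ring_curv_def)
qed

lemma ring_curv_add_left:
  assumes "VF X" "VF X'" "VF Y" "VF Z"
  shows "ring_curv M D (\<lambda>q. X q + X' q) Y Z p = ring_curv M D X Y Z p + ring_curv M D X' Y Z p"
proof -
  have 1: "N (\<lambda>q. X q + X' q) Z = (\<lambda>q. N X Z q + N X' Z q)" by (rule ext) (simp add: N_add_left assms)
  have 2: "br (\<lambda>q. X q + X' q) Y = (\<lambda>q. br X Y q + br X' Y q)" by (rule ext) (simp add: bracket_add_left assms)
  show ?thesis
    unfolding ring_curv_def 1 2
    using assms by (simp add: N_add_left N_add_right N_vf vf_bracket)
qed

lemma ring_curv_scale_left: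
  assumes "SF f" "VF X" "VF Y" "VF Z"
  shows "ring_curv M D (\<lambda>q. f q *\<^sub>R X q) Y Z p = f p *\<^sub>R ring_curv M D X Y Z p"
proof -
  have 1: "N (\<lambda>q. f q *\<^sub>R X q) Z = (\<lambda>q. f q *\<^sub>R N X Z q)" by (rule ext) (simp add: N_scale_left assms)
  have 2: "br (\<lambda>q. f q *\<^sub>R X q) Y = (\<lambda>q. f q *\<^sub>R br X Y q - dir Y f q *\<^sub>R X q)"
    by (rule ext) (simp add: bracket_scale_left assms)
  show ?thesis
    unfolding ring_curv_def 1 2
    using assms by (simp add: N_scale_left N_scale_right N_diff_left N_vf vf_bracket vf_scale sf_along scaleR_diff_right)
qed

lemma ring_curv_add_right:
  assumes "VF X" "VF Y" "VF Z" "VF Z'"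
  shows "ring_curv M D X Y (\<lambda>q. Z q + Z' q) p = ring_curv M D X Y Z p + ring_curv M D X Y Z' p"
proof -
  have 1: "N W (\<lambda>q. Z q + Z' q) = (\<lambda>q. N W Z q + N W Z' q)" if "VF W" for W
    by (rule ext) (simp add: N_add_right assms that)
  show ?thesis
    unfolding ring_curv_def 
    using assms by (simp add: 1 N_add_right N_vf vf_bracket)
qed

text \<open>Products of first derivatives are symmetric in X and Y and cancel; the second
  derivatives of f amount to its derivative along [X, Y] and cancel against the bracket
  term.\<close>

lemma ring_curv_scale_right:
  assumes "SF f" "VF X" "VF Y" "VF Z"
  shows "ring_curv M D X Y (\<lambda>q. f q *\<^sub>R Z q) p = f p *\<^sub>R ring_curv M D X Y Z p"
proof -
  have 1: "N W (\<lambda>q. f q *\<^sub>R Z q) = (\<lambda>q. dir W f q *\<^sub>R Z q + f q *\<^sub>R N W Z q)" if "VF W" for W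
    by (rule ext) (simp add: N_scale_right assms that)
  show ?thesis
    unfolding ring_curv_def 
    using assms
    by (simp add: 1 N_add_right N_scale_right N_vf vf_bracket vf_scale sf_along along_bracket
        scaleR_diff_right scaleR_diff_left scaleR_add_left)
qed

lemma ring_curv_cong:
  assumes "VF X" "VF X'" "VF Y" "VF Y'" "VF Z" "VF Z'" "X p = X' p" "Y p = Y' p" "Z p = Z' p"
  shows "ring_curv M D X Y Z p = ring_curv M D X' Y' Z' p"
proof -
  have 1: "ring_curv M D X Y Z p = ring_curv M D X' Y Z p" if "VF X" "VF X'" "VF Y" "VF Z" "X p = X' p" for X X' Y Z
    by (rule vf_tensorial[of "\<lambda>X. ring_curv M D X Y Z p" p])
      (use that in \<open>simp_all add: ring_curv_add_left ring_curv_scale_left\<close>)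
  have "ring_curv M D X Y Z p = ring_curv M D X' Y Z p" by (rule 1) (use assms in auto)
  also have "\<dots> = ring_curv M D X' Y' Z p"
    using 1[of Y Y' X' Z] assms ring_curv_antisym[of X' Y Z p] ring_curv_antisym[of X' Y' Z p] by simp
  also have "\<dots> = ring_curv M D X' Y' Z' p"
    by (rule vf_tensorial[of "\<lambda>Z. ring_curv M D X' Y' Z p" p])
      (use assms in \<open>simp_all add: ring_curv_add_right ring_curv_scale_right\<close>)
  finally show ?thesis .
qed

lemma ring_curv_in_hor:
  "VF X \<Longrightarrow> VF Y \<Longrightarrow> VF Z \<Longrightarrow> (\<And>q. Z q \<in> hor M q) \<Longrightarrow> ring_curv M D X Y Z p \<in> hor M p"
  unfolding ring_curv_def by (intro subspace_diff subspace_hor N_in_hor N_vf vf_bracket)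

lemma ring_curv_in_ver:
  "VF X \<Longrightarrow> VF Y \<Longrightarrow> VF Z \<Longrightarrow> (\<And>q. Z q \<in> ver M q) \<Longrightarrow> ring_curv M D X Y Z p \<in> ver M p"
  unfolding ring_curv_def by (intro subspace_diff subspace_ver N_in_ver N_vf vf_bracket)

text \<open>Apply [X, Y] = XY - YX to the function h(Z, W) and use metricity twice: products of
  first covariant derivatives are symmetric in X and Y and drop out.\<close>

lemma ring_curv_metric:
  assumes X: "VF X" and Y: "VF Y" and Z: "VF Z" "\<And>q. Z q \<in> hor M q" and W: "VF W" "\<And>q. W q \<in> hor M q"
  shows "hmet M p (ring_curv M D X Y Z p) (W p) = - hmet M p (ring_curv M D X Y W p) (Z p)"
proof -
  let ?h = "\<lambda>Z W q. hmet M q (Z q) (W q)"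
  note N = N_vf N_in_hor
  have m: "dir V (?h A B) = (\<lambda>q. ?h (N V A) B q + ?h A (N V B) q)"
    if "VF V" "VF A" "\<And>q. A q \<in> hor M q" "VF B" "\<And>q. B q \<in> hor M q" for V A B
    by (rule ext) (rule N_metric[OF that])
  have m2: "dir U (dir V (?h Z W)) p = ?h (N U (N V Z)) W p + ?h (N V Z) (N U W) p + ?h (N U Z) (N V W) p + ?h Z (N U (N V W)) p"
    if "VF U" "VF V" for U V
    using that Z W by (simp add: m along_add sf_hmet N)
  have 0: "?h (N (br X Y) Z) W p + ?h Z (N (br X Y) W) p = dir X (dir Y (?h Z W)) p - dir Y (dir X (?h Z W)) p"
    using along_bracket[OF sf_hmet[OF Z(1) W(1) Z(2) W(2)] X Y, of p]
    by (simp add: m vf_bracket X Y Z W)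
  have d: "hmet M p (ring_curv M D X Y Z p) (W p) = ?h (N X (N Y Z)) W p - ?h (N Y (N X Z)) W p - ?h (N (br X Y) Z) W p"
    if "VF Z" "\<And>q. Z q \<in> hor M q" "VF W" "\<And>q. W q \<in> hor M q" for Z W
    unfolding ring_curv_def using that X Y
    by (simp add: inner_on_diff[OF inner_hor] subspace_diff N vf_bracket)
  have c: "?h A B p = ?h B A p" if "\<And>q. A q \<in> hor M q" "\<And>q. B q \<in> hor M q" for A B
    by (rule inner_on_commute[OF inner_hor that])
  have cc: "?h (N X (N Y W)) Z p = ?h Z (N X (N Y W)) p" "?h (N Y (N X W)) Z p = ?h Z (N Y (N X W)) p"
    "?h (N (br X Y) W) Z p = ?h Z (N (br X Y) W) p"
    by (rule c; use X Y Z W in \<open>simp add: N vf_bracket\<close>)+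
  show ?thesis
    unfolding d[OF Z W] d[OF W Z] cc using 0 m2[OF X Y] m2[OF Y X] by linarith
qed

text \<open>Each difference of second derivatives is rewritten twice by the torsion formula; the
  double brackets then cancel by the Jacobi identity.\<close>

lemma first_bianchi:
  assumes X: "VF X" and Y: "VF Y" and Z: "VF Z"
  shows "ring_curv M D X Y Z p + ring_curv M D Y Z X p + ring_curv M D Z X Y p =
    - (N X (RF Y Z) p + N Y (RF Z X) p + N Z (RF X Y) p)
    - (hcurv M p (X p) (br Y Z p) + hcurv M p (Y p) (br Z X p) + hcurv M p (Z p) (br X Y p))"
proof -
  have *: "N U (N V W) p - N U (N W V) p - N (br V W) U p = br U (br V W) p - hcurv M p (U p) (br V W p) - N U (RF V W) p"
    if "VF U" "VF V" "VF W" for U V W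
  proof -
    have "(\<lambda>q. N V W q - N W V q) = (\<lambda>q. br V W q - RF V W q)" by (rule ext) (rule N_torsion[OF that(2,3)])
    then have "N U (N V W) p - N U (N W V) p = N U (br V W) p - N U (RF V W) p"
      using N_diff_right[OF that(1) N_vf[OF that(2,3)] N_vf[OF that(3,2)], of p]
        N_diff_right[OF that(1) vf_bracket[OF that(2,3)] vf_hcurv[OF that(2,3)], of p]
      by simp
    then show ?thesis using N_torsion[OF that(1) vf_bracket[OF that(2,3)], of p] by simp
  qed
  have "ring_curv M D X Y Z p + ring_curv M D Y Z X p + ring_curv M D Z X Y p =
    (N X (N Y Z) p - N X (N Z Y) p - N (br Y Z) X p) + (N Y (N Z X) p - N Y (N X Z) p - N (br Z X) Y p) +
    (N Z (N X Y) p - N Z (N Y X) p - N (br X Y) Z p)"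
    unfolding ring_curv_def by (simp add: algebra_simps)
  also have "\<dots> = (br X (br Y Z) p + br Y (br Z X) p + br Z (br X Y) p)
    - (N X (RF Y Z) p + N Y (RF Z X) p + N Z (RF X Y) p)
    - (hcurv M p (X p) (br Y Z p) + hcurv M p (Y p) (br Z X p) + hcurv M p (Z p) (br X Y p))"
    unfolding *[OF X Y Z] *[OF Y Z X] *[OF Z X Y] by (simp add: algebra_simps)
  finally show ?thesis by (simp add: bracket_jacobi[OF X Y Z])
qed

text \<open>By the first Bianchi identity, \<open>\<langle>R(X, U) Y, Z\<rangle>\<close> is symmetric in \<open>X, Y\<close>; it is also antisymmetric in
  \<open>Y, Z\<close>.\<close>

lemma ring_curv_hor_ver:
  assumes U: "VF U" "\<And>q. U q \<in> ver M q" and X: "VF X" "\<And>q. X q \<in> hor M q"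
    and Y: "VF Y" "\<And>q. Y q \<in> hor M q" and Z: "VF Z" "\<And>q. Z q \<in> hor M q"
  shows "hmet M p (ring_curv M D X U Y p) (Z p) = 0"
proof -
  have sym: "ring_curv M D X U Y p = ring_curv M D Y U X p"
    if X: "VF X" "\<And>q. X q \<in> hor M q" and Y: "VF Y" "\<And>q. Y q \<in> hor M q" for X Y
  proof -
    \<comment> \<open>With U vertical, the right side of the Bianchi identity is vertical, since N
      preserves vertical fields and \<open>hcurv\<close> has vertical values. R(Y, X) U is vertical
      too, so it drops out of the horizontal part.\<close>
    have "prH M p (ring_curv M D X U Y p + ring_curv M D U Y X p + ring_curv M D Y X U p) = 0"
      unfolding first_bianchi[OF X(1) U(1) Y(1)]
      by (rule prH_ver) (intro subspace_diff subspace_add subspace_neg subspace_ver N_in_ver hcurv_in_ver vf_hcurv X Y U)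
    then have "ring_curv M D X U Y p + ring_curv M D U Y X p = 0"
      using ring_curv_in_hor[OF X(1) U(1) Y(1,2), of p] ring_curv_in_hor[OF U(1) Y(1) X(1,2), of p]
        ring_curv_in_ver[OF Y(1) X(1) U(1,2), of p]
      by (simp add: pr_linear)
    then show ?thesis using ring_curv_antisym[OF U(1) Y(1) X(1), of p] by simp
  qed
  have anti: "hmet M p (ring_curv M D X U Y p) (Z p) = - hmet M p (ring_curv M D X U Z p) (Y p)"
    if "VF X" "VF Y" "\<And>q. Y q \<in> hor M q" "VF Z" "\<And>q. Z q \<in> hor M q" for X Y Z
    by (rule ring_curv_metric[OF that(1) U(1) that(2-)])
  \<comment> \<open>Six alternating exchanges, three symmetric and three antisymmetric, return the
    expression to itself with the opposite sign.\<close>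
  show ?thesis
    using sym[OF X Y] sym[OF X Z] sym[OF Y Z] anti[OF X(1) Y Z] anti[OF Z(1) X Y] anti[OF Y(1) Z X] by simp
qed

end

section \<open>Covariant derivatives of forms and bitensors\<close>

context sr_geometry
begin

abbreviation "df \<equiv> differential (atlas M)"
abbreviation "form1 \<equiv> one_form (atlas M)"
abbreviation "hess \<equiv> hess_fun M D"
abbreviation "Nf \<equiv> cov_form M D"
abbreviation "Nb \<equiv> cov_bitensor M D"

lemma hess_eq: "hess X Y f = (\<lambda>p. dir X (dir Y f) p - dir (N X Y) f p)"
  by (rule ext) (simp add: hess_fun_def)

lemma sf_hess: "VF X \<Longrightarrow> VF Y \<Longrightarrow> SF f \<Longrightarrow> SF (hess X Y f)"
  unfolding hess_eq by (intro sf_diff sf_along N_vf)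

lemma hess_add_left:
  assumes "VF X" "VF X'" "VF Y" "SF f"
  shows "hess (\<lambda>q. X q + X' q) Y f p = hess X Y f p + hess X' Y f p"
  unfolding hess_fun_def using assms
  by (simp add: along_vec_add sf_along) (simp add: along_def N_add_left linear_add[OF linear_differential'])

lemma hess_scale_left:
  assumes "SF h" "VF X" "VF Y" "SF f"
  shows "hess (\<lambda>q. h q *\<^sub>R X q) Y f p = h p * hess X Y f p"
  unfolding hess_fun_def using assms
  by (simp add: along_vec_scale sf_along)
    (simp add: along_def N_scale_left linear_scale[OF linear_differential'] right_diff_distrib)

lemma hess_add_right:
  assumes "VF X" "VF Y" "VF Y'" "SF f"
  shows "hess X (\<lambda>q. Y q + Y' q) f p = hess X Y f p + hess X Y' f p"
proof -
  have "dir (\<lambda>q. Y q + Y' q) f = (\<lambda>q. dir Y f q + dir Y' f q)"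
    by (rule ext) (simp add: along_vec_add assms)
  moreover have "dir (N X (\<lambda>q. Y q + Y' q)) f p = dir (N X Y) f p + dir (N X Y') f p"
    by (simp add: along_def N_add_right linear_add[OF linear_differential'] assms)
  ultimately show ?thesis
    unfolding hess_fun_def using assms by (simp add: along_add sf_along)
qed

lemma hess_scale_right:
  assumes "SF h" "VF X" "VF Y" "SF f"
  shows "hess X (\<lambda>q. h q *\<^sub>R Y q) f p = h p * hess X Y f p"
proof -
  have "dir (\<lambda>q. h q *\<^sub>R Y q) f = (\<lambda>q. h q * dir Y f q)"
    by (rule ext) (simp add: along_vec_scale assms)
  moreover have "dir (N X (\<lambda>q. h q *\<^sub>R Y q)) f p = dir X h p * dir Y f p + h p * dir (N X Y) f p"
    by (simp add: along_def N_scale_right linear_add[OF linear_differential'] linear_scale[OF linear_differential'] assms)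
  ultimately show ?thesis
    unfolding hess_fun_def using assms by (simp add: along_mult sf_along algebra_simps)
qed

lemma hess_cong:
  assumes "VF X" "VF X'" "VF Y" "VF Y'" "SF f" "X p = X' p" "Y p = Y' p"
  shows "hess X Y f p = hess X' Y' f p"
proof -
  have "hess X Y f p = hess X' Y f p"
    by (rule vf_tensorial[of "\<lambda>X. hess X Y f p" p]) (use assms in \<open>simp_all add: hess_add_left hess_scale_left\<close>)
  also have "\<dots> = hess X' Y' f p"
    by (rule vf_tensorial[of "\<lambda>Y. hess X' Y f p" p]) (use assms in \<open>simp_all add: hess_add_right hess_scale_right\<close>)
  finally show ?thesis .
qed

text \<open>The iterated derivatives of f differ by the bracket, the correction terms by the bracket
  minus \<open>hcurv\<close>.\<close>

lemma hess_commute: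
  assumes "VF X" "VF Y" "SF f"
  shows "hess X Y f p - hess Y X f p = df f p (hcurv M p (X p) (Y p))"
proof -
  have "hess X Y f p - hess Y X f p = df f p (br X Y p) - df f p (N X Y p - N Y X p)"
    unfolding differential_bracket[OF assms(3,1,2)] hess_fun_def linear_diff[OF linear_differential'[OF assms(3)]]
      along_def[of _ _ f p] by simp
  also have "\<dots> = df f p (hcurv M p (X p) (Y p))"
    unfolding N_torsion[OF assms(1,2)] linear_diff[OF linear_differential'[OF assms(3)]] by simp
  finally show ?thesis .
qed

lemma form_tensor_rules:
  assumes "form1 \<omega>" "VF X"
  shows "VF W \<Longrightarrow> VF W' \<Longrightarrow> dir X (\<lambda>q. \<omega> q (W q + W' q)) p - \<omega> p (N X (\<lambda>q. W q + W' q) p) =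
      (dir X (\<lambda>q. \<omega> q (W q)) p - \<omega> p (N X W p)) + (dir X (\<lambda>q. \<omega> q (W' q)) p - \<omega> p (N X W' p))"
    and "SF h \<Longrightarrow> VF W \<Longrightarrow> dir X (\<lambda>q. \<omega> q (h q *\<^sub>R W q)) p - \<omega> p (N X (\<lambda>q. h q *\<^sub>R W q) p) =
      h p *\<^sub>R (dir X (\<lambda>q. \<omega> q (W q)) p - \<omega> p (N X W p))"
  using assms
  by (simp_all add: N_add_right N_scale_right linear_add[OF one_form_linear] linear_scale[OF one_form_linear]
      along_add along_mult one_form_smooth algebra_simps)

text \<open>The derivative of a factor of W arises in both terms and cancels, so the expression is
  tensorial in W and the chosen extension may be replaced by any field.\<close>

lemma cov_form_field:
  assumes "form1 \<omega>" "VF X" "VF W"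
  shows "Nf X \<omega> p (W p) = dir X (\<lambda>q. \<omega> q (W q)) p - \<omega> p (N X W p)"
proof -
  have "dir X (\<lambda>q. \<omega> q (ext_vec (atlas M) p (W p) q)) p - \<omega> p (N X (ext_vec (atlas M) p (W p)) p) =
    dir X (\<lambda>q. \<omega> q (W q)) p - \<omega> p (N X W p)"
    by (rule vf_tensorial[of "\<lambda>W. dir X (\<lambda>q. \<omega> q (W q)) p - \<omega> p (N X W p)" p])
      (use assms form_tensor_rules in \<open>simp_all add: ext_vec\<close>)
  then show ?thesis by (simp add: cov_form_def Let_def)
qed

lemma one_form_cov:
  assumes "form1 \<omega>" "VF X"
  shows "form1 (Nf X \<omega>)"
  unfolding one_form_def
proof (intro conjI allI impI)
  show "linear (Nf X \<omega> p)" for p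
    unfolding cov_form_def Let_def
    by (rule vf_tensorial_linear[where \<Phi> = "\<lambda>W. dir X (\<lambda>q. \<omega> q (W q)) p - \<omega> p (N X W p)"])
      (use assms form_tensor_rules in simp_all)
  show "SF (\<lambda>p. Nf X \<omega> p (W p))" if "VF W" for W
    using assms that by (simp add: cov_form_field sf_diff sf_along one_form_smooth N_vf)
qed

lemma covector_eqI:
  assumes "\<And>W. VF W \<Longrightarrow> \<alpha> (W p) = \<beta> (W p)"
  shows "\<alpha> = \<beta>"
proof
  fix w show "\<alpha> w = \<beta> w" using assms[OF ext_vec(1), of p w] by (simp add: ext_vec)
qed

lemma cov_form_add:
  assumes "form1 \<omega>" "form1 \<eta>" "VF X"
  shows "Nf X (\<lambda>q w. \<omega> q w + \<eta> q w) p = (\<lambda>w. Nf X \<omega> p w + Nf X \<eta> p w)"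
  by (rule covector_eqI[where p = p])
    (use assms in \<open>simp add: cov_form_field one_form_add along_add one_form_smooth\<close>)

lemma cov_form_scale:
  assumes "SF h" "form1 \<omega>" "VF X"
  shows "Nf X (\<lambda>q w. h q * \<omega> q w) p = (\<lambda>w. dir X h p * \<omega> p w + h p * Nf X \<omega> p w)"
  by (rule covector_eqI[where p = p])
    (use assms in \<open>simp add: cov_form_field one_form_scale along_mult one_form_smooth algebra_simps\<close>)

lemma cov_form_add_left:
  assumes "form1 \<omega>" "VF X" "VF X'"
  shows "Nf (\<lambda>q. X q + X' q) \<omega> p = (\<lambda>w. Nf X \<omega> p w + Nf X' \<omega> p w)"
  by (rule covector_eqI[where p = p])
    (use assms in \<open>simp add: cov_form_field vf_add along_vec_add one_form_smooth N_add_left linear_add[OF one_form_linear]\<close>)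

lemma cov_form_scale_left:
  assumes "SF h" "form1 \<omega>" "VF X"
  shows "Nf (\<lambda>q. h q *\<^sub>R X q) \<omega> p = (\<lambda>w. h p * Nf X \<omega> p w)"
  by (rule covector_eqI[where p = p])
    (use assms in \<open>simp add: cov_form_field vf_scale along_vec_scale one_form_smooth N_scale_left
      linear_scale[OF one_form_linear] right_diff_distrib\<close>)

lemma cov_form_differential:
  assumes "SF f" "VF X" "VF Y"
  shows "Nf X (df f) p (Y p) = hess X Y f p"
  using cov_form_field[OF one_form_differential[OF assms(1)] assms(2,3), of p]
  by (simp add: hess_fun_def along_def[abs_def])

section \<open>Symmetric bitensors and their covariant derivatives\<close>

text \<open>Arguments are restricted to linear functionals because \<open>cometric\<close> rests on
  a definite description, which need not describe anything otherwise. Linearity in the second slot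
  follows from symmetry.\<close>

definition bitensor :: "('a \<Rightarrow> ('e \<Rightarrow> real) \<Rightarrow> ('e \<Rightarrow> real) \<Rightarrow> real) \<Rightarrow> bool" where
  "bitensor s \<longleftrightarrow>
     (\<forall>p \<alpha> \<beta>. linear \<alpha> \<and> linear \<beta> \<longrightarrow> s p \<alpha> \<beta> = s p \<beta> \<alpha>) \<and>
     (\<forall>p \<alpha> \<alpha>' \<beta>. linear \<alpha> \<and> linear \<alpha>' \<and> linear \<beta> \<longrightarrow> s p (\<lambda>w. \<alpha> w + \<alpha>' w) \<beta> = s p \<alpha> \<beta> + s p \<alpha>' \<beta>) \<and>
     (\<forall>p r \<alpha> \<beta>. linear \<alpha> \<and> linear \<beta> \<longrightarrow> s p (\<lambda>w. r * \<alpha> w) \<beta> = r * s p \<alpha> \<beta>) \<and>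
     (\<forall>\<omega> \<eta>. form1 \<omega> \<and> form1 \<eta> \<longrightarrow> SF (\<lambda>q. s q (\<omega> q) (\<eta> q)))"

lemma bitensor_commute: "bitensor s \<Longrightarrow> linear \<alpha> \<Longrightarrow> linear \<beta> \<Longrightarrow> s p \<alpha> \<beta> = s p \<beta> \<alpha>"
  unfolding bitensor_def by (elim conjE) (erule allE | erule mp | rule conjI | assumption)+

lemma bitensor_add:
  "bitensor s \<Longrightarrow> linear \<alpha> \<Longrightarrow> linear \<alpha>' \<Longrightarrow> linear \<beta> \<Longrightarrow>
    s p (\<lambda>w. \<alpha> w + \<alpha>' w) \<beta> = s p \<alpha> \<beta> + s p \<alpha>' \<beta>"
  unfolding bitensor_def by simp

lemma bitensor_scale:
  "bitensor s \<Longrightarrow> linear \<alpha> \<Longrightarrow> linear \<beta> \<Longrightarrow> s p (\<lambda>w. r * \<alpha> w) \<beta> = r * s p \<alpha> \<beta>"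
  unfolding bitensor_def by simp

lemma bitensor_smooth: "bitensor s \<Longrightarrow> form1 \<omega> \<Longrightarrow> form1 \<eta> \<Longrightarrow> SF (\<lambda>q. s q (\<omega> q) (\<eta> q))"
  unfolding bitensor_def by simp

lemma linear_scaled: "linear \<alpha> \<Longrightarrow> linear (\<lambda>w. r * \<alpha> w :: real)"
  using linear_compose_scale_right[of \<alpha> r] by simp

text \<open>Tensoriality is shown in the first slot; symmetry carries it to the second, whence the
  exchanges of arguments at the end.\<close>

lemma cov_bitensor_field:
  assumes s: "bitensor s" and X: "VF X" and forms: "form1 a" "form1 b"
  shows "Nb X s p (a p) (b p) =
    dir X (\<lambda>q. s q (a q) (b q)) p - s p (Nf X a p) (b p) - s p (a p) (Nf X b p)"
proof -
  define \<Phi> where "\<Phi> a b = dir X (\<lambda>q. s q (a q) (b q)) p - s p (Nf X a p) (b p) - s p (a p) (Nf X b p)" for a b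
  have comm: "\<Phi> a b = \<Phi> b a" if ab: "form1 a" "form1 b" for a b
  proof -
    have "(\<lambda>q. s q (a q) (b q)) = (\<lambda>q. s q (b q) (a q))"
      by (rule ext) (rule bitensor_commute[OF s one_form_linear[OF ab(1)] one_form_linear[OF ab(2)]])
    moreover have "s p (Nf X a p) (b p) = s p (b p) (Nf X a p)" "s p (a p) (Nf X b p) = s p (Nf X b p) (a p)"
      by (rule bitensor_commute[OF s]; intro one_form_linear one_form_cov ab X)+
    ultimately show ?thesis by (simp only: \<Phi>_def)
  qed
  have cong: "\<Phi> a b = \<Phi> a' b" if forms: "form1 a" "form1 a'" "form1 b" "a p = a' p" for a a' b
  proof (rule form_tensorial[of "\<lambda>a. \<Phi> a b" p])
    fix u v assume uv: "form1 u" "form1 v"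
    show "\<Phi> (\<lambda>q w. u q w + v q w) b = \<Phi> u b + \<Phi> v b"
      unfolding \<Phi>_def cov_form_add[OF uv X]
      using uv forms X
      by (simp add: bitensor_add[OF s] one_form_linear one_form_cov along_add bitensor_smooth[OF s])
  next
    fix h u assume hu: "SF h" "form1 u"
    show "\<Phi> (\<lambda>q w. h q * u q w) b = h p * \<Phi> u b"
      unfolding \<Phi>_def cov_form_scale[OF hu X]
      using hu forms X
      by (simp add: bitensor_add[OF s] bitensor_scale[OF s] linear_scaled one_form_linear one_form_cov along_mult
          bitensor_smooth[OF s]) (simp add: algebra_simps)
  qed (use that in auto)
  note la = one_form_linear[OF forms(1), of p] and lb = one_form_linear[OF forms(2), of p]
  let ?a = "ext_cov (atlas M) p (a p)" and ?b = "ext_cov (atlas M) p (b p)"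
  have "Nb X s p (a p) (b p) = \<Phi> ?a ?b"
    by (simp add: cov_bitensor_def Let_def \<Phi>_def ext_cov la lb)
  also have "\<dots> = \<Phi> a ?b" by (rule cong) (simp_all add: ext_cov la lb forms)
  also have "\<dots> = \<Phi> ?b a" by (rule comm) (simp_all add: ext_cov la lb forms)
  also have "\<dots> = \<Phi> b a" by (rule cong) (simp_all add: ext_cov la lb forms)
  also have "\<dots> = \<Phi> a b" by (rule comm) (simp_all add: forms)
  finally show ?thesis by (simp add: \<Phi>_def)
qed

lemma covector_cases:
  assumes "linear \<alpha>"
  obtains a where "form1 a" "a p = \<alpha>"
  using ext_cov[OF assms] that by blast

text \<open>Closure under covariant derivatives lets the field formula be iterated to second
  order.\<close>

lemma bitensor_cov:
  assumes s: "bitensor s" and X: "VF X"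
  shows "bitensor (Nb X s)"
  unfolding bitensor_def
proof (intro conjI allI impI; (elim conjE)?)
  note lin = one_form_linear one_form_cov[OF _ X]
  fix p and \<alpha> \<beta> :: "'e \<Rightarrow> real" assume ab: "linear \<alpha>" "linear \<beta>"
  then obtain a b where a: "form1 a" "a p = \<alpha>" and b: "form1 b" "b p = \<beta>"
    by (metis covector_cases)
  have "(\<lambda>q. s q (a q) (b q)) = (\<lambda>q. s q (b q) (a q))"
    by (rule ext) (rule bitensor_commute[OF s one_form_linear[OF a(1)] one_form_linear[OF b(1)]])
  moreover have "s p (Nf X a p) (b p) = s p (b p) (Nf X a p)" "s p (a p) (Nf X b p) = s p (Nf X b p) (a p)"
    by (rule bitensor_commute[OF s]; intro lin a b)+
  ultimately show "Nb X s p \<alpha> \<beta> = Nb X s p \<beta> \<alpha>"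
    unfolding a(2)[symmetric] b(2)[symmetric] cov_bitensor_field[OF s X a(1) b(1)] cov_bitensor_field[OF s X b(1) a(1)]
    by simp
  show "Nb X s p (\<lambda>w. r * \<alpha> w) \<beta> = r * Nb X s p \<alpha> \<beta>" for r
  proof -
    have "Nb X s p (\<lambda>w. r * \<alpha> w) \<beta> = Nb X s p ((\<lambda>q w. r * a q w) p) (b p)" by (simp add: a b)
    also have "\<dots> = r * Nb X s p (a p) (b p)"
      unfolding cov_bitensor_field[OF s X one_form_scale[OF sf_const a(1)] b(1)] cov_form_scale[OF sf_const a(1) X]
        cov_bitensor_field[OF s X a(1) b(1)]
      using a b ab by (simp add: bitensor_scale[OF s] lin along_const along_mult sf_const bitensor_smooth[OF s])
        (simp add: algebra_simps)
    finally show ?thesis by (simp add: a b)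
  qed
  show "Nb X s p (\<lambda>w. \<alpha> w + \<gamma> w) \<beta> = Nb X s p \<alpha> \<beta> + Nb X s p \<gamma> \<beta>" if "linear \<gamma>" for \<gamma>
  proof -
    obtain g where g: "form1 g" "g p = \<gamma>" using \<open>linear \<gamma>\<close> by (metis covector_cases)
    have "Nb X s p (\<lambda>w. \<alpha> w + \<gamma> w) \<beta> = Nb X s p ((\<lambda>q w. a q w + g q w) p) (b p)" by (simp add: a b g)
    also have "\<dots> = Nb X s p (a p) (b p) + Nb X s p (g p) (b p)"
      unfolding cov_bitensor_field[OF s X one_form_add[OF a(1) g(1)] b(1)] cov_form_add[OF a(1) g(1) X]
        cov_bitensor_field[OF s X a(1) b(1)] cov_bitensor_field[OF s X g(1) b(1)]
      using a(1) b(1) g(1) by (simp add: bitensor_add[OF s] lin along_add bitensor_smooth[OF s])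
    finally show ?thesis by (simp add: a b g)
  qed
next
  fix \<omega> \<eta> assume "form1 \<omega>" "form1 \<eta>"
  then show "SF (\<lambda>q. Nb X s q (\<omega> q) (\<eta> q))"
    by (simp add: cov_bitensor_field[OF s X] sf_diff sf_along bitensor_smooth[OF s] one_form_cov X)
qed

lemma cov_bitensor_add_left:
  assumes s: "bitensor s" and X: "VF X" "VF X'" and ab: "form1 a" "form1 b"
  shows "Nb (\<lambda>q. X q + X' q) s p (a p) (b p) = Nb X s p (a p) (b p) + Nb X' s p (a p) (b p)"
proof -
  have r: "s p (a p) (\<lambda>w. \<alpha> w + \<beta> w) = s p (a p) \<alpha> + s p (a p) \<beta>" if "linear \<alpha>" "linear \<beta>" for \<alpha> \<beta>
    using bitensor_commute[OF s one_form_linear[OF ab(1)]] bitensor_add[OF s that one_form_linear[OF ab(1)]] that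
      linear_compose_add[OF that] by simp
  show ?thesis
    unfolding cov_bitensor_field[OF s vf_add[OF X] ab] cov_bitensor_field[OF s X(1) ab] cov_bitensor_field[OF s X(2) ab]
      cov_form_add_left[OF ab(1) X] cov_form_add_left[OF ab(2) X]
    using ab X by (simp add: r bitensor_add[OF s] one_form_linear one_form_cov along_vec_add bitensor_smooth[OF s])
qed

lemma cov_bitensor_scale_left:
  assumes s: "bitensor s" and X: "SF h" "VF X" and ab: "form1 a" "form1 b"
  shows "Nb (\<lambda>q. h q *\<^sub>R X q) s p (a p) (b p) = h p * Nb X s p (a p) (b p)"
proof -
  have r: "s p (a p) (\<lambda>w. r * \<beta> w) = r * s p (a p) \<beta>" if "linear \<beta>" for r \<beta>
    using bitensor_commute[OF s one_form_linear[OF ab(1)]] bitensor_scale[OF s that one_form_linear[OF ab(1)]] that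
      linear_scaled[OF that] by simp
  show ?thesis
    unfolding cov_bitensor_field[OF s vf_scale[OF X] ab] cov_bitensor_field[OF s X(2) ab]
      cov_form_scale_left[OF X(1) ab(1) X(2)] cov_form_scale_left[OF X(1) ab(2) X(2)]
    using ab X by (simp add: r bitensor_scale[OF s] one_form_linear one_form_cov along_vec_scale bitensor_smooth[OF s]
        right_diff_distrib)
qed

lemma cov_bitensor_cong:
  assumes s: "bitensor s" and X: "VF X" "VF X'" "X p = X' p" and ab: "form1 a" "form1 b"
  shows "Nb X s p (a p) (b p) = Nb X' s p (a p) (b p)"
  by (rule vf_tensorial[of "\<lambda>X. Nb X s p (a p) (b p)" p])
    (use assms in \<open>simp_all add: cov_bitensor_add_left cov_bitensor_scale_left\<close>)

text \<open>These rules turn the trace in \<open>sub_laplacian_bitensor\<close> into a sum over a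
  frame. In the second slot the derivative of h arises in both terms and cancels.\<close>

lemma hess_bitensor_tensorial:
  fixes p :: 'a
  assumes s: "bitensor s" and ab: "form1 a" "form1 b"
  defines "\<Phi> \<equiv> \<lambda>X Z. hess_bitensor M D X Z s p (a p) (b p)"
  shows "VF X \<Longrightarrow> VF X' \<Longrightarrow> VF Z \<Longrightarrow> \<Phi> (\<lambda>q. X q + X' q) Z = \<Phi> X Z + \<Phi> X' Z"
    and "SF h \<Longrightarrow> VF X \<Longrightarrow> VF Z \<Longrightarrow> \<Phi> (\<lambda>q. h q *\<^sub>R X q) Z = h p *\<^sub>R \<Phi> X Z"
    and "VF X \<Longrightarrow> VF Z \<Longrightarrow> VF Z' \<Longrightarrow> \<Phi> X (\<lambda>q. Z q + Z' q) = \<Phi> X Z + \<Phi> X Z'"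
    and "SF h \<Longrightarrow> VF X \<Longrightarrow> VF Z \<Longrightarrow> \<Phi> X (\<lambda>q. h q *\<^sub>R Z q) = h p *\<^sub>R \<Phi> X Z"
proof -
  note Nb_add = cov_bitensor_add_left[OF s] and Nb_scale = cov_bitensor_scale_left[OF s]
  note bc = bitensor_cov[OF s]
  show "\<Phi> (\<lambda>q. X q + X' q) Z = \<Phi> X Z + \<Phi> X' Z" if v: "VF X" "VF X'" "VF Z"
  proof -
    have 1: "N (\<lambda>q. X q + X' q) Z = (\<lambda>q. N X Z q + N X' Z q)" by (rule ext) (rule N_add_left[OF v])
    show ?thesis
      unfolding \<Phi>_def hess_bitensor_def 1
      using v ab by (simp add: cov_bitensor_add_left[OF bc] Nb_add N_vf)
  qed
  show "\<Phi> (\<lambda>q. h q *\<^sub>R X q) Z = h p *\<^sub>R \<Phi> X Z" if v: "SF h" "VF X" "VF Z"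
  proof -
    have 1: "N (\<lambda>q. h q *\<^sub>R X q) Z = (\<lambda>q. h q *\<^sub>R N X Z q)" by (rule ext) (rule N_scale_left[OF v])
    show ?thesis
      unfolding \<Phi>_def hess_bitensor_def 1
      using v ab by (simp add: cov_bitensor_scale_left[OF bc] Nb_scale N_vf right_diff_distrib)
  qed
  show "\<Phi> X (\<lambda>q. Z q + Z' q) = \<Phi> X Z + \<Phi> X Z'" if v: "VF X" "VF Z" "VF Z'"
  proof -
    have 1: "N X (\<lambda>q. Z q + Z' q) = (\<lambda>q. N X Z q + N X Z' q)" by (rule ext) (rule N_add_right[OF v])
    have 2: "Nb (\<lambda>q. Z q + Z' q) s q (c q) (d q) = Nb Z s q (c q) (d q) + Nb Z' s q (c q) (d q)"
      if "form1 c" "form1 d" for c d q by (rule Nb_add[OF v(2,3) that])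
    show ?thesis
      unfolding \<Phi>_def hess_bitensor_def 1
        cov_bitensor_field[OF bc[OF vf_add[OF v(2,3)]] v(1) ab] cov_bitensor_field[OF bc[OF v(2)] v(1) ab]
        cov_bitensor_field[OF bc[OF v(3)] v(1) ab]
      using v ab by (simp add: 2 Nb_add N_vf one_form_cov along_add bitensor_smooth[OF bc])
  qed
  show "\<Phi> X (\<lambda>q. h q *\<^sub>R Z q) = h p *\<^sub>R \<Phi> X Z" if v: "SF h" "VF X" "VF Z"
  proof -
    have 1: "N X (\<lambda>q. h q *\<^sub>R Z q) = (\<lambda>q. dir X h q *\<^sub>R Z q + h q *\<^sub>R N X Z q)" by (rule ext) (rule N_scale_right[OF v])
    have 2: "Nb (\<lambda>q. h q *\<^sub>R Z q) s q (c q) (d q) = h q * Nb Z s q (c q) (d q)"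
      if "form1 c" "form1 d" for c d q by (rule Nb_scale[OF v(1,3) that])
    have 3: "Nb (\<lambda>q. dir X h q *\<^sub>R Z q + h q *\<^sub>R N X Z q) s p (a p) (b p) =
        dir X h p * Nb Z s p (a p) (b p) + h p * Nb (N X Z) s p (a p) (b p)"
      using Nb_add[OF vf_scale[OF sf_along[OF v(1,2)] v(3)] vf_scale[OF v(1) N_vf[OF v(2,3)]] ab]
        Nb_scale[OF sf_along[OF v(1,2)] v(3) ab] Nb_scale[OF v(1) N_vf[OF v(2,3)] ab] by simp
    show ?thesis
      unfolding \<Phi>_def hess_bitensor_def 1 3
        cov_bitensor_field[OF bc[OF vf_scale[OF v(1,3)]] v(2) ab] cov_bitensor_field[OF bc[OF v(3)] v(2) ab]
      using v ab
      by (simp add: 2 Nb_add Nb_scale N_vf vf_scale sf_along one_form_cov along_mult bitensor_smooth[OF bc])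
        (simp add: algebra_simps)
  qed
qed

section \<open>Third derivatives and the Bochner formula\<close>

text \<open>The third covariant derivative of f: the Hessian differentiated in the direction X and
  evaluated on Y and Z.\<close>

definition third :: "('a \<Rightarrow> 'e) \<Rightarrow> ('a \<Rightarrow> 'e) \<Rightarrow> ('a \<Rightarrow> 'e) \<Rightarrow> ('a \<Rightarrow> real) \<Rightarrow> 'a \<Rightarrow> real" where
  "third X Y Z f p = dir X (hess Y Z f) p - hess (N X Y) Z f p - hess Y (N X Z) f p"

lemma cov_cov_form_differential:
  assumes "SF f" "VF X" "VF Y" "VF Z"
  shows "Nf X (Nf Y (df f)) p (Z p) - Nf (N X Y) (df f) p (Z p) = third X Y Z f p"
proof -
  have "(\<lambda>q. Nf Y (df f) q (Z q)) = hess Y Z f" by (rule ext) (rule cov_form_differential[OF assms(1,3,4)])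
  then show ?thesis
    using cov_form_field[OF one_form_cov[OF one_form_differential[OF assms(1)] assms(3)] assms(2,4), of p]
    by (simp add: third_def cov_form_differential assms N_vf)
qed

text \<open>The Leibniz rule used twice. The factor 4 counts two slots for the differential and two
  orders in which one derivative falls on s and the other on the differential.\<close>

lemma bochner:
  assumes s: "bitensor s" and f: "SF f" and X: "VF X"
  shows "hess X X (\<lambda>q. s q (df f q) (df f q)) p =
    hess_bitensor M D X X s p (df f p) (df f p) + 4 * Nb X s p (Nf X (df f) p) (df f p)
    + 2 * s p (\<lambda>w. Nf X (Nf X (df f)) p w - Nf (N X X) (df f) p w) (df f p)
    + 2 * s p (Nf X (df f) p) (Nf X (df f) p)"
proof -
  let ?\<omega> = "df f"
  let ?G = "\<lambda>q. s q (?\<omega> q) (?\<omega> q)"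
  have w: "form1 ?\<omega>" by (rule one_form_differential[OF f])
  have Xw: "form1 (Nf X ?\<omega>)" by (rule one_form_cov[OF w X])
  have XX: "VF (N X X)" by (rule N_vf[OF X X])
  have c: "s q (a q) (b q) = s q (b q) (a q)" if "form1 a" "form1 b" for a b q
    by (rule bitensor_commute[OF s one_form_linear[OF that(1)] one_form_linear[OF that(2)]])
  have c': "Nb Y s q (a q) (b q) = Nb Y s q (b q) (a q)" if "VF Y" "form1 a" "form1 b" for Y a b q
    by (rule bitensor_commute[OF bitensor_cov[OF s that(1)] one_form_linear[OF that(2)] one_form_linear[OF that(3)]])
  have 1: "dir Y ?G = (\<lambda>q. Nb Y s q (?\<omega> q) (?\<omega> q) + 2 * s q (Nf Y ?\<omega> q) (?\<omega> q))" if "VF Y" for Y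
  proof
    fix q
    show "dir Y ?G q = Nb Y s q (?\<omega> q) (?\<omega> q) + 2 * s q (Nf Y ?\<omega> q) (?\<omega> q)"
      using cov_bitensor_field[OF s that w w, of q] c[OF w one_form_cov[OF w that], of q] by simp
  qed
  have 2: "dir X (\<lambda>q. Nb X s q (?\<omega> q) (?\<omega> q)) p = Nb X (Nb X s) p (?\<omega> p) (?\<omega> p) + 2 * Nb X s p (Nf X ?\<omega> p) (?\<omega> p)"
    using cov_bitensor_field[OF bitensor_cov[OF s X] X w w, of p] c'[OF X w Xw, of p] by simp
  have 3: "dir X (\<lambda>q. s q (Nf X ?\<omega> q) (?\<omega> q)) p = Nb X s p (Nf X ?\<omega> p) (?\<omega> p)
      + s p (Nf X (Nf X ?\<omega>) p) (?\<omega> p) + s p (Nf X ?\<omega> p) (Nf X ?\<omega> p)"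
    using cov_bitensor_field[OF s X Xw w, of p] by simp
  have 4: "dir X (dir X ?G) p = Nb X (Nb X s) p (?\<omega> p) (?\<omega> p) + 2 * Nb X s p (Nf X ?\<omega> p) (?\<omega> p)
      + 2 * (Nb X s p (Nf X ?\<omega> p) (?\<omega> p) + s p (Nf X (Nf X ?\<omega>) p) (?\<omega> p) + s p (Nf X ?\<omega> p) (Nf X ?\<omega> p))"
    unfolding 1[OF X]
    by (subst along_add) (simp_all add: 2 3 along_mult along_const sf_const sf_mult bitensor_smooth[OF s]
        bitensor_smooth[OF bitensor_cov[OF s X]] w Xw)
  have 5: "s p (\<lambda>w. Nf X (Nf X ?\<omega>) p w - Nf (N X X) ?\<omega> p w) (?\<omega> p) =
      s p (Nf X (Nf X ?\<omega>) p) (?\<omega> p) - s p (Nf (N X X) ?\<omega> p) (?\<omega> p)"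
  proof -
    have l: "linear (Nf X (Nf X ?\<omega>) p)" "linear (Nf (N X X) ?\<omega> p)" "linear (?\<omega> p)"
      by (intro one_form_linear one_form_cov w X XX)+
    have "s p (\<lambda>w. (Nf X (Nf X ?\<omega>) p w - Nf (N X X) ?\<omega> p w) + Nf (N X X) ?\<omega> p w) (?\<omega> p) =
      s p (\<lambda>w. Nf X (Nf X ?\<omega>) p w - Nf (N X X) ?\<omega> p w) (?\<omega> p) + s p (Nf (N X X) ?\<omega> p) (?\<omega> p)"
      by (rule bitensor_add[OF s linear_compose_sub[OF l(1,2)] l(2,3)])
    then show ?thesis by simp
  qed
  show ?thesis
    unfolding 5 hess_fun_def[of M D X X ?G] 4 1[OF XX] hess_bitensor_def by simp
qed

lemma cov_hcurv_field:
  assumes "VF Z" "VF X" "VF Y"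
  shows "cov_hcurv M D p (Z p) (X p) (Y p) =
    N Z (RF X Y) p - hcurv M p (N Z X p) (Y p) - hcurv M p (X p) (N Z Y p)"
proof -
  define \<Phi> where "\<Phi> Z X Y = N Z (RF X Y) p - hcurv M p (N Z X p) (Y p) - hcurv M p (X p) (N Z Y p)" for Z X Y
  note lin = linear_add[OF linear_hcurv] linear_add[OF linear_hcurv_left] linear_scale[OF linear_hcurv]
    linear_scale[OF linear_hcurv_left]
  have 1: "\<Phi> Z X Y = \<Phi> Z' X Y" if "VF Z" "VF Z'" "VF X" "VF Y" "Z p = Z' p" for Z Z' X Y
    by (rule vf_tensorial[of "\<lambda>Z. \<Phi> Z X Y" p])
      (use that in \<open>simp_all add: \<Phi>_def N_add_left N_scale_left vf_hcurv lin scaleR_diff_right\<close>)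
  have 2: "\<Phi> Z X Y = \<Phi> Z X' Y" if "VF Z" "VF X" "VF X'" "VF Y" "X p = X' p" for Z X X' Y
    by (rule vf_tensorial[of "\<lambda>X. \<Phi> Z X Y" p])
      (use that in \<open>simp_all add: \<Phi>_def N_add_right N_scale_right vf_hcurv lin scaleR_diff_right\<close>)
  have 3: "\<Phi> Z X Y = \<Phi> Z X Y'" if "VF Z" "VF X" "VF Y" "VF Y'" "Y p = Y' p" for Z X Y Y'
    by (rule vf_tensorial[of "\<lambda>Y. \<Phi> Z X Y" p])
      (use that in \<open>simp_all add: \<Phi>_def N_add_right N_scale_right vf_hcurv lin scaleR_diff_right\<close>)
  let ?e = "ext_vec (atlas M) p"
  have "cov_hcurv M D p (Z p) (X p) (Y p) = \<Phi> (?e (Z p)) (?e (X p)) (?e (Y p))"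
    by (simp add: cov_hcurv_def Let_def \<Phi>_def ext_vec)
  also have "\<dots> = \<Phi> Z (?e (X p)) (?e (Y p))" by (rule 1) (simp_all add: ext_vec assms)
  also have "\<dots> = \<Phi> Z X (?e (Y p))" by (rule 2) (simp_all add: ext_vec assms)
  also have "\<dots> = \<Phi> Z X Y" by (rule 3) (simp_all add: ext_vec assms)
  finally show ?thesis by (simp add: \<Phi>_def)
qed

text \<open>The commutation rule of the Hessian, differentiated: the derivative of df applied to
  R(Y, Z) splits into a Hessian term and a derivative of R.\<close>

lemma third_commute_right:
  assumes "SF f" "VF X" "VF Y" "VF Z"
  shows "third X Y Z f p - third X Z Y f p = hess X (RF Y Z) f p + df f p (cov_hcurv M D p (X p) (Y p) (Z p))"
proof -
  note v = N_vf[OF assms(2,3)] N_vf[OF assms(2,4)] vf_hcurv[OF assms(3,4)]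
  have "(\<lambda>q. hess Y Z f q - hess Z Y f q) = dir (RF Y Z) f"
    by (rule ext) (simp add: along_def hess_commute assms)
  then have 1: "dir X (hess Y Z f) p - dir X (hess Z Y f) p = dir X (dir (RF Y Z) f) p"
    using along_diff[OF sf_hess[OF assms(3,4,1)] sf_hess[OF assms(4,3,1)], of X p] by simp
  have 2: "hess (N X Y) Z f p - hess Z (N X Y) f p = df f p (hcurv M p (N X Y p) (Z p))"
    "hess Y (N X Z) f p - hess (N X Z) Y f p = df f p (hcurv M p (Y p) (N X Z p))"
    by (simp_all add: hess_commute v assms)
  have 3: "dir X (dir (RF Y Z) f) p = hess X (RF Y Z) f p + df f p (N X (RF Y Z) p)"
    by (simp add: hess_fun_def along_def[of _ "N X (RF Y Z)"])
  show ?thesis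
    unfolding third_def cov_hcurv_field[OF assms(2-4)] linear_diff[OF linear_differential'[OF assms(1)]]
    using 1 2 3 by linarith
qed

text \<open>The Ricci identity for the one-form df; the torsion of N adds the Hessian term.\<close>

lemma third_commute_left:
  assumes f: "SF f" and X: "VF X" and Y: "VF Y" and Z: "VF Z"
  shows "third X Z Y f p - third Z X Y f p = - df f p (ring_curv M D X Z Y p) + hess (RF X Z) Y f p"
proof -
  note v = N_vf[OF X Z] N_vf[OF Z X] N_vf[OF X Y] N_vf[OF Z Y] vf_hcurv[OF X Z] vf_bracket[OF X Z]
  have 1: "dir U (hess W Y f) p = dir U (dir W (dir Y f)) p - dir U (dir (N W Y) f) p" if "VF U" "VF W" for U W
    unfolding hess_eq[of W] using that f Y by (simp add: along_diff sf_along N_vf)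
  have 2: "hess U V f p = dir U (dir V f) p - df f p (N U V p)" for U V
    by (simp add: hess_fun_def along_def[of _ "N U V"])
  have 3: "hess (N X Z) Y f p - hess (N Z X) Y f p = hess (br X Z) Y f p - hess (RF X Z) Y f p"
  proof -
    have eq: "N X Z = (\<lambda>q. N Z X q + (br X Z q - RF X Z q))"
    proof
      fix q show "N X Z q = N Z X q + (br X Z q - RF X Z q)" using N_torsion[OF X Z, of q] by (simp add: algebra_simps)
    qed
    have "hess (N X Z) Y f p = hess (N Z X) Y f p + hess (\<lambda>q. br X Z q - RF X Z q) Y f p"
      by (subst eq) (rule hess_add_left[OF v(2) vf_diff[OF v(6,5)] Y f])
    moreover have "hess (br X Z) Y f p = hess (\<lambda>q. br X Z q - RF X Z q) Y f p + hess (RF X Z) Y f p"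
      using hess_add_left[OF vf_diff[OF v(6,5)] v(5) Y f, of p] by simp
    ultimately show ?thesis by simp
  qed
  have 4: "dir (br X Z) (dir Y f) p = dir X (dir Z (dir Y f)) p - dir Z (dir X (dir Y f)) p"
    by (rule along_bracket[OF sf_along[OF f Y] X Z])
  show ?thesis
    unfolding third_def 1[OF X Z] 1[OF Z X] ring_curv_def linear_diff[OF linear_differential'[OF f]]
    using 3 4 2[of X "N Z Y"] 2[of Z "N X Y"] 2[of "br X Z" Y] by linarith
qed

text \<open>Z moves from the last slot to the middle and then to the front. The two torsion terms
  coincide, giving the factor 2, because their difference is df of R(X, R(X, Z)) and R vanishes on
  vertical vectors.\<close>

lemma third_bochner:
  assumes f: "SF f" and X: "VF X" and Z: "VF Z"
  shows "third X X Z f p = third Z X X f p - df f p (ring_curv M D X Z X p) + 2 * hess X (RF X Z) f p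
    + df f p (cov_hcurv M D p (X p) (X p) (Z p))"
proof -
  have "hess X (RF X Z) f p - hess (RF X Z) X f p = 0"
    unfolding hess_commute[OF X vf_hcurv[OF X Z] f]
    by (simp add: hcurv_ver_right linear_0[OF linear_differential'[OF f]])
  then show ?thesis
    using third_commute_right[OF f X X Z, of p] third_commute_left[OF f X X Z, of p] by linarith
qed

end

section \<open>The inequality of completed squares\<close>

text \<open>Of the symmetric part only the diagonal is kept; Cauchy-Schwarz against the constant
  vector 1 then yields 1/n.\<close>

lemma sum_squares_symmetric_split:
  fixes H :: "nat \<Rightarrow> nat \<Rightarrow> real"
  assumes "n > 0"
  shows "(\<Sum>i<n. \<Sum>j<n. (H i j)\<^sup>2) \<ge> (\<Sum>i<n. H i i)\<^sup>2 / n + 1/4 * (\<Sum>i<n. \<Sum>j<n. (H i j - H j i)\<^sup>2)"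
proof -
  have "(\<Sum>i<n. \<Sum>j<n. (H i j)\<^sup>2) = 1/2 * ((\<Sum>i<n. \<Sum>j<n. (H i j)\<^sup>2) + (\<Sum>i<n. \<Sum>j<n. (H j i)\<^sup>2))"
    using sum.swap[of "\<lambda>i j. (H i j)\<^sup>2" "{..<n}" "{..<n}"] by simp
  also have "\<dots> = (\<Sum>i<n. \<Sum>j<n. ((H i j + H j i) / 2)\<^sup>2 + 1/4 * (H i j - H j i)\<^sup>2)"
    unfolding sum.distrib[symmetric] sum_distrib_left
    by (intro sum.cong refl) (simp add: power2_eq_square field_simps)
  finally have eq: "(\<Sum>i<n. \<Sum>j<n. (H i j)\<^sup>2) =
      (\<Sum>i<n. \<Sum>j<n. ((H i j + H j i) / 2)\<^sup>2) + 1/4 * (\<Sum>i<n. \<Sum>j<n. (H i j - H j i)\<^sup>2)"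
    by (simp add: sum.distrib sum_distrib_left)
  have "(H i i)\<^sup>2 \<le> (\<Sum>j<n. ((H i j + H j i) / 2)\<^sup>2)" if "i < n" for i
    using member_le_sum[of i "{..<n}" "\<lambda>j. ((H i j + H j i) / 2)\<^sup>2"] that by simp
  then have "(\<Sum>i<n. (H i i)\<^sup>2) \<le> (\<Sum>i<n. \<Sum>j<n. ((H i j + H j i) / 2)\<^sup>2)"
    by (intro sum_mono) simp
  moreover have "(\<Sum>i<n. H i i)\<^sup>2 \<le> (\<Sum>i<n. (H i i)\<^sup>2) * n"
    using Cauchy_Schwarz_ineq_sum[of "\<lambda>i. H i i" "\<lambda>i. 1" "{..<n}"] by simp
  then have "(\<Sum>i<n. H i i)\<^sup>2 / n \<le> (\<Sum>i<n. (H i i)\<^sup>2)"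
    using assms by (simp add: field_simps)
  ultimately show ?thesis using eq by linarith
qed

text \<open>The square is that of \<open>l * \<beta> i + (\<rho> i + l * q i)\<close>, summed and
  divided by l; in the remainder the product of \<rho> and q is bounded by Cauchy-Schwarz. The bound
  is uniform in \<beta>, so the mixed Hessian may stay uncontrolled.\<close>

lemma completed_square_sum:
  fixes \<rho> q \<beta> :: "'i \<Rightarrow> real"
  assumes l: "l > 0" and \<rho>: "(\<Sum>i\<in>I. (\<rho> i)\<^sup>2) \<le> x\<^sup>2" and q: "(\<Sum>i\<in>I. (q i)\<^sup>2) \<le> y\<^sup>2"
    and xy: "x \<ge> 0" "y \<ge> 0"
  shows "2 * (\<Sum>i\<in>I. \<rho> i * \<beta> i) + l * (2 * (\<Sum>i\<in>I. q i * \<beta> i) + (\<Sum>i\<in>I. (\<beta> i)\<^sup>2))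
    \<ge> - (x\<^sup>2 / l) - 2 * (x * y) - l * y\<^sup>2"
proof -
  have "(\<Sum>i\<in>I. \<rho> i * q i)\<^sup>2 \<le> (\<Sum>i\<in>I. (\<rho> i)\<^sup>2) * (\<Sum>i\<in>I. (q i)\<^sup>2)"
    by (rule Cauchy_Schwarz_ineq_sum)
  also have "\<dots> \<le> x\<^sup>2 * y\<^sup>2"
    by (rule mult_mono) (use \<rho> q in \<open>auto intro: sum_nonneg\<close>)
  finally have "(\<Sum>i\<in>I. \<rho> i * q i)\<^sup>2 \<le> (x * y)\<^sup>2" by (simp add: power_mult_distrib)
  then have cs: "(\<Sum>i\<in>I. \<rho> i * q i) \<le> x * y"
    by (rule power2_le_imp_le) (use xy in simp)
  have "0 \<le> (\<Sum>i\<in>I. (l * \<beta> i + (\<rho> i + l * q i))\<^sup>2)" by (rule sum_nonneg) simp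
  also have "\<dots> = (\<Sum>i\<in>I. l * (2 * (\<rho> i * \<beta> i)) + l * (l * (2 * (q i * \<beta> i) + (\<beta> i)\<^sup>2)) + ((\<rho> i)\<^sup>2 + l * (2 * (\<rho> i * q i)) + l * (l * (q i)\<^sup>2)))"
    by (rule sum.cong) (simp_all add: power2_eq_square algebra_simps)
  also have "\<dots> = l * (2 * (\<Sum>i\<in>I. \<rho> i * \<beta> i) + l * (2 * (\<Sum>i\<in>I. q i * \<beta> i) + (\<Sum>i\<in>I. (\<beta> i)\<^sup>2)))
      + ((\<Sum>i\<in>I. (\<rho> i)\<^sup>2) + l * (2 * (\<Sum>i\<in>I. \<rho> i * q i)) + l * (l * (\<Sum>i\<in>I. (q i)\<^sup>2)))"
    by (simp only: sum.distrib sum_distrib_left[symmetric] distrib_left)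
  also have "\<dots> \<le> l * (2 * (\<Sum>i\<in>I. \<rho> i * \<beta> i) + l * (2 * (\<Sum>i\<in>I. q i * \<beta> i) + (\<Sum>i\<in>I. (\<beta> i)\<^sup>2)))
      + (x\<^sup>2 + l * (2 * (x * y)) + l * (l * y\<^sup>2))"
    using \<rho> q cs l by (intro add_mono mult_left_mono) auto
  finally show ?thesis using l by (simp add: field_simps power2_eq_square)
qed

text \<open>The final estimate as a statement about numbers: x and y are the norms of the two
  gradients, H and \<beta> the horizontal and mixed Hessian, \<rho> the components of R against the
  horizontal gradient, q those of the derivative of \<open>vstar\<close> against df. Keeping
  \<open>ci\<close> and \<open>cm\<close> abstract, in place of 1/c and c (MHV + Mv)^2, confines the
  case c = \<infinity> to the hypothesis \<open>c\<close>.\<close>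

lemma curvature_dimension_algebra:
  fixes H \<beta> \<rho> q :: "nat \<Rightarrow> nat \<Rightarrow> real"
  assumes n: "n > 0" and l: "l > 0" and xy: "x \<ge> 0" "y \<ge> 0" and Mv: "Mv \<ge> 0"
    and \<rho>: "(\<Sum>i<n. \<Sum>k<\<nu>. (\<rho> i k)\<^sup>2) \<le> x\<^sup>2" and q: "(\<Sum>i<n. \<Sum>k<\<nu>. (q i k)\<^sup>2) \<le> (Mv * y)\<^sup>2"
    and mR: "(mR * y)\<^sup>2 \<le> 1/2 * (\<Sum>i<n. \<Sum>j<n. (H i j - H j i)\<^sup>2)"
    and Ric: "Ric \<ge> \<rho>H * x\<^sup>2" and RicHV: "RicHV \<ge> - 2 * MHV * y * x" and Lap: "Lap \<ge> \<rho>\<Delta> * y\<^sup>2"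
    and c: "2 * (MHV + Mv) * x * y \<le> ci * x\<^sup>2 + cm * y\<^sup>2"
  shows "(\<Sum>i<n. \<Sum>j<n. (H i j)\<^sup>2) + Ric + 2 * (\<Sum>i<n. \<Sum>k<\<nu>. \<rho> i k * \<beta> i k) + RicHV
    + l * (1/2 * Lap + 2 * (\<Sum>i<n. \<Sum>k<\<nu>. q i k * \<beta> i k) + (\<Sum>i<n. \<Sum>k<\<nu>. (\<beta> i k)\<^sup>2))
    \<ge> 1 / real n * (\<Sum>i<n. H i i)\<^sup>2 + (\<rho>H - ci - 1 / l) * x\<^sup>2 + (1/2 * mR\<^sup>2 - cm + (1/2 * \<rho>\<Delta> - Mv\<^sup>2) * l) * y\<^sup>2"
proof -
  have "2 * (\<Sum>i<n. \<Sum>k<\<nu>. \<rho> i k * \<beta> i k) + l * (2 * (\<Sum>i<n. \<Sum>k<\<nu>. q i k * \<beta> i k) + (\<Sum>i<n. \<Sum>k<\<nu>. (\<beta> i k)\<^sup>2))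
    \<ge> - (x\<^sup>2 / l) - 2 * (x * (Mv * y)) - l * (Mv * y)\<^sup>2"
    using completed_square_sum[OF l, of "case_prod \<rho>" "{..<n} \<times> {..<\<nu>}" x "case_prod q" "Mv * y" "case_prod \<beta>"] \<rho> q xy Mv
    by (simp add: sum.cartesian_product case_prod_unfold)
  moreover have "l * (1/2 * Lap) \<ge> l * (1/2 * (\<rho>\<Delta> * y\<^sup>2))"
    using Lap l by simp
  ultimately show ?thesis
    using sum_squares_symmetric_split[OF n, of H] mR Ric RicHV c
    by (simp add: field_simps power_mult_distrib)
qed

section \<open>Co-metrics in an orthonormal frame\<close>

text \<open>The vector dual to \<beta> is the sum of the \<beta>(b_i) b_i: the orthonormal expansion
  shows that it represents \<beta> and that no other vector does.\<close>

lemma cometric_orthonormal: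
  assumes s: "inner_on (B p) (s p)" and b: "orthonormal r (B p) (s p) b" and r: "r = dim (B p)"
    and lin: "linear \<alpha>" "linear \<beta>"
  shows "cometric B s p \<alpha> \<beta> = (\<Sum>i<r. \<alpha> (b i) * \<beta> (b i))"
proof -
  have bB: "b i \<in> B p" if "i < r" for i using b that by (simp add: orthonormal_def)
  note exp = orthonormal_expansion[OF s b r]
  let ?w = "\<Sum>i<r. \<beta> (b i) *\<^sub>R b i"
  have wB: "?w \<in> B p" using bB by (auto intro!: subspace_sum subspace_scale inner_on_subspace[OF s])
  have "cosharp B s p \<beta> = ?w"
    unfolding cosharp_def
  proof (rule the_equality, intro conjI ballI)
    show "?w \<in> B p" by fact
    fix u assume u: "u \<in> B p"
    have "\<beta> u = \<beta> (\<Sum>i<r. s p u (b i) *\<^sub>R b i)" by (simp only: exp[OF u])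
    also have "\<dots> = (\<Sum>i<r. \<beta> (b i) * s p (b i) u)"
      unfolding linear_sum[OF lin(2)]
      by (rule sum.cong) (use inner_on_commute[OF s u bB] in \<open>simp_all add: linear_scale[OF lin(2)]\<close>)
    also have "\<dots> = (\<Sum>i<r. s p (\<beta> (b i) *\<^sub>R b i) u)"
      by (rule sum.cong) (use u bB in \<open>simp_all add: inner_on_scale[OF s]\<close>)
    also have "\<dots> = s p ?w u"
      by (rule inner_on_sum[OF s, symmetric]) (use u bB in \<open>auto intro: subspace_scale inner_on_subspace[OF s]\<close>)
    also have "\<dots> = s p u ?w" by (rule inner_on_commute[OF s wB u])
    finally show "\<beta> u = s p u ?w" .
  next
    fix w assume w: "w \<in> B p \<and> (\<forall>u\<in>B p. \<beta> u = s p u w)"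
    then have "(\<Sum>i<r. s p w (b i) *\<^sub>R b i) = ?w"
      using inner_on_commute[OF s] bB by (intro sum.cong) auto
    then show "w = ?w" using exp[of w] w by simp
  qed
  then show ?thesis
    by (simp add: cometric_def linear_sum[OF lin(1)] linear_scale[OF lin(1)] mult.commute)
qed

context sr_geometry
begin

lemma bitensor_cometric:
  assumes B: "subbundle (atlas M) r B" and s: "metric_on (atlas M) B s"
  shows "bitensor (cometric B s)"
proof -
  have dim: "r = dim (B q)" for q using B by (simp add: subbundle_def)
  have frame: "\<exists>E U. open U \<and> p \<in> U \<and> (\<forall>i<r. VF (E i)) \<and>
      (\<forall>q\<in>U. \<forall>\<alpha> \<beta>. linear \<alpha> \<and> linear \<beta> \<longrightarrow> cometric B s q \<alpha> \<beta> = (\<Sum>i<r. \<alpha> (E i q) * \<beta> (E i q)))" for p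
  proof -
    obtain E U where U: "open U" "p \<in> U" and E: "\<forall>i<r. VF (E i) \<and> (\<forall>q. E i q \<in> B q)"
      and on: "\<forall>q\<in>U. orthonormal r (B q) (s q) (\<lambda>i. E i q)"
      using metric_frame[OF B s, of p] by blast
    have "cometric B s q \<alpha> \<beta> = (\<Sum>i<r. \<alpha> (E i q) * \<beta> (E i q))" if "q \<in> U" "linear \<alpha>" "linear \<beta>" for q \<alpha> \<beta>
      by (rule cometric_orthonormal[where b = "\<lambda>i. E i q"])
        (use inner_on_metric[OF B s] on dim that in auto)
    then show ?thesis
      using U E by (intro exI[of _ E] exI[of _ U]) simp
  qed
  show ?thesis
    unfolding bitensor_def
  proof (intro conjI allI impI; (elim conjE)?)
    fix p and \<alpha> \<beta> :: "'e \<Rightarrow> real" assume lin: "linear \<alpha>" "linear \<beta>"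
    obtain E U where pU: "p \<in> U"
      and eq: "\<forall>q\<in>U. \<forall>\<alpha> \<beta>. linear \<alpha> \<and> linear \<beta> \<longrightarrow> cometric B s q \<alpha> \<beta> = (\<Sum>i<r. \<alpha> (E i q) * \<beta> (E i q))"
      using frame[of p] by (elim exE conjE)
    have E: "cometric B s p \<alpha> \<beta> = (\<Sum>i<r. \<alpha> (E i p) * \<beta> (E i p))" if "linear \<alpha>" "linear \<beta>" for \<alpha> \<beta>
      using eq[rule_format, OF pU] that by simp
    show "cometric B s p \<alpha> \<beta> = cometric B s p \<beta> \<alpha>"
      using lin by (simp add: E mult.commute)
    show "cometric B s p (\<lambda>w. c * \<alpha> w) \<beta> = c * cometric B s p \<alpha> \<beta>" for c
      using lin by (simp add: E linear_scaled sum_distrib_left mult.assoc)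
    show "cometric B s p (\<lambda>w. \<alpha> w + \<gamma> w) \<beta> = cometric B s p \<alpha> \<beta> + cometric B s p \<gamma> \<beta>" if "linear \<gamma>" for \<gamma>
      using lin that by (simp add: E linear_compose_add sum.distrib distrib_right)
  next
    fix \<omega> \<eta> assume f: "form1 \<omega>" "form1 \<eta>"
    show "SF (\<lambda>q. cometric B s q (\<omega> q) (\<eta> q))"
    proof (rule smooth_fun_on_local)
      fix p :: 'a
      obtain E U where U: "open U" "p \<in> U" and E: "\<forall>i<r. VF (E i)"
        and eq: "\<forall>q\<in>U. \<forall>\<alpha> \<beta>. linear \<alpha> \<and> linear \<beta> \<longrightarrow> cometric B s q \<alpha> \<beta> = (\<Sum>i<r. \<alpha> (E i q) * \<beta> (E i q))"
        using frame[of p] by (elim exE conjE)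
      have "SF (\<lambda>q. \<Sum>i<r. \<omega> q (E i q) * \<eta> q (E i q))"
        using E f by (intro sf_sum sf_mult one_form_smooth) auto
      then have "smooth_fun_on (atlas M) U (\<lambda>q. \<Sum>i<r. \<omega> q (E i q) * \<eta> q (E i q))"
        by (rule smooth_fun_on_subset) simp
      then have "smooth_fun_on (atlas M) U (\<lambda>q. cometric B s q (\<omega> q) (\<eta> q))"
        by (rule smooth_fun_on_cong[OF U(1), THEN iffD1, rotated])
          (use eq f in \<open>simp add: one_form_linear\<close>)
      then show "\<exists>V. open V \<and> p \<in> V \<and> smooth_fun_on (atlas M) V (\<lambda>q. cometric B s q (\<omega> q) (\<eta> q))"
        using U by blast
    qed
  qed
qed

lemma bitensor_hstar: "bitensor (hstar M)"
  unfolding hstar_def by (rule bitensor_cometric[OF subbundle_hor horizontal_metric])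

lemma bitensor_vstar: "bitensor (vstar M)"
  unfolding vstar_def by (rule bitensor_cometric[OF subbundle_ver vertical_metric])

end

text \<open>The fields are global and lie in their bundles everywhere, but are orthonormal only on
  U. A neighbourhood is required, rather than p alone, because orthonormality is
  differentiated.\<close>

locale adapted_frame = sr_geometry M n \<nu> D
  for M :: "('a::{t2_space, second_countable_topology}, 'e::euclidean_space) sr_foliation" and n \<nu> D +
  fixes p :: 'a and U :: "'a set" and A V :: "nat \<Rightarrow> 'a \<Rightarrow> 'e"
  assumes U: "open U" "p \<in> U"
    and A: "\<And>i. i < n \<Longrightarrow> VF (A i)" "\<And>i q. i < n \<Longrightarrow> A i q \<in> hor M q"
    and onA: "\<And>q. q \<in> U \<Longrightarrow> orthonormal n (hor M q) (hmet M q) (\<lambda>i. A i q)"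
    and V: "\<And>i. i < \<nu> \<Longrightarrow> VF (V i)" "\<And>i q. i < \<nu> \<Longrightarrow> V i q \<in> ver M q"
    and onV: "\<And>q. q \<in> U \<Longrightarrow> orthonormal \<nu> (ver M q) (vmet M q) (\<lambda>i. V i q)"
begin

lemma hstar_frame: "q \<in> U \<Longrightarrow> linear \<alpha> \<Longrightarrow> linear \<beta> \<Longrightarrow> hstar M q \<alpha> \<beta> = (\<Sum>i<n. \<alpha> (A i q) * \<beta> (A i q))"
  unfolding hstar_def
  by (rule cometric_orthonormal[where b = "\<lambda>i. A i q"]) (simp_all add: inner_hor onA dim_hor)

lemma vstar_frame: "q \<in> U \<Longrightarrow> linear \<alpha> \<Longrightarrow> linear \<beta> \<Longrightarrow> vstar M q \<alpha> \<beta> = (\<Sum>i<\<nu>. \<alpha> (V i q) * \<beta> (V i q))"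
  unfolding vstar_def
  by (rule cometric_orthonormal[where b = "\<lambda>i. V i q"]) (simp_all add: inner_ver onV dim_ver)

lemma hor_expansion: "w \<in> hor M p \<Longrightarrow> (\<Sum>i<n. hmet M p w (A i p) *\<^sub>R A i p) = w"
  by (rule orthonormal_expansion[OF inner_hor onA[OF U(2)] dim_hor[symmetric]])

lemma ver_expansion: "w \<in> ver M p \<Longrightarrow> (\<Sum>i<\<nu>. vmet M p w (V i p) *\<^sub>R V i p) = w"
  by (rule orthonormal_expansion[OF inner_ver onV[OF U(2)] dim_ver[symmetric]])

text \<open>Near p the products of the frame fields are constant; metricity of N expands their zero
  derivative.\<close>

lemma connection_form_antisym:
  assumes "VF Z" "i < n" "j < n"
  shows "hmet M p (N Z (A i) p) (A j p) = - hmet M p (N Z (A j) p) (A i p)"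
proof -
  have "\<forall>\<^sub>F q in nhds p. hmet M q (A i q) (A j q) = (if i = j then 1 else 0)"
    using eventually_nhds_in_open[OF U]
    by (rule eventually_mono) (use onA assms in \<open>auto simp: orthonormal_def\<close>)
  then have "dir Z (\<lambda>q. hmet M q (A i q) (A j q)) p = dir Z (\<lambda>q. if i = j then 1 else 0) p"
    by (rule along_cong)
  then have "dir Z (\<lambda>q. hmet M q (A i q) (A j q)) p = 0"
    by (simp only: along_const)
  then have "hmet M p (N Z (A i) p) (A j p) + hmet M p (A i p) (N Z (A j) p) = 0"
    using N_metric[OF assms(1) A(1)[OF assms(2)] A(2)[OF assms(2)] A(1)[OF assms(3)] A(2)[OF assms(3)], of p] by simp
  moreover have "hmet M p (A i p) (N Z (A j) p) = hmet M p (N Z (A j) p) (A i p)"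
    using assms A by (intro inner_on_commute[OF inner_hor] N_in_hor) auto
  ultimately show ?thesis by simp
qed

text \<open>The connection form is antisymmetric, so the trace of a bilinear form over the frame is
  parallel.\<close>

lemma frame_trace_parallel:
  fixes T :: "'e \<Rightarrow> 'e \<Rightarrow> real"
  assumes Z: "VF Z" and T: "\<And>w. linear (\<lambda>u. T u w)" "\<And>u. linear (T u)"
  shows "(\<Sum>i<n. T (N Z (A i) p) (A i p) + T (A i p) (N Z (A i) p)) = 0"
proof -
  define \<omega> where "\<omega> i j = hmet M p (N Z (A i) p) (A j p)" for i j
  define S where "S i j = T (A j p) (A i p) + T (A i p) (A j p)" for i j
  have "T (N Z (A i) p) (A i p) + T (A i p) (N Z (A i) p) = (\<Sum>j<n. \<omega> i j * S i j)" if i: "i < n" for i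
  proof -
    have "N Z (A i) p \<in> hor M p" using i A Z by (intro N_in_hor) auto
    then have e: "N Z (A i) p = (\<Sum>j<n. \<omega> i j *\<^sub>R A j p)"
      unfolding \<omega>_def by (rule hor_expansion[symmetric])
    show ?thesis
      unfolding e linear_sum[OF T(1)] linear_sum[OF T(2)] linear_scale[OF T(1)] linear_scale[OF T(2)]
      by (simp add: S_def sum.distrib distrib_left)
  qed
  then have 1: "(\<Sum>i<n. T (N Z (A i) p) (A i p) + T (A i p) (N Z (A i) p)) = (\<Sum>i<n. \<Sum>j<n. \<omega> i j * S i j)"
    by (intro sum.cong) auto
  have "(\<Sum>i<n. \<Sum>j<n. \<omega> i j * S i j) = (\<Sum>i<n. \<Sum>j<n. \<omega> j i * S j i)" by (rule sum.swap)
  also have "\<dots> = (\<Sum>i<n. \<Sum>j<n. - (\<omega> i j * S i j))"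
  proof (intro sum.cong refl)
    fix i j assume "i \<in> {..<n}" "j \<in> {..<n}"
    then have "\<omega> j i = - \<omega> i j" unfolding \<omega>_def by (intro connection_form_antisym[OF Z]) auto
    moreover have "S j i = S i j" by (simp add: S_def)
    ultimately show "\<omega> j i * S j i = - (\<omega> i j * S i j)" by simp
  qed
  also have "\<dots> = - (\<Sum>i<n. \<Sum>j<n. \<omega> i j * S i j)" by (simp add: sum_negf)
  finally show ?thesis unfolding 1 by simp
qed

section \<open>Covariant derivatives of the two co-metrics\<close>

text \<open>Derivatives of the coefficients of a and b cancel; what remains is the trace of
  \<open>a \<otimes> b\<close> with one frame vector differentiated, zero by
  \<open>frame_trace_parallel\<close>. So \<open>hstar\<close> is parallel.\<close>

lemma cov_hstar_frame:
  assumes X: "VF X" and ab: "form1 a" "form1 b"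
  shows "Nb X (hstar M) p (a p) (b p) = 0"
proof -
  have "\<forall>\<^sub>F q in nhds p. hstar M q (a q) (b q) = (\<Sum>i<n. a q (A i q) * b q (A i q))"
    using eventually_nhds_in_open[OF U]
    by (rule eventually_mono) (use ab in \<open>simp add: hstar_frame one_form_linear\<close>)
  then have "dir X (\<lambda>q. hstar M q (a q) (b q)) p = dir X (\<lambda>q. \<Sum>i<n. a q (A i q) * b q (A i q)) p"
    by (rule along_cong)
  also have "\<dots> = (\<Sum>i<n. a p (A i p) * dir X (\<lambda>q. b q (A i q)) p + dir X (\<lambda>q. a q (A i q)) p * b p (A i p))"
    using ab A by (subst along_sum) (simp_all add: along_mult sf_mult one_form_smooth)
  finally have 1: "dir X (\<lambda>q. hstar M q (a q) (b q)) p = \<dots>" .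
  have 2: "hstar M p (Nf X a p) (b p) = (\<Sum>i<n. (dir X (\<lambda>q. a q (A i q)) p - a p (N X (A i) p)) * b p (A i p))"
    using ab A X by (simp add: hstar_frame[OF U(2)] one_form_linear one_form_cov cov_form_field)
  have 3: "hstar M p (a p) (Nf X b p) = (\<Sum>i<n. a p (A i p) * (dir X (\<lambda>q. b q (A i q)) p - b p (N X (A i) p)))"
    using ab A X by (simp add: hstar_frame[OF U(2)] one_form_linear one_form_cov cov_form_field)
  have "(\<Sum>i<n. a p (N X (A i) p) * b p (A i p) + a p (A i p) * b p (N X (A i) p)) = 0"
    by (rule frame_trace_parallel[OF X, of "\<lambda>u w. a p u * b p w"])
      (use one_form_linear[OF ab(1), of p] one_form_linear[OF ab(2), of p]
        in \<open>auto simp: linear_iff algebra_simps\<close>)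
  then show ?thesis
    unfolding cov_bitensor_field[OF bitensor_hstar X ab] 1 2 3 sum_subtractf[symmetric]
    by (subst sum.cong[OF refl, of _ _ "\<lambda>i. a p (N X (A i) p) * b p (A i p) + a p (A i p) * b p (N X (A i) p)"])
      (simp_all add: algebra_simps)
qed

end

context sr_geometry
begin

lemma adapted_frame_exists: "\<exists>U A V. adapted_frame M n \<nu> D p U A V"
proof -
  obtain A U1 where U1: "open U1" "p \<in> U1" and A: "\<forall>i<n. VF (A i) \<and> (\<forall>q. A i q \<in> hor M q)"
    and onA: "\<forall>q\<in>U1. orthonormal n (hor M q) (hmet M q) (\<lambda>i. A i q)"
    using metric_frame[OF subbundle_hor horizontal_metric, of p] by blast
  obtain V U2 where U2: "open U2" "p \<in> U2" and V: "\<forall>i<\<nu>. VF (V i) \<and> (\<forall>q. V i q \<in> ver M q)"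
    and onV: "\<forall>q\<in>U2. orthonormal \<nu> (ver M q) (vmet M q) (\<lambda>i. V i q)"
    using metric_frame[OF subbundle_ver vertical_metric, of p] by blast
  have "adapted_frame M n \<nu> D p (U1 \<inter> U2) A V"
    by unfold_locales (use U1 U2 A V onA onV in auto)
  then show ?thesis by blast
qed

lemma cov_hstar_zero:
  assumes "VF X" "form1 a" "form1 b"
  shows "Nb X (hstar M) p (a p) (b p) = 0"
  using adapted_frame_exists[of p] adapted_frame.cov_hstar_frame[OF _ assms] by blast

lemma hess_hstar_zero:
  assumes "VF X" "VF Z" "form1 a" "form1 b"
  shows "hess_bitensor M D X Z (hstar M) p (a p) (b p) = 0"
  using assms
  by (simp add: hess_bitensor_def cov_bitensor_field[OF bitensor_cov[OF bitensor_hstar]] cov_hstar_zero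
      along_const one_form_cov N_vf)

lemma one_form_prH:
  assumes "form1 a"
  shows "form1 (\<lambda>q w. a q (prH M q w))"
  using assms linear_compose[OF linear_prH one_form_linear[OF assms]] one_form_smooth[OF assms vf_PH]
  by (simp add: one_form_def o_def PH_def)

lemma vstar_annihilator:
  assumes "linear \<alpha>" "linear \<beta>" "\<And>w. w \<in> ver M p \<Longrightarrow> \<alpha> w = 0"
  shows "vstar M p \<alpha> \<beta> = 0"
proof -
  obtain U A V where "adapted_frame M n \<nu> D p U A V" using adapted_frame_exists by blast
  then interpret adapted_frame M n \<nu> D p U A V .
  show ?thesis using assms V U by (simp add: vstar_frame)
qed

text \<open>N preserves vertical fields, so its action on one-forms preserves the annihilator of the
  vertical bundle. \<alpha> is extended, through \<open>prH\<close>, by a form that annihilates this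
  bundle everywhere, and all three terms of the derivative vanish.\<close>

lemma cov_vstar_annihilator:
  assumes X: "VF X" and \<alpha>: "linear \<alpha>" and \<beta>: "linear \<beta>" and ann: "\<And>w. w \<in> ver M p \<Longrightarrow> \<alpha> w = 0"
  shows "Nb X (vstar M) p \<alpha> \<beta> = 0"
proof -
  obtain a where a: "form1 a" "a p = \<alpha>" by (rule covector_cases[OF \<alpha>])
  obtain b where b: "form1 b" "b p = \<beta>" by (rule covector_cases[OF \<beta>])
  let ?a = "\<lambda>q w. a q (prH M q w)"
  have a': "form1 ?a" by (rule one_form_prH[OF a(1)])
  have "?a p w = \<alpha> w" for w
  proof -
    have "\<alpha> w = \<alpha> (prH M p w + prV M p w)" by (simp only: prH_add_prV)
    also have "\<dots> = \<alpha> (prH M p w)" unfolding linear_add[OF \<alpha>] using ann by simp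
    finally show ?thesis by (simp add: a)
  qed
  then have ap: "?a p = \<alpha>" by (rule ext)
  have v0: "?a q w = 0" if "w \<in> ver M q" for q w
    using that linear_0[OF one_form_linear[OF a(1)]] by simp
  have s0: "(\<lambda>q. vstar M q (?a q) (b q)) = (\<lambda>q. 0)"
    using vstar_annihilator[OF one_form_linear[OF a'] one_form_linear[OF b(1)] v0] by simp
  have "Nf X ?a p w = 0" if w: "w \<in> ver M p" for w
  proof -
    let ?W = "PV M (ext_vec (atlas M) p w)"
    have W: "VF ?W" by (rule vf_PV[OF ext_vec(1)])
    have "?W p = w" using w by (simp add: PV_def ext_vec)
    then have "Nf X ?a p w = Nf X ?a p (?W p)" by simp
    also have "\<dots> = dir X (\<lambda>q. ?a q (?W q)) p - ?a p (N X ?W p)" by (rule cov_form_field[OF a' X W])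
    also have "\<dots> = 0"
    proof -
      have "?a p (N X ?W p) = 0" by (rule v0) (rule N_in_ver[OF X W PV_in])
      moreover have "(\<lambda>q. ?a q (?W q)) = (\<lambda>q. 0)" by (rule ext) (rule v0[OF PV_in])
      ultimately show ?thesis by (simp only: along_const)
    qed
    finally show ?thesis .
  qed
  then have "vstar M p (Nf X ?a p) (b p) = 0"
    by (rule vstar_annihilator[OF one_form_linear[OF one_form_cov[OF a' X]] one_form_linear[OF b(1)]])
  moreover have "vstar M p (?a p) (Nf X b p) = 0"
    by (rule vstar_annihilator[OF one_form_linear[OF a'] one_form_linear[OF one_form_cov[OF b(1) X]] v0])
  ultimately have "Nb X (vstar M) p (?a p) (b p) = 0"
    unfolding cov_bitensor_field[OF bitensor_vstar X a' b(1)] s0 by (simp add: along_const)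
  then show ?thesis by (simp only: ap b)
qed

end

section \<open>Traces and norms in an adapted frame\<close>

lemma sum_lessThan_add:
  fixes f :: "nat \<Rightarrow> real"
  shows "(\<Sum>k<m + r. f k) = (\<Sum>k<m. f k) + (\<Sum>j<r. f (m + j))"
  by (induction r) simp_all

text \<open>Invariance of the trace of \<open>F \<otimes> F\<close>. Applied one slot at a time, it
  replaces bases picked by choice by the frame.\<close>

lemma sum_squares_orthonormal:
  fixes F :: "'e::euclidean_space \<Rightarrow> real"
  assumes "inner_on S s" "r = dim S" "orthonormal r S s b" "orthonormal r S s e" "linear F"
  shows "(\<Sum>i<r. (F (b i))\<^sup>2) = (\<Sum>i<r. (F (e i))\<^sup>2)"
proof -
  have "linear (\<lambda>u. F u * F w)" "linear (\<lambda>w. F u * F w)" for u w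
    using assms(5) by (auto simp: linear_iff algebra_simps)
  from trace_orthonormal_unique[OF assms(1-4), of "\<lambda>u w. F u * F w", OF this] show ?thesis
    by (simp add: power2_eq_square)
qed

lemma parseval:
  assumes s: "inner_on S s" and b: "orthonormal r S s b" and r: "r = dim S" and w: "w \<in> S"
  shows "s w w = (\<Sum>i<r. (s w (b i))\<^sup>2)"
proof -
  have bS: "b i \<in> S" if "i < r" for i using b that by (simp add: orthonormal_def)
  have "s w w = s (\<Sum>i<r. s w (b i) *\<^sub>R b i) w" by (simp only: orthonormal_expansion[OF s b r w])
  also have "\<dots> = (\<Sum>i<r. s (s w (b i) *\<^sub>R b i) w)"
    by (rule inner_on_sum[OF s]) (use bS w in \<open>auto intro: subspace_scale inner_on_subspace[OF s]\<close>)
  also have "\<dots> = (\<Sum>i<r. (s w (b i))\<^sup>2)"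
  proof (rule sum.cong)
    fix i assume "i \<in> {..<r}"
    then show "s (s w (b i) *\<^sub>R b i) w = (s w (b i))\<^sup>2"
      using inner_on_scale[OF s, of "b i" w] inner_on_commute[OF s w, of "b i"] bS w by (simp add: power2_eq_square)
  qed simp
  finally show ?thesis .
qed

text \<open>Antisymmetry makes the full sum count each pair twice, with zero diagonal; hence the
  factor 1/2 between the wedge norm and a double sum.\<close>

lemma sum_upper_triangle:
  fixes \<eta> :: "nat \<Rightarrow> nat \<Rightarrow> real"
  assumes "\<And>i j. \<eta> i j = - \<eta> j i"
  shows "(\<Sum>j<n. \<Sum>i<j. (\<eta> i j)\<^sup>2) = 1/2 * (\<Sum>i<n. \<Sum>j<n. (\<eta> i j)\<^sup>2)"
proof (induction n)
  case (Suc n)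
  have "(\<eta> n j)\<^sup>2 = (\<eta> j n)\<^sup>2" for j using assms[of n j] by simp
  moreover have "\<eta> n n = 0" using assms[of n n] by simp
  ultimately show ?case using Suc by (simp add: sum.distrib)
qed simp

context sr_geometry
begin

lemma cov_hcurv_ext:
  "cov_hcurv M D p z u w = N (ext_vec (atlas M) p z) (RF (ext_vec (atlas M) p u) (ext_vec (atlas M) p w)) p
    - hcurv M p (N (ext_vec (atlas M) p z) (ext_vec (atlas M) p u) p) (ext_vec (atlas M) p w p)
    - hcurv M p (ext_vec (atlas M) p u p) (N (ext_vec (atlas M) p z) (ext_vec (atlas M) p w) p)"
  using cov_hcurv_field[OF ext_vec(1) ext_vec(1) ext_vec(1), of p p z p u p w] by (simp only: ext_vec(2))

lemma linear_cov_hcurv: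
  "linear (\<lambda>z. cov_hcurv M D p z u w)" "linear (\<lambda>u. cov_hcurv M D p z u w)" "linear (\<lambda>w. cov_hcurv M D p z u w)"
proof -
  note lin = linear_add[OF linear_hcurv] linear_add[OF linear_hcurv_left] linear_scale[OF linear_hcurv]
    linear_scale[OF linear_hcurv_left]
  let ?Z = "ext_vec (atlas M) p z" and ?X = "ext_vec (atlas M) p u" and ?Y = "ext_vec (atlas M) p w"
  show "linear (\<lambda>z. cov_hcurv M D p z u w)"
    unfolding cov_hcurv_ext
    by (rule vf_tensorial_linear[where \<Phi> = "\<lambda>Z. N Z (RF ?X ?Y) p - hcurv M p (N Z ?X p) (?Y p) - hcurv M p (?X p) (N Z ?Y p)"])
      (simp_all add: N_add_left N_scale_left vf_hcurv ext_vec lin scaleR_diff_right)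
  show "linear (\<lambda>u. cov_hcurv M D p z u w)"
    unfolding cov_hcurv_ext
    by (rule vf_tensorial_linear[where \<Phi> = "\<lambda>X. N ?Z (RF X ?Y) p - hcurv M p (N ?Z X p) (?Y p) - hcurv M p (X p) (N ?Z ?Y p)"])
      (simp_all add: N_add_right N_scale_right vf_hcurv ext_vec lin scaleR_diff_right)
  show "linear (\<lambda>w. cov_hcurv M D p z u w)"
    unfolding cov_hcurv_ext
    by (rule vf_tensorial_linear[where \<Phi> = "\<lambda>Y. N ?Z (RF ?X Y) p - hcurv M p (N ?Z ?X p) (Y p) - hcurv M p (?X p) (N ?Z Y p)"])
      (simp_all add: N_add_right N_scale_right vf_hcurv ext_vec lin scaleR_diff_right)
qed

lemma linear_hess:
  assumes "SF f"
  shows "linear (\<lambda>u. hess (ext_vec (atlas M) p u) (ext_vec (atlas M) p w) f p)"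
    "linear (\<lambda>w. hess (ext_vec (atlas M) p u) (ext_vec (atlas M) p w) f p)"
proof -
  show "linear (\<lambda>u. hess (ext_vec (atlas M) p u) (ext_vec (atlas M) p w) f p)"
    by (rule vf_tensorial_linear[where \<Phi> = "\<lambda>X. hess X (ext_vec (atlas M) p w) f p"])
      (use assms in \<open>simp_all add: hess_add_left hess_scale_left ext_vec\<close>)
  show "linear (\<lambda>w. hess (ext_vec (atlas M) p u) (ext_vec (atlas M) p w) f p)"
    by (rule vf_tensorial_linear[where \<Phi> = "\<lambda>Y. hess (ext_vec (atlas M) p u) Y f p"])
      (use assms in \<open>simp_all add: hess_add_right hess_scale_right ext_vec\<close>)
qed

lemma dim_sum: "DIM('e) = n + \<nu>"
proof -
  have "{x + y |x y. x \<in> hor M p \<and> y \<in> ver M p} = UNIV" for p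
    using complement unfolding complement_def by blast
  \<comment> \<open>\<open>undefined\<close> serves as an arbitrary point: the count takes place in
    a single fibre.\<close>
  then show ?thesis
    using dim_sums_Int[OF subspace_hor subspace_ver, of undefined undefined]
    by (simp add: dim_hor dim_ver hor_int_ver)
qed

text \<open>Serves to remove the vertical directions from the full trace in \<open>Ric_HV\<close>: R
  vanishes on vertical vectors and N keeps X vertical.\<close>

lemma cov_hcurv_ver_12:
  assumes "VF X" "VF Y" "\<And>q. X q \<in> ver M q"
  shows "cov_hcurv M D p (X p) (X p) (Y p) = 0"
proof -
  have "RF X Y = (\<lambda>q. 0 *\<^sub>R (0::'e))" by (rule ext) (simp add: hcurv_ver_left assms)
  then have "N X (RF X Y) p = 0"
    using N_scale_right[OF sf_const[of 0] assms(1) vf_zero, of p] by (simp add: along_const)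
  then show ?thesis
    using assms by (simp add: cov_hcurv_field hcurv_ver_left N_in_ver)
qed

lemma hcurv_field_ver_zero:
  assumes "VF X" "VF Y" "\<And>q. Y q \<in> ver M q"
  shows "RF X Y = (\<lambda>q. 0)"
  by (rule ext) (simp add: hcurv_ver_right assms)

lemma cov_hcurv_ver_3:
  assumes "VF Z" "VF X" "VF Y" "\<And>q. Y q \<in> ver M q"
  shows "cov_hcurv M D p (Z p) (X p) (Y p) = 0"
proof -
  have "N Z (\<lambda>q. 0) p = 0"
    using N_scale_right[OF sf_const[of 0] assms(1) vf_zero, of p] by (simp add: along_const)
  then show ?thesis
    using assms by (simp add: cov_hcurv_field hcurv_field_ver_zero hcurv_ver_right N_in_ver)
qed

lemma cov_hcurv_in_ver: "VF Z \<Longrightarrow> VF X \<Longrightarrow> VF Y \<Longrightarrow> cov_hcurv M D p (Z p) (X p) (Y p) \<in> ver M p"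
  by (simp add: cov_hcurv_field subspace_diff N_in_ver vf_hcurv)

end

context adapted_frame
begin

text \<open>Both frames at p in one numbering below n + \<nu>, so that together they form a single
  g-orthonormal basis.\<close>

definition frame_vec :: "nat \<Rightarrow> 'e" where
  "frame_vec k = (if k < n then A k p else V (k - n) p)"

lemma orthonormal_frame_vec: "orthonormal (n + \<nu>) UNIV (gmet M p) frame_vec"
  unfolding orthonormal_def
proof (intro conjI allI impI)
  fix i j assume ij: "i < n + \<nu>" "j < n + \<nu>"
  then have v: "i - n < \<nu>" if "\<not> i < n" using that by simp
  have w: "j - n < \<nu>" if "\<not> j < n" using that ij by simp
  show "gmet M p (frame_vec i) (frame_vec j) = (if i = j then 1 else 0)"
    using onA[OF U(2)] onV[OF U(2)] v w A V
    by (cases "i < n"; cases "j < n")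
      (auto simp: frame_vec_def gmet_hor gmet_ver orthonormal_def
        inner_on_zero[OF inner_hor] inner_on_commute[OF inner_hor _ subspace_0[OF subspace_hor]]
        inner_on_zero[OF inner_ver] inner_on_commute[OF inner_ver _ subspace_0[OF subspace_ver]])
qed simp

lemma sum_frame_vec: "(\<Sum>k<n + \<nu>. F (frame_vec k)) = (\<Sum>i<n. F (A i p)) + (\<Sum>j<\<nu>. F (V j p) :: real)"
  unfolding sum_lessThan_add by (simp add: frame_vec_def)

lemma trG_adapted:
  assumes "\<And>w. linear (\<lambda>u. T u w)" "\<And>u. linear (T u)"
  shows "trG M p T = (\<Sum>i<n. T (A i p) (A i p)) + (\<Sum>j<\<nu>. T (V j p) (V j p))"
proof -
  have "trG M p T = (\<Sum>k<n + \<nu>. T (frame_vec k) (frame_vec k))"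
    unfolding trG_def
    by (rule trace_on_eq[OF inner_gmet _ orthonormal_frame_vec assms]) (simp add: dim_sum)
  then show ?thesis using sum_frame_vec[of "\<lambda>e. T e e"] by simp
qed

lemma trH_adapted:
  assumes "q \<in> U" "\<And>w. linear (\<lambda>u. T u w)" "\<And>u. linear (T u)"
  shows "trH M q T = (\<Sum>i<n. T (A i q) (A i q))"
  unfolding trH_def
  by (rule trace_on_eq[OF inner_hor dim_hor[symmetric] onA[OF assms(1)] assms(2,3)])

text \<open>Vertical summands of the trace vanish and Parseval expands the rest. Nonnegativity is
  stated separately because \<open>sqrt\<close> of a negative number is negative; it follows from
  the sign of the trace.\<close>

lemma end_norm_hcurv:
  "(end_norm M p (hcurv M p w))\<^sup>2 = (\<Sum>i<n. \<Sum>k<\<nu>. (vmet M p (hcurv M p w (A i p)) (V k p))\<^sup>2)"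
  "end_norm M p (hcurv M p w) \<ge> 0"
proof -
  let ?T = "\<lambda>e e'. gmet M p (hcurv M p w e) (hcurv M p w e')"
  have lin: "linear (\<lambda>e. ?T e e')" "linear (?T e)" for e e'
    using linear_compose[OF linear_hcurv linear_gmet_left] linear_compose[OF linear_hcurv linear_gmet]
    by (simp_all add: o_def)
  have "trG M p ?T = (\<Sum>i<n. ?T (A i p) (A i p))"
    using trG_adapted[of ?T, OF lin] V by (simp add: hcurv_ver_right linear_0[OF linear_gmet])
  also have "\<dots> = (\<Sum>i<n. \<Sum>k<\<nu>. (vmet M p (hcurv M p w (A i p)) (V k p))\<^sup>2)"
    by (rule sum.cong) (simp_all add: gmet_ver parseval[OF inner_ver onV[OF U(2)] dim_ver[symmetric]])
  finally have eq: "trG M p ?T = \<dots>" .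
  then have "trG M p ?T \<ge> 0" by (simp add: sum_nonneg)
  then show "(end_norm M p (hcurv M p w))\<^sup>2 = (\<Sum>i<n. \<Sum>k<\<nu>. (vmet M p (hcurv M p w (A i p)) (V k p))\<^sup>2)"
    "end_norm M p (hcurv M p w) \<ge> 0"
    unfolding end_norm_def using eq by simp_all
qed

text \<open>The sum over i < j is not a trace, so it is first completed to the full double sum, in
  which the chosen basis is exchanged for the frame one slot at a time.\<close>

lemma wedge2_norm:
  assumes "linear \<alpha>"
  shows "(wedge2_hstar_norm M p (\<lambda>u w. \<alpha> (hcurv M p u w)))\<^sup>2 = 1/2 * (\<Sum>i<n. \<Sum>j<n. (\<alpha> (hcurv M p (A i p) (A j p)))\<^sup>2)"
proof -
  let ?b = "onb (hor M p) (hmet M p)"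
  have b: "orthonormal n (hor M p) (hmet M p) ?b"
    using onb_orthonormal[of "hor M p" "hmet M p" "\<lambda>i. A i p"] onA[OF U(2)] by (simp add: dim_hor)
  have lin: "linear (\<lambda>u. \<alpha> (hcurv M p u w))" "linear (\<lambda>w. \<alpha> (hcurv M p u w))" for u w
    using linear_compose[OF linear_hcurv_left assms] linear_compose[OF linear_hcurv assms] by (simp_all add: o_def)
  note sq = sum_squares_orthonormal[OF inner_hor dim_hor[symmetric] b onA[OF U(2)]]
  have anti: "\<alpha> (hcurv M p (?b i) (?b j)) = - \<alpha> (hcurv M p (?b j) (?b i))" for i j
    by (subst hcurv_antisym) (rule linear_neg[OF assms])
  have "(\<Sum>i<n. \<Sum>j<n. (\<alpha> (hcurv M p (?b i) (?b j)))\<^sup>2) = (\<Sum>i<n. \<Sum>j<n. (\<alpha> (hcurv M p (?b i) (A j p)))\<^sup>2)"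
    by (rule sum.cong[OF refl]) (rule sq[OF lin(2)])
  also have "\<dots> = (\<Sum>j<n. \<Sum>i<n. (\<alpha> (hcurv M p (?b i) (A j p)))\<^sup>2)" by (rule sum.swap)
  also have "\<dots> = (\<Sum>j<n. \<Sum>i<n. (\<alpha> (hcurv M p (A i p) (A j p)))\<^sup>2)"
    by (rule sum.cong[OF refl]) (rule sq[OF lin(1)])
  also have "\<dots> = (\<Sum>i<n. \<Sum>j<n. (\<alpha> (hcurv M p (A i p) (A j p)))\<^sup>2)" by (rule sum.swap)
  finally have eq: "(\<Sum>i<n. \<Sum>j<n. (\<alpha> (hcurv M p (?b i) (?b j)))\<^sup>2) = \<dots>" .
  have "(\<Sum>j<n. \<Sum>i<j. (\<alpha> (hcurv M p (?b i) (?b j)))\<^sup>2) = 1/2 * (\<Sum>i<n. \<Sum>j<n. (\<alpha> (hcurv M p (?b i) (?b j)))\<^sup>2)"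
    by (rule sum_upper_triangle[of "\<lambda>i j. \<alpha> (hcurv M p (?b i) (?b j))", OF anti])
  then show ?thesis
    unfolding wedge2_hstar_norm_def Let_def dim_hor eq[symmetric]
    by (simp add: sum_nonneg)
qed

text \<open>The full norm is moved from the chosen basis to the adapted one, slot by slot; of its
  squares only those with a horizontal direction and two vertical covectors are kept.\<close>

lemma cov_vstar_norm_bound:
  "(\<Sum>i<n. \<Sum>k<\<nu>. \<Sum>j<\<nu>. (Nb (A i) (vstar M) p (gmet M p (V k p)) (gmet M p (V j p)))\<^sup>2) \<le> (cov_vstar_norm M D p)\<^sup>2"
proof -
  define T where "T u v w = Nb (ext_vec (atlas M) p u) (vstar M) p (gmet M p v) (gmet M p w)" for u v w
  let ?E = "onb UNIV (gmet M p)" and ?F = frame_vec and ?d = "n + \<nu>"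
  have d: "?d = dim (UNIV :: 'e set)" by (simp add: dim_sum)
  have E: "orthonormal ?d UNIV (gmet M p) ?E"
    using onb_orthonormal[of UNIV "gmet M p" frame_vec] orthonormal_frame_vec d by simp
  note lg = linear_gmet[of p]
  have bv: "bitensor (Nb X (vstar M))" if "VF X" for X by (rule bitensor_cov[OF bitensor_vstar that])
  have g_add: "gmet M p (v + v') = (\<lambda>w. gmet M p v w + gmet M p v' w)"
    and g_scale: "gmet M p (r *\<^sub>R v) = (\<lambda>w. r * gmet M p v w)" for v v' r
    using linear_add[OF linear_gmet_left] linear_scale[OF linear_gmet_left] by auto
  have l1: "linear (\<lambda>u. T u v w)" for v w
  proof -
    obtain a where a: "form1 a" "a p = gmet M p v" by (rule covector_cases[OF lg])
    obtain b where b: "form1 b" "b p = gmet M p w" by (rule covector_cases[OF lg])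
    have "linear (\<lambda>u. Nb (ext_vec (atlas M) p u) (vstar M) p (a p) (b p))"
      by (rule vf_tensorial_linear[where \<Phi> = "\<lambda>X. Nb X (vstar M) p (a p) (b p)"])
        (simp_all add: cov_bitensor_add_left[OF bitensor_vstar] cov_bitensor_scale_left[OF bitensor_vstar] a(1) b(1))
    then show ?thesis by (simp add: T_def a b)
  qed
  have l2: "linear (\<lambda>v. T u v w)" for u w
    by (rule linearI) (simp_all add: T_def g_add g_scale bitensor_add[OF bv] bitensor_scale[OF bv] ext_vec lg)
  have l3: "linear (\<lambda>w. T u v w)" for u v
  proof -
    have "T u v w = T u w v" for w unfolding T_def by (rule bitensor_commute[OF bv]) (simp_all add: ext_vec lg)
    then show ?thesis using l2[of u v] by simp
  qed
  note sq = sum_squares_orthonormal[OF inner_gmet d E orthonormal_frame_vec]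
  have "(\<Sum>i<?d. \<Sum>j<?d. \<Sum>k<?d. (T (?E i) (?E j) (?E k))\<^sup>2) = (\<Sum>i<?d. \<Sum>j<?d. \<Sum>k<?d. (T (?E i) (?E j) (?F k))\<^sup>2)"
    by (rule sum.cong[OF refl], rule sum.cong[OF refl]) (rule sq[OF l3])
  also have "\<dots> = (\<Sum>i<?d. \<Sum>k<?d. \<Sum>j<?d. (T (?E i) (?E j) (?F k))\<^sup>2)"
    by (rule sum.cong[OF refl]) (rule sum.swap)
  also have "\<dots> = (\<Sum>i<?d. \<Sum>k<?d. \<Sum>j<?d. (T (?E i) (?F j) (?F k))\<^sup>2)"
    by (rule sum.cong[OF refl], rule sum.cong[OF refl]) (rule sq[OF l2])
  also have "\<dots> = (\<Sum>k<?d. \<Sum>i<?d. \<Sum>j<?d. (T (?E i) (?F j) (?F k))\<^sup>2)" by (rule sum.swap)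
  also have "\<dots> = (\<Sum>k<?d. \<Sum>j<?d. \<Sum>i<?d. (T (?E i) (?F j) (?F k))\<^sup>2)"
    by (rule sum.cong[OF refl]) (rule sum.swap)
  also have "\<dots> = (\<Sum>k<?d. \<Sum>j<?d. \<Sum>i<?d. (T (?F i) (?F j) (?F k))\<^sup>2)"
    by (rule sum.cong[OF refl], rule sum.cong[OF refl]) (rule sq[OF l1])
  finally have eq: "(\<Sum>i<?d. \<Sum>j<?d. \<Sum>k<?d. (T (?E i) (?E j) (?E k))\<^sup>2) = \<dots>" .
  have nn: "(cov_vstar_norm M D p)\<^sup>2 = (\<Sum>i<?d. \<Sum>j<?d. \<Sum>k<?d. (T (?E i) (?E j) (?E k))\<^sup>2)"
    unfolding cov_vstar_norm_def Let_def dim_sum T_def by (rule real_sqrt_pow2) (intro sum_nonneg zero_le_power2)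
  have "(\<Sum>k<\<nu>. \<Sum>j<\<nu>. \<Sum>i<n. (T (A i p) (V j p) (V k p))\<^sup>2) \<le> (\<Sum>k<?d. \<Sum>j<?d. \<Sum>i<?d. (T (?F i) (?F j) (?F k))\<^sup>2)"
  proof -
    have 1: "(\<Sum>i<n. F (A i p)) \<le> (\<Sum>i<?d. F (?F i))" if "\<And>e. F e \<ge> 0" for F :: "'e \<Rightarrow> real"
      unfolding sum_frame_vec using that by (simp add: sum_nonneg)
    have 2: "(\<Sum>i<\<nu>. F (V i p)) \<le> (\<Sum>i<?d. F (?F i))" if "\<And>e. F e \<ge> 0" for F :: "'e \<Rightarrow> real"
      unfolding sum_frame_vec using that by (simp add: sum_nonneg)
    have "(\<Sum>k<\<nu>. \<Sum>j<\<nu>. \<Sum>i<n. (T (A i p) (V j p) (V k p))\<^sup>2) \<le> (\<Sum>k<\<nu>. \<Sum>j<\<nu>. \<Sum>i<?d. (T (?F i) (V j p) (V k p))\<^sup>2)"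
      by (intro sum_mono 1[of "\<lambda>e. (T e _ _)\<^sup>2"]) simp
    also have "\<dots> \<le> (\<Sum>k<\<nu>. \<Sum>j<?d. \<Sum>i<?d. (T (?F i) (?F j) (V k p))\<^sup>2)"
      by (intro sum_mono 2[of "\<lambda>e. \<Sum>i<?d. (T (?F i) e _)\<^sup>2"] sum_nonneg) simp
    also have "\<dots> \<le> (\<Sum>k<?d. \<Sum>j<?d. \<Sum>i<?d. (T (?F i) (?F j) (?F k))\<^sup>2)"
      by (intro 2[of "\<lambda>e. \<Sum>j<?d. \<Sum>i<?d. (T (?F i) (?F j) e)\<^sup>2"] sum_nonneg) simp
    finally show ?thesis .
  qed
  also have "\<dots> = (cov_vstar_norm M D p)\<^sup>2" unfolding nn eq ..
  also have "(\<Sum>k<\<nu>. \<Sum>j<\<nu>. \<Sum>i<n. (T (A i p) (V j p) (V k p))\<^sup>2) = (\<Sum>k<\<nu>. \<Sum>i<n. \<Sum>j<\<nu>. (T (A i p) (V j p) (V k p))\<^sup>2)"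
    by (rule sum.cong[OF refl]) (rule sum.swap)
  also have "\<dots> = (\<Sum>i<n. \<Sum>k<\<nu>. \<Sum>j<\<nu>. (T (A i p) (V j p) (V k p))\<^sup>2)" by (rule sum.swap)
  also have "\<dots> = (\<Sum>i<n. \<Sum>j<\<nu>. \<Sum>k<\<nu>. (T (A i p) (V j p) (V k p))\<^sup>2)"
    by (rule sum.cong[OF refl]) (rule sum.swap)
  also have "\<dots> = (\<Sum>i<n. \<Sum>k<\<nu>. \<Sum>j<\<nu>. (Nb (A i) (vstar M) p (gmet M p (V k p)) (gmet M p (V j p)))\<^sup>2)"
  proof (intro sum.cong refl)
    fix i k j assume i: "i \<in> {..<n}"
    obtain a where a: "form1 a" "a p = gmet M p (V k p)" by (rule covector_cases[OF lg])
    obtain b where b: "form1 b" "b p = gmet M p (V j p)" by (rule covector_cases[OF lg])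
    have "Nb (ext_vec (atlas M) p (A i p)) (vstar M) p (a p) (b p) = Nb (A i) (vstar M) p (a p) (b p)"
      by (rule cov_bitensor_cong[OF bitensor_vstar _ _ _ a(1) b(1)]) (use i A in \<open>simp_all add: ext_vec\<close>)
    then show "(T (A i p) (V k p) (V j p))\<^sup>2 = (Nb (A i) (vstar M) p (gmet M p (V k p)) (gmet M p (V j p)))\<^sup>2"
      by (simp add: T_def a b)
  qed
  finally show ?thesis .
qed

end

section \<open>The iterated gradient forms in an adapted frame\<close>

locale adapted_frame_fun = adapted_frame M n \<nu> D p U A V
  for M :: "('a::{t2_space, second_countable_topology}, 'e::euclidean_space) sr_foliation"
    and n \<nu> D p U A V +
  fixes f :: "'a \<Rightarrow> real"
  assumes f: "smooth_fun (atlas M) f"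
begin

abbreviation "L \<equiv> sub_laplacian M D"
abbreviation "\<omega> \<equiv> df f"

lemma form_f: "form1 \<omega>"
  by (rule one_form_differential[OF f])

lemma linear_f: "linear (\<omega> q)"
  by (rule linear_differential'[OF f])

text \<open>Stated at every q in U, and not only at p, because \<open>L f\<close> is differentiated
  afterwards.\<close>

lemma laplacian_frame:
  assumes "q \<in> U" "SF g"
  shows "L g q = (\<Sum>i<n. hess (A i) (A i) g q)"
proof -
  have "L g q = (\<Sum>i<n. hess (ext_vec (atlas M) q (A i q)) (ext_vec (atlas M) q (A i q)) g q)"
    unfolding sub_laplacian_def by (rule trH_adapted[OF assms(1) linear_hess[OF assms(2)]])
  also have "\<dots> = (\<Sum>i<n. hess (A i) (A i) g q)"
    by (rule sum.cong[OF refl], rule hess_cong) (use A assms in \<open>simp_all add: ext_vec\<close>)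
  finally show ?thesis .
qed

lemma eventually_laplacian: "\<forall>\<^sub>F q in nhds p. L f q = (\<Sum>i<n. hess (A i) (A i) f q)"
  using eventually_nhds_in_open[OF U] by (rule eventually_mono) (rule laplacian_frame[OF _ f])

lemma sf_hess_A: "i < n \<Longrightarrow> SF (hess (A i) (A i) f)"
  using A f by (intro sf_hess) auto

text \<open>Near p the function \<open>L f\<close> equals a finite sum of globally smooth functions,
  and a differential sees only that neighbourhood.\<close>

lemma linear_differential_laplacian: "linear (df (L f) p)"
  unfolding differential_cong[OF eventually_laplacian]
  by (rule linear_differential', rule sf_sum) (simp add: sf_hess_A)

text \<open>Differentiating the frame sum also differentiates the frame. Those terms are a trace of
  the Hessian against \<open>N Z (A i)\<close> and vanish by \<open>frame_trace_parallel\<close>, as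
  if the frame were parallel at p.\<close>

lemma differential_laplacian:
  assumes Z: "VF Z"
  shows "df (L f) p (Z p) = (\<Sum>i<n. third Z (A i) (A i) f p)"
proof -
  have "df (L f) p (Z p) = dir Z (\<lambda>q. \<Sum>i<n. hess (A i) (A i) f q) p"
    unfolding differential_cong[OF eventually_laplacian] along_def ..
  also have "\<dots> = (\<Sum>i<n. dir Z (hess (A i) (A i) f) p)"
    by (rule along_sum) (simp add: sf_hess_A)
  also have "\<dots> = (\<Sum>i<n. third Z (A i) (A i) f p + (hess (N Z (A i)) (A i) f p + hess (A i) (N Z (A i)) f p))"
    by (simp add: third_def)
  also have "\<dots> = (\<Sum>i<n. third Z (A i) (A i) f p)"
  proof -
    let ?T = "\<lambda>u w. hess (ext_vec (atlas M) p u) (ext_vec (atlas M) p w) f p"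
    have T: "?T (X p) (Y p) = hess X Y f p" if "VF X" "VF Y" for X Y
      by (rule hess_cong) (use that f in \<open>simp_all add: ext_vec\<close>)
    have "(\<Sum>i<n. hess (N Z (A i)) (A i) f p + hess (A i) (N Z (A i)) f p) =
      (\<Sum>i<n. ?T (N Z (A i) p) (A i p) + ?T (A i p) (N Z (A i) p))"
      by (rule sum.cong[OF refl]) (use A Z in \<open>simp add: T N_vf\<close>)
    also have "\<dots> = 0" by (rule frame_trace_parallel[OF Z, of ?T, OF linear_hess[OF f]])
    finally show ?thesis by (simp add: sum.distrib)
  qed
  finally show ?thesis .
qed

text \<open>The i-th summand of the rough Laplacian of df.\<close>

definition rough :: "nat \<Rightarrow> 'e \<Rightarrow> real" where
  "rough i w = Nf (A i) (Nf (A i) \<omega>) p w - Nf (N (A i) (A i)) \<omega> p w"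

lemma linear_rough: "i < n \<Longrightarrow> linear (rough i)"
  unfolding rough_def[abs_def]
  by (intro linear_compose_sub one_form_linear one_form_cov N_vf form_f A)

lemma sub_laplacian_bitensor_frame:
  assumes s: "bitensor s"
  shows "sub_laplacian_bitensor M D s p (\<omega> p) (\<omega> p) = (\<Sum>i<n. hess_bitensor M D (A i) (A i) s p (\<omega> p) (\<omega> p))"
proof -
  note t = hess_bitensor_tensorial[OF s form_f form_f, where p = p]
  let ?H = "\<lambda>X Z. hess_bitensor M D X Z s p (\<omega> p) (\<omega> p)"
  have l1: "linear (\<lambda>u. ?H (ext_vec (atlas M) p u) (ext_vec (atlas M) p w))" for w
    by (rule vf_tensorial_linear[where \<Phi> = "\<lambda>X. ?H X (ext_vec (atlas M) p w)"])
      (rule t; simp add: ext_vec)+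
  have l2: "linear (\<lambda>w. ?H (ext_vec (atlas M) p u) (ext_vec (atlas M) p w))" for u
    by (rule vf_tensorial_linear[where \<Phi> = "\<lambda>Z. ?H (ext_vec (atlas M) p u) Z"])
      (rule t; simp add: ext_vec)+
  have "sub_laplacian_bitensor M D s p (\<omega> p) (\<omega> p) =
      (\<Sum>i<n. ?H (ext_vec (atlas M) p (A i p)) (ext_vec (atlas M) p (A i p)))"
    unfolding sub_laplacian_bitensor_def by (rule trH_adapted[OF U(2) l1 l2])
  also have "\<dots> = (\<Sum>i<n. ?H (A i) (A i))"
  proof (rule sum.cong[OF refl])
    fix i assume "i \<in> {..<n}"
    then have Ai: "VF (A i)" using A by simp
    let ?e = "ext_vec (atlas M) p (A i p)"
    have "?H ?e ?e = ?H (A i) ?e"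
      by (rule vf_tensorial[of "\<lambda>X. ?H X ?e" p, OF t(1)[OF _ _ ext_vec(1)] t(2)[OF _ _ ext_vec(1)] ext_vec(1) Ai ext_vec(2)])
    also have "\<dots> = ?H (A i) (A i)"
      by (rule vf_tensorial[of "\<lambda>Z. ?H (A i) Z" p, OF t(3)[OF Ai] t(4)[OF _ Ai] ext_vec(1) Ai ext_vec(2)])
    finally show "?H ?e ?e = ?H (A i) (A i)" .
  qed
  finally show ?thesis .
qed

text \<open>The Bochner formula summed over the frame. The last bracket is the commutator of the
  Laplacian with d, paired with df; curvature and torsion enter only there.\<close>

lemma Gam2_frame:
  assumes s: "bitensor s"
  shows "Gam2 L M s f f p = 1/2 * sub_laplacian_bitensor M D s p (\<omega> p) (\<omega> p)
    + 2 * (\<Sum>i<n. Nb (A i) s p (Nf (A i) \<omega> p) (\<omega> p)) + (\<Sum>i<n. s p (Nf (A i) \<omega> p) (Nf (A i) \<omega> p))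
    + ((\<Sum>i<n. s p (rough i) (\<omega> p)) - s p (df (L f) p) (\<omega> p))"
proof -
  let ?G = "\<lambda>q. s q (\<omega> q) (\<omega> q)"
  have G: "Gam M s f f = ?G" by (rule ext) (simp add: Gam_def)
  have "SF ?G" by (rule bitensor_smooth[OF s form_f form_f])
  then have "L ?G p = (\<Sum>i<n. hess (A i) (A i) ?G p)" by (rule laplacian_frame[OF U(2)])
  also have "\<dots> = (\<Sum>i<n. hess_bitensor M D (A i) (A i) s p (\<omega> p) (\<omega> p) + 4 * Nb (A i) s p (Nf (A i) \<omega> p) (\<omega> p)
      + 2 * s p (rough i) (\<omega> p) + 2 * s p (Nf (A i) \<omega> p) (Nf (A i) \<omega> p))"
    unfolding rough_def[abs_def] by (rule sum.cong[OF refl], rule bochner[OF s f]) (use A in simp)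
  also have "\<dots> = sub_laplacian_bitensor M D s p (\<omega> p) (\<omega> p) + 4 * (\<Sum>i<n. Nb (A i) s p (Nf (A i) \<omega> p) (\<omega> p))
      + 2 * (\<Sum>i<n. s p (rough i) (\<omega> p)) + 2 * (\<Sum>i<n. s p (Nf (A i) \<omega> p) (Nf (A i) \<omega> p))"
    unfolding sub_laplacian_bitensor_frame[OF s] by (simp add: sum.distrib sum_distrib_left)
  finally have 1: "L ?G p = \<dots>" .
  have 2: "s p (\<omega> p) (df (L f) p) = s p (df (L f) p) (\<omega> p)"
    by (rule bitensor_commute[OF s linear_f linear_differential_laplacian])
  show ?thesis
    unfolding Gam2_def G 1 Gam_def 2 by simp
qed

text \<open>On U, \<open>grad_h\<close> and \<open>grad_v\<close> are the vectors dual to df for the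
  two metrics; they are global smooth fields because the frame is, so derivatives and curvatures may
  be taken of them.\<close>

definition grad_h :: "'a \<Rightarrow> 'e" where "grad_h q = (\<Sum>i<n. dir (A i) f q *\<^sub>R A i q)"
definition grad_v :: "'a \<Rightarrow> 'e" where "grad_v q = (\<Sum>k<\<nu>. dir (V k) f q *\<^sub>R V k q)"

lemma vf_grad_h: "VF grad_h"
  unfolding grad_h_def[abs_def] using A f by (intro vf_sum vf_scale sf_along) auto

lemma vf_grad_v: "VF grad_v"
  unfolding grad_v_def[abs_def] using V f by (intro vf_sum vf_scale sf_along) auto

lemma grad_h_in: "grad_h q \<in> hor M q"
  unfolding grad_h_def using A by (intro subspace_sum subspace_scale subspace_hor) auto

lemma grad_v_in: "grad_v q \<in> ver M q"
  unfolding grad_v_def using V by (intro subspace_sum subspace_scale subspace_ver) auto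

lemma hstar_f: "linear \<alpha> \<Longrightarrow> hstar M p \<alpha> (\<omega> p) = \<alpha> (grad_h p)"
  by (simp add: hstar_frame[OF U(2)] linear_f grad_h_def linear_sum linear_scale along_def mult.commute)

lemma vstar_f: "linear \<alpha> \<Longrightarrow> vstar M p \<alpha> (\<omega> p) = \<alpha> (grad_v p)"
  by (simp add: vstar_frame[OF U(2)] linear_f grad_v_def linear_sum linear_scale along_def mult.commute)

lemma hmet_grad_h:
  assumes w: "w \<in> hor M p"
  shows "hmet M p w (grad_h p) = \<omega> p w"
proof -
  have "hmet M p w (grad_h p) = hmet M p (grad_h p) w"
    by (rule inner_on_commute[OF inner_hor w grad_h_in])
  also have "\<dots> = (\<Sum>i<n. hmet M p (dir (A i) f p *\<^sub>R A i p) w)"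
    unfolding grad_h_def by (rule inner_on_sum[OF inner_hor]) (use A w in \<open>auto intro: subspace_scale\<close>)
  also have "\<dots> = (\<Sum>i<n. hmet M p w (A i p) * \<omega> p (A i p))"
    by (rule sum.cong) (use A w in \<open>simp_all add: inner_on_scale[OF inner_hor] inner_on_commute[OF inner_hor w] along_def\<close>)
  also have "\<dots> = \<omega> p (\<Sum>i<n. hmet M p w (A i p) *\<^sub>R A i p)"
    by (simp add: linear_sum[OF linear_f] linear_scale[OF linear_f])
  finally show ?thesis by (simp only: hor_expansion[OF w])
qed

lemma vmet_grad_v:
  assumes w: "w \<in> ver M p"
  shows "vmet M p w (grad_v p) = \<omega> p w"
proof -
  have "vmet M p w (grad_v p) = vmet M p (grad_v p) w"
    by (rule inner_on_commute[OF inner_ver w grad_v_in])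
  also have "\<dots> = (\<Sum>i<\<nu>. vmet M p (dir (V i) f p *\<^sub>R V i p) w)"
    unfolding grad_v_def by (rule inner_on_sum[OF inner_ver]) (use V w in \<open>auto intro: subspace_scale\<close>)
  also have "\<dots> = (\<Sum>i<\<nu>. vmet M p w (V i p) * \<omega> p (V i p))"
    by (rule sum.cong) (use V w in \<open>simp_all add: inner_on_scale[OF inner_ver] inner_on_commute[OF inner_ver w] along_def\<close>)
  also have "\<dots> = \<omega> p (\<Sum>i<\<nu>. vmet M p w (V i p) *\<^sub>R V i p)"
    by (simp add: linear_sum[OF linear_f] linear_scale[OF linear_f])
  finally show ?thesis by (simp only: ver_expansion[OF w])
qed

text \<open>A Weitzenboeck formula for df: \<open>third_bochner\<close> summed over the frame, with
  the terms \<open>third Z (A i) (A i)\<close> adding up to the differential of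
  \<open>L f\<close>.\<close>

lemma rough_sum:
  assumes Z: "VF Z"
  shows "(\<Sum>i<n. rough i (Z p)) - df (L f) p (Z p) =
    (\<Sum>i<n. - \<omega> p (ring_curv M D (A i) Z (A i) p)) + 2 * (\<Sum>i<n. hess (A i) (RF (A i) Z) f p)
    + (\<Sum>i<n. \<omega> p (cov_hcurv M D p (A i p) (A i p) (Z p)))"
proof -
  have "rough i (Z p) = third Z (A i) (A i) f p + (- \<omega> p (ring_curv M D (A i) Z (A i) p) + 2 * hess (A i) (RF (A i) Z) f p
    + \<omega> p (cov_hcurv M D p (A i p) (A i p) (Z p)))" if "i < n" for i
    using cov_cov_form_differential[OF f A(1)[OF that] A(1)[OF that] Z, of p] third_bochner[OF f A(1)[OF that] Z, of p]
    by (simp add: rough_def)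
  then have "(\<Sum>i<n. rough i (Z p)) = (\<Sum>i<n. third Z (A i) (A i) f p + (- \<omega> p (ring_curv M D (A i) Z (A i) p) + 2 * hess (A i) (RF (A i) Z) f p
    + \<omega> p (cov_hcurv M D p (A i p) (A i p) (Z p))))"
    by (intro sum.cong) auto
  then show ?thesis
    unfolding differential_laplacian[OF Z] sum.distrib sum_distrib_left by linarith
qed

lemma Ric_H_frame:
  assumes Z: "VF Z" "\<And>q. Z q \<in> hor M q"
  shows "Ric_H M D p (Z p) (Z p) = (\<Sum>i<n. hmet M p (ring_curv M D (A i) Z Z p) (A i p))"
proof -
  let ?z = "ext_vec (atlas M) p (Z p)"
  let ?R = "\<lambda>u. ring_curv M D (ext_vec (atlas M) p u) ?z ?z p"
  let ?T = "\<lambda>e e'. gmet M p (?R (prH M p e)) e'"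
  have R: "linear ?R"
    by (rule vf_tensorial_linear[where \<Phi> = "\<lambda>X. ring_curv M D X ?z ?z p"])
      (simp_all add: ring_curv_add_left ring_curv_scale_left ext_vec)
  have l1: "linear (\<lambda>e. ?T e e')" for e'
    using linear_compose[OF linear_compose[OF linear_prH R] linear_gmet_left] by (simp add: o_def)
  have "Ric_H M D p (Z p) (Z p) = (\<Sum>i<n. ?T (A i p) (A i p)) + (\<Sum>j<\<nu>. ?T (V j p) (V j p))"
    unfolding Ric_H_def by (rule trG_adapted[OF l1 linear_gmet])
  also have "(\<Sum>j<\<nu>. ?T (V j p) (V j p)) = 0"
    using V by (intro sum.neutral) (simp add: linear_0[OF R] linear_0[OF linear_gmet_left])
  also have "(\<Sum>i<n. ?T (A i p) (A i p)) = (\<Sum>i<n. hmet M p (ring_curv M D (A i) Z Z p) (A i p))"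
  proof (rule sum.cong[OF refl])
    fix i assume i: "i \<in> {..<n}"
    have "?R (A i p) = ring_curv M D (A i) Z Z p"
      by (rule ring_curv_cong) (use i A Z in \<open>simp_all add: ext_vec\<close>)
    then show "?T (A i p) (A i p) = hmet M p (ring_curv M D (A i) Z Z p) (A i p)"
      using i A Z by (simp add: gmet_hor ring_curv_in_hor)
  qed
  finally show ?thesis by simp
qed

text \<open>The derivative of R is vertical-valued, so pairing it with the full gradient amounts to
  applying df; it vanishes on \<open>grad_v\<close> in the last slot and on a repeated vertical
  vector in the first two. As both arguments agree, symmetrisation cancels the factor 1/2.\<close>

lemma Ric_HV_frame:
  "Ric_HV M D p (grad_h p + grad_v p) (grad_h p + grad_v p) =
    (\<Sum>i<n. \<omega> p (cov_hcurv M D p (A i p) (A i p) (grad_h p)))"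
proof -
  let ?z = "grad_h p + grad_v p"
  let ?C = "\<lambda>e e'. gmet M p ?z (cov_hcurv M D p e e' ?z)"
  have l: "linear (\<lambda>e. ?C e e' + ?C e e')" "linear (\<lambda>e'. ?C e e' + ?C e e')" for e e'
    using linear_compose[OF linear_cov_hcurv(1) linear_gmet] linear_compose[OF linear_cov_hcurv(2) linear_gmet]
    by (auto simp: o_def intro!: linear_scaled)
  have "Ric_HV M D p ?z ?z = 1/2 * ((\<Sum>i<n. ?C (A i p) (A i p) + ?C (A i p) (A i p)) + (\<Sum>j<\<nu>. ?C (V j p) (V j p) + ?C (V j p) (V j p)))"
    unfolding Ric_HV_def by (subst trG_adapted[OF l]) simp
  also have "(\<Sum>j<\<nu>. ?C (V j p) (V j p) + ?C (V j p) (V j p)) = 0"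
    using V cov_hcurv_ver_12[OF _ vf_add[OF vf_grad_h vf_grad_v], of _ p]
    by (intro sum.neutral) (simp add: linear_0[OF linear_gmet])
  also have "(\<Sum>i<n. ?C (A i p) (A i p) + ?C (A i p) (A i p)) = (\<Sum>i<n. 2 * \<omega> p (cov_hcurv M D p (A i p) (A i p) (grad_h p)))"
  proof (rule sum.cong[OF refl])
    fix i assume "i \<in> {..<n}"
    then have Ai: "VF (A i)" using A by simp
    let ?c = "cov_hcurv M D p (A i p) (A i p) (grad_h p)"
    have c: "?c \<in> ver M p" by (rule cov_hcurv_in_ver[OF Ai Ai vf_grad_h])
    have "cov_hcurv M D p (A i p) (A i p) ?z = ?c"
      using cov_hcurv_ver_3[OF Ai Ai vf_grad_v grad_v_in, of p] linear_add[OF linear_cov_hcurv(3)[of p "A i p" "A i p"]]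
      by simp
    moreover have "gmet M p ?z ?c = \<omega> p ?c"
      unfolding gmet_commute[of p ?z] gmet_ver[OF c] prV_sum[OF grad_h_in grad_v_in] by (rule vmet_grad_v[OF c])
    ultimately show "?C (A i p) (A i p) + ?C (A i p) (A i p) = 2 * \<omega> p ?c" by simp
  qed
  finally show ?thesis by (simp add: sum_distrib_left[symmetric])
qed

section \<open>Components in the frame and the two iterated forms\<close>

definition H where "H i j = hess (A i) (A j) f p"
definition \<beta> where "\<beta> i k = hess (A i) (V k) f p"
definition \<rho> where "\<rho> i k = vmet M p (hcurv M p (A i p) (grad_h p)) (V k p)"
text \<open>The covectors \<open>gmet M p (V k p)\<close> are dual to the vertical frame, so Q lists
  the components of the derivative of \<open>vstar\<close> after df fills one slot.\<close>

definition Q where "Q i k = Nb (A i) (vstar M) p (gmet M p (V k p)) (\<omega> p)"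

lemma Nf_f: "i < n \<Longrightarrow> VF Y \<Longrightarrow> Nf (A i) \<omega> p (Y p) = hess (A i) Y f p"
  by (rule cov_form_differential[OF f A(1)])

lemma linear_Nf: "i < n \<Longrightarrow> linear (Nf (A i) \<omega> p)"
  by (intro one_form_linear one_form_cov form_f A)

lemma hess_RF_grad_h:
  assumes i: "i < n"
  shows "hess (A i) (RF (A i) grad_h) f p = (\<Sum>k<\<nu>. \<rho> i k * \<beta> i k)"
proof -
  have "hess (A i) (RF (A i) grad_h) f p = Nf (A i) \<omega> p (hcurv M p (A i p) (grad_h p))"
    using Nf_f[OF i vf_hcurv[OF A(1)[OF i] vf_grad_h]] by simp
  also have "\<dots> = Nf (A i) \<omega> p (\<Sum>k<\<nu>. \<rho> i k *\<^sub>R V k p)"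
    unfolding \<rho>_def by (simp only: ver_expansion[OF hcurv_in_ver])
  also have "\<dots> = (\<Sum>k<\<nu>. \<rho> i k * \<beta> i k)"
    using V by (simp add: linear_sum[OF linear_Nf[OF i]] linear_scale[OF linear_Nf[OF i]] Nf_f[OF i] \<beta>_def)
  finally show ?thesis .
qed

lemma Gam2_hstar:
  "Gam2 L M (hstar M) f f p = (\<Sum>i<n. \<Sum>j<n. (H i j)\<^sup>2) + Ric_H M D p (grad_h p) (grad_h p)
    + 2 * (\<Sum>i<n. \<Sum>k<\<nu>. \<rho> i k * \<beta> i k)
    + Ric_HV M D p (grad_h p + grad_v p) (grad_h p + grad_v p)"
proof -
  have 1: "sub_laplacian_bitensor M D (hstar M) p (\<omega> p) (\<omega> p) = 0"
    using A by (simp add: sub_laplacian_bitensor_frame[OF bitensor_hstar] hess_hstar_zero[OF _ _ form_f form_f])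
  have 2: "(\<Sum>i<n. Nb (A i) (hstar M) p (Nf (A i) \<omega> p) (\<omega> p)) = 0"
    using A by (intro sum.neutral) (simp add: cov_hstar_zero[OF _ one_form_cov[OF form_f] form_f])
  have 3: "(\<Sum>i<n. hstar M p (Nf (A i) \<omega> p) (Nf (A i) \<omega> p)) = (\<Sum>i<n. \<Sum>j<n. (H i j)\<^sup>2)"
    using A by (intro sum.cong) (simp_all add: hstar_frame[OF U(2)] linear_Nf Nf_f H_def power2_eq_square)
  have "(\<Sum>i<n. hstar M p (rough i) (\<omega> p)) - hstar M p (df (L f) p) (\<omega> p) = (\<Sum>i<n. rough i (grad_h p)) - df (L f) p (grad_h p)"
    by (simp add: hstar_f linear_rough linear_differential_laplacian)
  also have "\<dots> = Ric_H M D p (grad_h p) (grad_h p) + 2 * (\<Sum>i<n. \<Sum>k<\<nu>. \<rho> i k * \<beta> i k)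
      + Ric_HV M D p (grad_h p + grad_v p) (grad_h p + grad_v p)"
  proof -
    \<comment> \<open>df of a horizontal vector is its product with \<open>grad_h\<close>;
      skew-symmetry of the curvature then moves \<open>A i\<close> to the outer slot, which produces
      the Ricci trace.\<close>
    have "(\<Sum>i<n. - \<omega> p (ring_curv M D (A i) grad_h (A i) p)) = (\<Sum>i<n. hmet M p (ring_curv M D (A i) grad_h grad_h p) (A i p))"
    proof (rule sum.cong[OF refl])
      fix i assume "i \<in> {..<n}"
      then have Ai: "VF (A i)" "\<And>q. A i q \<in> hor M q" using A by auto
      show "- \<omega> p (ring_curv M D (A i) grad_h (A i) p) = hmet M p (ring_curv M D (A i) grad_h grad_h p) (A i p)"
        using hmet_grad_h[OF ring_curv_in_hor[OF Ai(1) vf_grad_h Ai]]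
          ring_curv_metric[OF Ai(1) vf_grad_h Ai vf_grad_h grad_h_in, of p] by simp
    qed
    moreover have "(\<Sum>i<n. hess (A i) (RF (A i) grad_h) f p) = (\<Sum>i<n. \<Sum>k<\<nu>. \<rho> i k * \<beta> i k)"
      by (rule sum.cong) (simp_all add: hess_RF_grad_h)
    ultimately show ?thesis
      unfolding rough_sum[OF vf_grad_h] Ric_H_frame[OF vf_grad_h grad_h_in] Ric_HV_frame by (simp only:)
  qed
  finally show ?thesis
    unfolding Gam2_frame[OF bitensor_hstar] 1 2 3 by simp
qed

text \<open>\<alpha> minus its part in the span of the covectors \<open>gmet M p (V k p)\<close>
  annihilates vertical vectors, and \<open>cov_vstar_annihilator\<close> discards the
  difference.\<close>

lemma cov_vstar_expand:
  assumes i: "i < n" and \<alpha>: "linear \<alpha>" and \<eta>: "linear \<eta>"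
  shows "Nb (A i) (vstar M) p \<alpha> \<eta> = (\<Sum>k<\<nu>. Nb (A i) (vstar M) p (gmet M p (V k p)) \<eta> * \<alpha> (V k p))"
proof -
  let ?s = "Nb (A i) (vstar M)"
  note b = bitensor_cov[OF bitensor_vstar A(1)[OF i]]
  have sum: "linear (\<lambda>w. \<Sum>k<m. \<alpha> (V k p) * gmet M p (V k p) w) \<and>
    ?s p (\<lambda>w. \<Sum>k<m. \<alpha> (V k p) * gmet M p (V k p) w) \<eta> = (\<Sum>k<m. ?s p (gmet M p (V k p)) \<eta> * \<alpha> (V k p))" for m
  proof (induction m)
    case 0
    have "linear (\<lambda>w::'e. 0::real)" by (simp add: linear_iff)
    then show ?case using bitensor_scale[OF b _ \<eta>, of "\<lambda>w. 0" p 0] by simp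
  next
    case (Suc m)
    have l: "linear (\<lambda>w. \<alpha> (V m p) * gmet M p (V m p) w)" by (rule linear_scaled[OF linear_gmet])
    have "?s p (\<lambda>w. \<alpha> (V m p) * gmet M p (V m p) w) \<eta> = \<alpha> (V m p) * ?s p (gmet M p (V m p)) \<eta>"
      by (rule bitensor_scale[OF b linear_gmet \<eta>])
    then show ?case
      using Suc bitensor_add[OF b _ l \<eta>, of "\<lambda>w. \<Sum>k<m. \<alpha> (V k p) * gmet M p (V k p) w" p]
        linear_compose_add[OF _ l, of "\<lambda>w. \<Sum>k<m. \<alpha> (V k p) * gmet M p (V k p) w"]
      by (simp add: mult.commute)
  qed
  let ?\<gamma> = "\<lambda>w. \<Sum>k<\<nu>. \<alpha> (V k p) * gmet M p (V k p) w"
  have \<gamma>: "linear ?\<gamma>" using sum by blast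
  have ann: "\<alpha> w - ?\<gamma> w = 0" if w: "w \<in> ver M p" for w
  proof -
    have "\<alpha> w = \<alpha> (\<Sum>k<\<nu>. vmet M p w (V k p) *\<^sub>R V k p)" by (simp only: ver_expansion[OF w])
    also have "\<dots> = ?\<gamma> w"
      unfolding linear_sum[OF \<alpha>]
      by (rule sum.cong) (use V w in \<open>simp_all add: linear_scale[OF \<alpha>] gmet_ver inner_on_commute[OF inner_ver w]\<close>)
    finally show ?thesis by simp
  qed
  have "?s p (\<lambda>w. (\<alpha> w - ?\<gamma> w) + ?\<gamma> w) \<eta> = ?s p (\<lambda>w. \<alpha> w - ?\<gamma> w) \<eta> + ?s p ?\<gamma> \<eta>"
    by (rule bitensor_add[OF b linear_compose_sub[OF \<alpha> \<gamma>] \<gamma> \<eta>])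
  moreover have "?s p (\<lambda>w. \<alpha> w - ?\<gamma> w) \<eta> = 0"
    by (rule cov_vstar_annihilator[OF A(1)[OF i] linear_compose_sub[OF \<alpha> \<gamma>] \<eta> ann])
  ultimately show ?thesis using sum[of \<nu>] by simp
qed

lemma Gam2_vstar:
  "Gam2 L M (vstar M) f f p = 1/2 * sub_laplacian_bitensor M D (vstar M) p (\<omega> p) (\<omega> p)
    + 2 * (\<Sum>i<n. \<Sum>k<\<nu>. Q i k * \<beta> i k) + (\<Sum>i<n. \<Sum>k<\<nu>. (\<beta> i k)\<^sup>2)"
proof -
  have 2: "(\<Sum>i<n. Nb (A i) (vstar M) p (Nf (A i) \<omega> p) (\<omega> p)) = (\<Sum>i<n. \<Sum>k<\<nu>. Q i k * \<beta> i k)"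
    using V by (intro sum.cong) (simp_all add: cov_vstar_expand linear_Nf linear_f Nf_f \<beta>_def Q_def)
  have 3: "(\<Sum>i<n. vstar M p (Nf (A i) \<omega> p) (Nf (A i) \<omega> p)) = (\<Sum>i<n. \<Sum>k<\<nu>. (\<beta> i k)\<^sup>2)"
    using V by (intro sum.cong) (simp_all add: vstar_frame[OF U(2)] linear_Nf Nf_f \<beta>_def power2_eq_square)
  have "(\<Sum>i<n. vstar M p (rough i) (\<omega> p)) - vstar M p (df (L f) p) (\<omega> p) = (\<Sum>i<n. rough i (grad_v p)) - df (L f) p (grad_v p)"
    by (simp add: vstar_f linear_rough linear_differential_laplacian)
  also have "\<dots> = 0"
  proof -
    \<comment> \<open>df of this horizontal vector is its product with \<open>grad_h\<close>, a
      mixed curvature component that \<open>ring_curv_hor_ver\<close> makes zero.\<close>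
    have "\<omega> p (ring_curv M D (A i) grad_v (A i) p) = 0" if "i < n" for i
      using hmet_grad_h[OF ring_curv_in_hor[OF A(1)[OF that] vf_grad_v A(1)[OF that] A(2)[OF that]]]
        ring_curv_hor_ver[OF vf_grad_v grad_v_in A(1)[OF that] A(2)[OF that] A(1)[OF that] A(2)[OF that] vf_grad_h grad_h_in, of p]
      by simp
    moreover have "hess (A i) (RF (A i) grad_v) f p = 0" if "i < n" for i
      using hess_scale_right[OF sf_const[of 0] A(1)[OF that] vf_zero f, of p]
      by (simp add: hcurv_field_ver_zero[OF A(1)[OF that] vf_grad_v grad_v_in])
    moreover have "cov_hcurv M D p (A i p) (A i p) (grad_v p) = 0" if "i < n" for i
      by (rule cov_hcurv_ver_3[OF A(1)[OF that] A(1)[OF that] vf_grad_v grad_v_in])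
    ultimately show ?thesis
      unfolding rough_sum[OF vf_grad_v] by (simp add: linear_0[OF linear_f])
  qed
  finally show ?thesis
    unfolding Gam2_frame[OF bitensor_vstar] 2 3 by simp
qed

lemma Gam_hstar: "Gam M (hstar M) f f p = hmet M p (grad_h p) (grad_h p)"
  by (simp add: Gam_def hstar_f linear_f hmet_grad_h grad_h_in)

lemma Gam_vstar: "Gam M (vstar M) f f p = vmet M p (grad_v p) (grad_v p)"
  by (simp add: Gam_def vstar_f linear_f vmet_grad_v grad_v_in)

section \<open>Bounds on the components\<close>

text \<open>The hypothesis is the bound on R with constant 1, taken at \<open>grad_h\<close>;
  antisymmetry exchanges the arguments of R to fit \<open>end_norm\<close>.\<close>

lemma rho_bound:
  assumes "end_norm M p (hcurv M p (grad_h p)) \<le> gnorm M p (prH M p (grad_h p))"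
  shows "(\<Sum>i<n. \<Sum>k<\<nu>. (\<rho> i k)\<^sup>2) \<le> hmet M p (grad_h p) (grad_h p)"
proof -
  have "(\<rho> i k)\<^sup>2 = (vmet M p (hcurv M p (grad_h p) (A i p)) (V k p))\<^sup>2" if "k < \<nu>" for i k
  proof -
    have "hcurv M p (A i p) (grad_h p) = (-1) *\<^sub>R hcurv M p (grad_h p) (A i p)"
      using hcurv_antisym[of p "A i p" "grad_h p"] by simp
    then have "\<rho> i k = - vmet M p (hcurv M p (grad_h p) (A i p)) (V k p)"
      unfolding \<rho>_def using inner_on_scale[OF inner_ver hcurv_in_ver V(2)[OF that], where a = "-1"] by simp
    then show ?thesis by simp
  qed
  then have "(\<Sum>i<n. \<Sum>k<\<nu>. (\<rho> i k)\<^sup>2) = (end_norm M p (hcurv M p (grad_h p)))\<^sup>2"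
    unfolding end_norm_hcurv(1) by (intro sum.cong) auto
  also have "\<dots> \<le> (gnorm M p (grad_h p))\<^sup>2"
  proof (rule power_mono)
    show "end_norm M p (hcurv M p (grad_h p)) \<le> gnorm M p (grad_h p)" using assms by (simp add: grad_h_in)
    show "0 \<le> end_norm M p (hcurv M p (grad_h p))" by (rule end_norm_hcurv(2))
  qed
  also have "\<dots> = hmet M p (grad_h p) (grad_h p)"
    using inner_on_nonneg[OF inner_hor grad_h_in] by (simp add: gnorm_def gmet_hor grad_h_in)
  finally show ?thesis .
qed

text \<open>df is expanded in the vertical frame and Cauchy-Schwarz is applied for each i and k.
  \<open>cov_vstar_expand\<close> acts on the first slot, hence the exchanges of arguments.\<close>

lemma Q_bound: "(\<Sum>i<n. \<Sum>k<\<nu>. (Q i k)\<^sup>2) \<le> (cov_vstar_norm M D p)\<^sup>2 * vmet M p (grad_v p) (grad_v p)"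
proof -
  let ?T = "\<lambda>i k j. Nb (A i) (vstar M) p (gmet M p (V k p)) (gmet M p (V j p))"
  have u: "vmet M p (grad_v p) (grad_v p) = (\<Sum>j<\<nu>. (\<omega> p (V j p))\<^sup>2)"
    unfolding Gam_vstar[symmetric] Gam_def by (simp add: vstar_frame[OF U(2)] linear_f power2_eq_square)
  have "(Q i k)\<^sup>2 \<le> (\<Sum>j<\<nu>. (?T i k j)\<^sup>2) * vmet M p (grad_v p) (grad_v p)" if i: "i < n" and k: "k < \<nu>" for i k
  proof -
    note b = bitensor_cov[OF bitensor_vstar A(1)[OF i]]
    have "Q i k = Nb (A i) (vstar M) p (\<omega> p) (gmet M p (V k p))"
      unfolding Q_def by (rule bitensor_commute[OF b linear_gmet linear_f])
    also have "\<dots> = (\<Sum>j<\<nu>. ?T i j k * \<omega> p (V j p))"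
      by (rule cov_vstar_expand[OF i linear_f linear_gmet])
    also have "\<dots> = (\<Sum>j<\<nu>. ?T i k j * \<omega> p (V j p))"
    proof (rule sum.cong[OF refl])
      fix j
      have "?T i j k = ?T i k j" by (rule bitensor_commute[OF b linear_gmet linear_gmet])
      then show "?T i j k * \<omega> p (V j p) = ?T i k j * \<omega> p (V j p)" by simp
    qed
    finally have "Q i k = (\<Sum>j<\<nu>. ?T i k j * \<omega> p (V j p))" .
    then have "(Q i k)\<^sup>2 \<le> (\<Sum>j<\<nu>. (?T i k j)\<^sup>2) * (\<Sum>j<\<nu>. (\<omega> p (V j p))\<^sup>2)"
      by (simp add: Cauchy_Schwarz_ineq_sum)
    then show ?thesis unfolding u .
  qed
  then have "(\<Sum>i<n. \<Sum>k<\<nu>. (Q i k)\<^sup>2) \<le> (\<Sum>i<n. \<Sum>k<\<nu>. (\<Sum>j<\<nu>. (?T i k j)\<^sup>2) * vmet M p (grad_v p) (grad_v p))"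
    by (intro sum_mono) simp
  also have "\<dots> = (\<Sum>i<n. \<Sum>k<\<nu>. \<Sum>j<\<nu>. (?T i k j)\<^sup>2) * vmet M p (grad_v p) (grad_v p)"
    by (simp add: sum_distrib_right)
  also have "\<dots> \<le> (cov_vstar_norm M D p)\<^sup>2 * vmet M p (grad_v p) (grad_v p)"
    by (rule mult_right_mono[OF cov_vstar_norm_bound inner_on_nonneg[OF inner_ver grad_v_in]])
  finally show ?thesis .
qed

lemma H_diff: "i < n \<Longrightarrow> j < n \<Longrightarrow> H i j - H j i = \<omega> p (hcurv M p (A i p) (A j p))"
  unfolding H_def by (rule hess_commute[OF A(1) A(1) f])

end

theorem theorem3p5:
  fixes M :: "('a::{t2_space, second_countable_topology}, 'e::euclidean_space) sr_foliation"
    and D :: "('a \<Rightarrow> 'e) \<Rightarrow> ('a \<Rightarrow> 'e) \<Rightarrow> ('a \<Rightarrow> 'e)"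
    and n \<nu> :: nat
    and \<rho>H Mv \<rho>\<Delta> MHV mR \<rho>1 \<rho>20 \<rho>21 l :: real
    and c :: ereal
    and L :: "('a \<Rightarrow> real) \<Rightarrow> 'a \<Rightarrow> real"
    and p :: 'a
    and f :: "'a \<Rightarrow> real"
  assumes sub_riemannian: "sub_riemannian M n"
    and complement: "complement M \<nu>" "integrable_complement M" "metric_preserving M"
    and vertical_metric: "metric_on (atlas M) (ver M) (vmet M)"
    and levi_civita: "levi_civita M D"
    and i: "is_M_R M 1"
    and ii: "\<forall>p w. Ric_H M D p w w \<ge> \<rho>H * (hnorm M p (prH M p w))\<^sup>2"
    and iii_bounded: "bdd_above (range (cov_vstar_norm M D))"
    and iii_sup: "Mv = (SUP p. cov_vstar_norm M D p)"
    and iii_laplacian: "\<forall>p \<alpha>. linear \<alpha> \<longrightarrow>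
           sub_laplacian_bitensor M D (vstar M) p \<alpha> \<alpha> \<ge> \<rho>\<Delta> * (vstar_norm M p \<alpha>)\<^sup>2"
    and iv: "MHV \<ge> 0"
           "\<forall>p z. Ric_HV M D p z z \<ge> - 2 * MHV * vnorm M p (prV M p z) * hnorm M p (prH M p z)"
    and mR: "is_m_R M mR"
    and L: "L = sub_laplacian M D"
    and c: "c > 0" "c = \<infinity> \<Longrightarrow> MHV = 0 \<and> Mv = 0"
    and \<rho>1: "\<rho>1 = \<rho>H - real_of_ereal (inverse c)"
    and \<rho>20: "\<rho>20 = 1/2 * mR\<^sup>2 - real_of_ereal (c * ereal ((MHV + Mv)\<^sup>2))"
    and \<rho>21: "\<rho>21 = 1/2 * \<rho>\<Delta> - Mv\<^sup>2"
    and l: "l > 0"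
    and f: "smooth_fun (atlas M) f"
  shows "Gam2 L M (hstar M) f f p + l * Gam2 L M (vstar M) f f p
           \<ge> 1 / real n * (L f p)\<^sup>2 + (\<rho>1 - 1 / l) * Gam M (hstar M) f f p
             + (\<rho>20 + \<rho>21 * l) * Gam M (vstar M) f f p"
proof -
  have "sr_geometry M n \<nu> D"
    by (rule sr_geometry.intro[OF sub_riemannian complement vertical_metric levi_civita])
  then obtain U A V where "adapted_frame M n \<nu> D p U A V"
    using sr_geometry.adapted_frame_exists by blast
  then have "adapted_frame_fun M n \<nu> D p U A V f"
    using f by (intro adapted_frame_fun.intro adapted_frame_fun_axioms.intro)
  then interpret F: adapted_frame_fun M n \<nu> D p U A V f .
  let ?W = "F.grad_h p" and ?U = "F.grad_v p"
  define x where "x = sqrt (hmet M p ?W ?W)"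
  define y where "y = sqrt (vmet M p ?U ?U)"
  have xy: "x \<ge> 0" "y \<ge> 0" "x\<^sup>2 = hmet M p ?W ?W" "y\<^sup>2 = vmet M p ?U ?U"
    using inner_on_nonneg[OF F.inner_hor F.grad_h_in] inner_on_nonneg[OF F.inner_ver F.grad_v_in]
    by (simp_all add: x_def y_def)
  have norms: "hnorm M p (prH M p ?W) = x" "hnorm M p (prH M p (?W + ?U)) = x" "vnorm M p (prV M p (?W + ?U)) = y"
    "vstar_norm M p (F.df f p) = y"
    using F.Gam_vstar
    by (simp_all add: hnorm_def vnorm_def vstar_norm_def x_def y_def Gam_def F.grad_h_in F.grad_v_in F.prH_sum F.prV_sum)
  have n: "n > 0" using sub_riemannian by (simp add: sub_riemannian_def)
  \<comment> \<open>Boundedness is what makes the real supremum an upper bound.\<close>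
  have Mp: "cov_vstar_norm M D p \<le> Mv" unfolding iii_sup by (rule cSUP_upper[OF UNIV_I iii_bounded])
  have Mp0: "0 \<le> cov_vstar_norm M D p"
    unfolding cov_vstar_norm_def Let_def by (intro real_sqrt_ge_zero sum_nonneg zero_le_power2)
  have Mv: "0 \<le> Mv" using Mp Mp0 by simp
  have \<rho>: "(\<Sum>i<n. \<Sum>k<\<nu>. (F.\<rho> i k)\<^sup>2) \<le> x\<^sup>2"
    unfolding xy(3) by (rule F.rho_bound) (use i in \<open>simp add: is_M_R_def\<close>)
  have "(\<Sum>i<n. \<Sum>k<\<nu>. (F.Q i k)\<^sup>2) \<le> (cov_vstar_norm M D p)\<^sup>2 * y\<^sup>2"
    unfolding xy(4) by (rule F.Q_bound)
  also have "\<dots> \<le> (Mv * y)\<^sup>2"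
    unfolding power_mult_distrib by (intro mult_right_mono power_mono Mp Mp0) simp
  finally have q: "(\<Sum>i<n. \<Sum>k<\<nu>. (F.Q i k)\<^sup>2) \<le> (Mv * y)\<^sup>2" .
  \<comment> \<open>Half the double sum is the squared wedge norm. The splitting of H retains a
    quarter of the double sum, so the coefficient of \<open>mR\<^sup>2\<close> becomes 1/2.\<close>
  have m: "(mR * y)\<^sup>2 \<le> 1/2 * (\<Sum>i<n. \<Sum>j<n. (F.H i j - F.H j i)\<^sup>2)"
  proof -
    have "mR * y \<le> wedge2_hstar_norm M p (\<lambda>u w. F.df f p (hcurv M p u w))" "0 \<le> mR"
      using mR F.linear_f unfolding is_m_R_def m_R_bound_def norms(4)[symmetric] by blast+
    then have "(mR * y)\<^sup>2 \<le> (wedge2_hstar_norm M p (\<lambda>u w. F.df f p (hcurv M p u w)))\<^sup>2"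
      using xy by (intro power_mono) simp_all
    also have "\<dots> = 1/2 * (\<Sum>i<n. \<Sum>j<n. (F.H i j - F.H j i)\<^sup>2)"
      unfolding F.wedge2_norm[OF F.linear_f] by (simp add: F.H_diff)
    finally show ?thesis .
  qed
  have Ric: "Ric_H M D p ?W ?W \<ge> \<rho>H * x\<^sup>2" using ii norms(1) by metis
  have RicHV: "Ric_HV M D p (?W + ?U) (?W + ?U) \<ge> - 2 * MHV * y * x" using iv(2) norms(2,3) by metis
  have Lap: "sub_laplacian_bitensor M D (vstar M) p (F.df f p) (F.df f p) \<ge> \<rho>\<Delta> * y\<^sup>2"
    using iii_laplacian F.linear_f norms(4) by metis
  define ci where "ci = real_of_ereal (inverse c)"
  define cm where "cm = real_of_ereal (c * ereal ((MHV + Mv)\<^sup>2))"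
  \<comment> \<open>Young's inequality with weight c. For real c it is the square of x - c (MHV +
    Mv) y, divided by c. For c = \<infinity> the hypothesis gives MHV = Mv = 0, and in
    \<open>ereal\<close> the inverse of \<infinity> and its product with 0 are 0, so both sides
    vanish.\<close>
  have cc: "2 * (MHV + Mv) * x * y \<le> ci * x\<^sup>2 + cm * y\<^sup>2"
  proof (cases c)
    case (real r)
    then have r: "r > 0" using c by simp
    have "0 \<le> (x - r * (MHV + Mv) * y)\<^sup>2 / r" using r by simp
    also have "\<dots> = ci * x\<^sup>2 + cm * y\<^sup>2 - 2 * (MHV + Mv) * x * y"
      using r by (simp add: ci_def cm_def real power2_eq_square field_simps)
    finally show ?thesis by simp
  next
    case PInf
    then show ?thesis using c by (simp add: ci_def cm_def)
  qed (use c in simp)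
  have Lf: "F.L f p = (\<Sum>i<n. F.H i i)" unfolding F.H_def by (rule F.laplacian_frame[OF F.U(2) f])
  show ?thesis
    using curvature_dimension_algebra[OF n l xy(1,2) Mv \<rho> q m Ric RicHV Lap cc, of F.\<beta>]
    unfolding L Lf F.Gam2_hstar F.Gam2_vstar F.Gam_hstar F.Gam_vstar xy(3,4)[symmetric] \<rho>1 \<rho>20 \<rho>21
      ci_def[symmetric] cm_def[symmetric]
    by simp
qed

end
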